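(* Let $\omega$ be a weight function with constants $K,b$, let $1\le p\le\infty$ and $\tau\in(0,1)$. (i) For every $\lambda\ge0$ and $f\in\mathcal{S}_\omega(\mathbb{R}^N)$, $$\|e^{\lambda\omega}\mathrm{Wig}_\tau(f)\|_\infty^2\le D_\lambda^{(3)}\,\|e^{4K^2\lambda\omega}Rf\|_p\,\|e^{4K^2\lambda\omega}Rf\|_{p'},\qquad D_\lambda^{(3)}=\frac{e^{K(1+2K)\lambda}}{(2\pi)^N(\tau-\tau^2)^N}.$$ (ii) For every $\lambda\ge0$, $\mu>\frac{2N}{b(2p)'}$ and $f\in\mathcal{S}_\omega(\mathbb{R}^N)$, $$\|e^{\lambda\omega}Rf\|_\infty\le D_{\lambda,\mu}^{(4)}\,\|e^{2K(K^2\lambda+\mu)\omega}\mathrm{Wig}_\tau(f)\|_p,$$ where $$D_{\lambda,\mu}^{(4)}=\inf_{g\in\mathcal{S}_\omega(\mathbb{R}^N),\,g\ne0}\Big[D_{\lambda,\mu}^{(2)}(g)\,e^{2K(K^2\lambda+\mu)}\,\|e^{2K(K^2\lambda+\mu)\omega}\mathrm{Wig}_{1-\tau}(\tilde g)\|_1\Big],$$ with $\tilde g(t):=g(-t)$ and $$D_{\lambda,\mu}^{(2)}(g)=\frac{e^{K(1+2K)\lambda}\,\|e^{K^2\lambda\omega}g\|_\infty\,\|e^{K^2\lambda\omega}\hat g\|_\infty\,\|e^{-\mu\omega}\|^2_{L^{(2p)'}(\mathbb{R}^{2N})}}{(2\pi)^{2N}\|g\|_2^4}.$$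
   Context: A weight function is a continuous increasing (i.e. nondecreasing) function $\omega:[0,\infty)\to[0,\infty)$ such that: ($\alpha$) there is $K\ge1$ with $\omega(2t)\le K(1+\omega(t))$ for all $t\ge0$; ($\beta$) $\omega(t)=o(t)$ as $t\to\infty$; ($\gamma$) there are $a\in\mathbb{R}$, $b>0$ with $\omega(t)\ge a+b\log(1+t)$ for all $t\ge0$; ($\delta$) $t\mapsto\omega(e^t)$ is convex. $K$ and $b$ always denote the constants in ($\alpha$) and ($\gamma$). One extends $\omega$ to $\mathbb{R}^M$ by $\omega(z)=\omega(|z|)$; in particular $\omega(x,\xi)=\omega(|(x,\xi)|)$ on $\mathbb{R}^{2N}$. Fourier transform: $\hat f(\xi)=\int_{\mathbb{R}^N}e^{-ix\xi}f(x)\,dx$. $\mathcal{S}_\omega(\mathbb{R}^N)$ is the set of all $f\in L^1(\mathbb{R}^N)$ with $f,\hat f\in C^\infty(\mathbb{R}^N)$ and $\|e^{\lambda\omega}\partial^\alpha f\|_\infty<\infty$, $\|e^{\lambda\omega}\partial^\alpha\hat f\|_\infty<\infty$ for all $\lambda>0$, $\alpha\in\mathbb{N}_0^N$. $\tau$-Wigner transform, $\tau\in[0,1]$: $\mathrm{Wig}_\tau(f)(x,\xi)=\int_{\mathbb{R}^N}e^{-it\xi}f(x+\tau t)\overline{f(x-(1-\tau)t)}\,dt$. Rihaczek form: $Rf(x,\xi)=e^{-ix\xi}f(x)\overline{\hat f(\xi)}$, $(x,\xi)\in\mathbb{R}^{2N}$. $p'$ is the conjugate exponent of $p\in[1,\infty]$;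 $(2p)'$ is defined by $\frac1{2p}+\frac1{(2p)'}=1$, with $(2p)'=1$ for $p=\infty$. Norms of functions on $\mathbb{R}^N$ are in $L^q(\mathbb{R}^N)$, norms of functions on $\mathbb{R}^{2N}$ are in $L^q(\mathbb{R}^{2N})$. *)

theory Defs
  imports "HOL-Probability.Essential_Supremum" "HOL-Library.Landau_Symbols"
begin

section \<open>Weight functions\<close>

text \<open>
  Only the values of \<open>\<omega>\<close> on \<open>[0,\<infinity>)\<close> matter. The constants \<open>K\<close> of \<open>(\<alpha>)\<close> and \<open>b\<close> of \<open>(\<gamma>)\<close>
  are parameters, because the estimates depend on them.
\<close>

definition weight_function :: "(real \<Rightarrow> real) \<Rightarrow> real \<Rightarrow> real \<Rightarrow> bool" where
  "weight_function \<omega> K b \<longleftrightarrow>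
     continuous_on {0..} \<omega> \<and> mono_on {0..} \<omega> \<and> (\<forall>t\<ge>0. 0 \<le> \<omega> t) \<and>
     (K \<ge> 1 \<and> (\<forall>t\<ge>0. \<omega> (2 * t) \<le> K * (1 + \<omega> t))) \<and>
     \<omega> \<in> o[at_top](\<lambda>t. t) \<and>
     (b > 0 \<and> (\<exists>a. \<forall>t\<ge>0. \<omega> t \<ge> a + b * ln (1 + t))) \<and>
     convex_on UNIV (\<lambda>t. \<omega> (exp t))"

text \<open>
  The product \<open>e\<^sup>\<lambda>\<^sup>\<omega> F\<close>, with \<open>\<omega>(z) = \<omega>(|z|)\<close>. For \<open>z = (x, \<xi>)\<close> the norm of the product type is
  the Euclidean norm of the pair.
\<close>

definition weighted ::
    "(real \<Rightarrow> real) \<Rightarrow> real \<Rightarrow> ('a::euclidean_space \<Rightarrow> complex) \<Rightarrow> 'a \<Rightarrow> complex" where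
  "weighted \<omega> l F z = complex_of_real (exp (l * \<omega> (norm z))) * F z"


section \<open>Lebesgue norms\<close>

text \<open>
  The exponent and the norm take values in \<open>[0,\<infinity>]\<close>; the second branch is \<open>(\<integral> |F|\<^sup>p)\<^sup>1\<^sup>/\<^sup>p\<close>,
  equal to \<open>\<infinity>\<close> if the integral is.
\<close>

definition Lp_norm :: "ennreal \<Rightarrow> ('a::euclidean_space \<Rightarrow> complex) \<Rightarrow> ennreal" where
  "Lp_norm p F =
     (if p = \<infinity> then esssup lborel (\<lambda>z. ennreal (norm (F z)))
      else let I = \<integral>\<^sup>+ z. ennreal (norm (F z) powr enn2real p) \<partial>lborel
           in if I = \<infinity> then \<infinity> else ennreal (enn2real I powr (1 / enn2real p)))"

definition conj_exponent :: "ennreal \<Rightarrow> ennreal" where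
  "conj_exponent p = 1 / (1 - 1 / p)"

lemma conj_exponent_iff:
  assumes "1 \<le> p"
  shows "1 / p + 1 / q = 1 \<longleftrightarrow> q = conj_exponent p"
proof -
  have ip: "1 / p \<le> 1"
    using assms by (metis divide_le_posI_ennreal mult.right_neutral not_gr_zero not_one_le_zero)
  hence fin: "1 / p \<noteq> top"
    by (auto simp: top_unique)
  have "1 / p + 1 / q = 1 \<longleftrightarrow> 1 / q = 1 - 1 / p"
  proof
    assume "1 / p + 1 / q = 1"
    thus "1 / q = 1 - 1 / p"
      using ennreal_add_diff_cancel_left[OF fin, of "1 / q"] by simp
  next
    assume "1 / q = 1 - 1 / p"
    thus "1 / p + 1 / q = 1"
      using ip by (simp add: add_diff_inverse_ennreal)
  qed
  also have "\<dots> \<longleftrightarrow> q = conj_exponent p"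
    unfolding conj_exponent_def by (metis one_divide_one_divide_ennreal)
  finally show ?thesis .
qed


section \<open>Smoothness and partial derivatives\<close>

definition partial_deriv :: "'n::finite \<Rightarrow> (real^'n \<Rightarrow> complex) \<Rightarrow> real^'n \<Rightarrow> complex" where
  "partial_deriv i f x = vector_derivative (\<lambda>s. f (x + s *\<^sub>R axis i 1)) (at 0)"

primrec C_k :: "nat \<Rightarrow> (real^'n::finite \<Rightarrow> complex) \<Rightarrow> bool" where
  "C_k 0 f \<longleftrightarrow> continuous_on UNIV f"
| "C_k (Suc k) f \<longleftrightarrow> continuous_on UNIV f \<and>
     (\<forall>i. (\<forall>x. (\<lambda>s. f (x + s *\<^sub>R axis i 1)) differentiable (at (0::real))) \<and>
          C_k k (partial_deriv i f))"

definition C_infinity :: "(real^'n::finite \<Rightarrow> complex) \<Rightarrow> bool" where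
  "C_infinity f \<longleftrightarrow> (\<forall>k. C_k k f)"

text \<open>
  \<open>\<partial>\<^sup>\<alpha>\<close> for a multi-index \<open>\<alpha> \<in> \<nat>\<^sub>0\<^sup>N\<close>. The index type carries no order, so an arbitrary enumeration
  of the coordinates fixes the order of differentiation; it does not matter for smooth functions.
\<close>

definition multi_deriv :: "('n::finite \<Rightarrow> nat) \<Rightarrow> (real^'n \<Rightarrow> complex) \<Rightarrow> real^'n \<Rightarrow> complex" where
  "multi_deriv \<alpha> f =
     fold (\<lambda>i. partial_deriv i ^^ \<alpha> i) (SOME is. distinct is \<and> set is = UNIV) f"


section \<open>Fourier transform, the space \<open>S\<^sub>\<omega>\<close>, and time-frequency forms\<close>

text \<open>\<open>cis \<theta>\<close> is \<open>e\<^sup>i\<^sup>\<theta>\<close>.\<close>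

definition fourier :: "(real^'n::finite \<Rightarrow> complex) \<Rightarrow> real^'n \<Rightarrow> complex" where
  "fourier f \<xi> = (LINT x|lborel. cis (- (x \<bullet> \<xi>)) * f x)"

definition S_space :: "(real \<Rightarrow> real) \<Rightarrow> (real^'n::finite \<Rightarrow> complex) set" where
  "S_space \<omega> = {f. integrable lborel f \<and> C_infinity f \<and> C_infinity (fourier f) \<and>
     (\<forall>l>0. \<forall>\<alpha>. Lp_norm \<infinity> (weighted \<omega> l (multi_deriv \<alpha> f)) < \<infinity> \<and>
                Lp_norm \<infinity> (weighted \<omega> l (multi_deriv \<alpha> (fourier f))) < \<infinity>)}"

definition Wig :: "real \<Rightarrow> (real^'n::finite \<Rightarrow> complex) \<Rightarrow> (real^'n) \<times> (real^'n) \<Rightarrow> complex" where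
  "Wig \<tau> f = (\<lambda>(x, \<xi>). LINT t|lborel.
     cis (- (t \<bullet> \<xi>)) * f (x + \<tau> *\<^sub>R t) * cnj (f (x - (1 - \<tau>) *\<^sub>R t)))"

definition Rihaczek :: "(real^'n::finite \<Rightarrow> complex) \<Rightarrow> (real^'n) \<times> (real^'n) \<Rightarrow> complex" where
  "Rihaczek f = (\<lambda>(x, \<xi>). cis (- (x \<bullet> \<xi>)) * f x * cnj (fourier f \<xi>))"


section \<open>The constants\<close>

text \<open>
  The constant \<open>D\<^sup>(\<^sup>3\<^sup>)\<close> depends on the dimension \<open>N\<close>, which is passed explicitly. The last two are
  elements of \<open>[0,\<infinity>]\<close>, as they are built from Lebesgue norms; \<open>D4\<close> has a type argument because
  \<open>g\<close>, ranging over functions on \<open>\<real>\<^sup>N\<close>, is bound in it.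
\<close>

definition D3 :: "nat \<Rightarrow> real \<Rightarrow> real \<Rightarrow> real \<Rightarrow> real" where
  "D3 N K \<tau> l = exp (K * (1 + 2 * K) * l) / ((2 * pi) ^ N * (\<tau> - \<tau>\<^sup>2) ^ N)"

definition D2 :: "(real \<Rightarrow> real) \<Rightarrow> real \<Rightarrow> ennreal \<Rightarrow> real \<Rightarrow> real \<Rightarrow>
    (real^'n::finite \<Rightarrow> complex) \<Rightarrow> ennreal" where
  "D2 \<omega> K p l \<mu> g =
     (ennreal (exp (K * (1 + 2 * K) * l)) *
      Lp_norm \<infinity> (weighted \<omega> (K\<^sup>2 * l) g) * Lp_norm \<infinity> (weighted \<omega> (K\<^sup>2 * l) (fourier g)) *
      (Lp_norm (conj_exponent (2 * p))
         (weighted \<omega> (- \<mu>) (\<lambda>_ :: (real^'n) \<times> (real^'n). 1)))\<^sup>2)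
     / (ennreal ((2 * pi) ^ (2 * CARD('n))) * Lp_norm 2 g ^ 4)"

definition D4 :: "'n::finite itself \<Rightarrow> (real \<Rightarrow> real) \<Rightarrow> real \<Rightarrow> ennreal \<Rightarrow> real \<Rightarrow> real \<Rightarrow> real \<Rightarrow>
    ennreal" where
  "D4 _ \<omega> K p \<tau> l \<mu> =
     (INF g \<in> {g \<in> S_space \<omega> :: (real^'n \<Rightarrow> complex) set. g \<noteq> (\<lambda>_. 0)}.
        D2 \<omega> K p l \<mu> g * ennreal (exp (2 * K * (K\<^sup>2 * l + \<mu>))) *
        Lp_norm 1 (weighted \<omega> (2 * K * (K\<^sup>2 * l + \<mu>)) (Wig (1 - \<tau>) (\<lambda>t. g (- t)))))"

end

theory Submission
  imports Defs "HOL-Probability.Characteristic_Functions" "HOL-Probability.Sinc_Integral"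
begin

text \<open>
  (i) The triangle inequality bounds \<open>|Wig\<^sub>\<tau> f(x,\<xi>)|\<close> by
  \<open>\<integral>|f(x+\<tau>t)||f(x-(1-\<tau>)t)|dt\<close>, and after Parseval's formula by
  \<open>(2\<pi>)\<^sup>-\<^sup>N \<integral>|f^(\<xi>+(1-\<tau>)\<eta>)||f^(\<xi>-\<tau>\<eta>)|d\<eta>\<close>, where \<open>f^\<close> is the Fourier transform.
  The product of the two bounds is \<open>(2\<pi>)\<^sup>-\<^sup>N \<integral>|Rf(Aw)||Rf(Bw)|dw\<close> with two affine maps
  \<open>A, B\<close> of \<open>\<real>\<^sup>2\<^sup>N\<close> that both have Jacobian \<open>(\<tau>-\<tau>\<^sup>2)\<^sup>N\<close> in absolute value, so that Hoelder's
  inequality applies directly on \<open>\<real>\<^sup>2\<^sup>N\<close>.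

  (ii) Let \<open>V\<close> be the short-time Fourier transform of \<open>f\<close> with window \<open>g\<close>. Fourier inversion of
  \<open>t \<mapsto> f(t) cnj(g(t-y))\<close>, and of the analogous product of \<open>f^\<close> and \<open>g^\<close>, bounds \<open>f\<close> and \<open>f^\<close>
  by integrals of \<open>|V|\<close> against \<open>|g|\<close> and \<open>|g^|\<close>. Hoelder's inequality with exponent \<open>2p\<close> then
  leads to the \<open>p\<close>-norm of \<open>|V|\<^sup>2\<close>, and \<open>(2\<pi>)\<^sup>N |V|\<^sup>2\<close> is dominated by the convolution of
  \<open>|Wig\<^sub>\<tau> f|\<close> with \<open>|Wig\<^sub>1\<^sub>-\<^sub>\<tau> g~|\<close>, to which Young's inequality applies.
\<close>

section \<open>Fourier inversion and Parseval's formula\<close>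

text \<open>All powers of K and all exponential factors have one source. A weight function is only
  almost subadditive, \<omega>(u+v) \<le> K(1 + \<omega>(u) + \<omega>(v)), so splitting a weight
  along a sum multiplies its exponent by K and costs e to the new exponent. In (i) this happens
  once, to the squared weight. In (ii) it happens at the pair (x, \<xi>), then in the bounds for f
  and for f^, which gives the total factor e^{Kl} e^{2K^2 l} = e^{K(1+2K)l}, and finally in the
  convolution. The exponent 2p arises because f and f^ are bounded by the same weighted L^1 norm of
  V, which therefore enters squared. Each copy is paid for by one norm of e^{-\<mu>\<omega>}. Bounds
  are stated in [0,\<infinity>], so a divergent right-hand side is harmless. Genuine finiteness is
  required where Parseval's formula is applied to slices of a Wigner transform and where the infimum
  over windows is taken. Both times it is the rapid decay of Wig, which is itself an instance of the
  estimate behind (i).\<close>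

lemma nn_integral_lborel_affine:
  fixes f :: "'a::euclidean_space \<Rightarrow> ennreal"
  assumes [measurable]: "f \<in> borel_measurable borel" and c: "c \<noteq> 0"
  shows "(\<integral>\<^sup>+x. f (t + c *\<^sub>R x) \<partial>lborel) = ennreal (1 / \<bar>c\<bar> ^ DIM('a)) * (\<integral>\<^sup>+x. f x \<partial>lborel)"
proof -
  have "(\<integral>\<^sup>+x. f x \<partial>lborel) = ennreal (\<bar>c\<bar> ^ DIM('a)) * (\<integral>\<^sup>+x. f (t + c *\<^sub>R x) \<partial>lborel)"
    by (subst lborel_affine[OF c, of t])
       (simp add: nn_integral_density nn_integral_distr nn_integral_cmult ennreal_power)
  then show ?thesis
    using c by (simp add: mult.assoc[symmetric] ennreal_mult[symmetric])
qed

lemma integrable_lborel_affine: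
  fixes f :: "'a::euclidean_space \<Rightarrow> 'b::{banach, second_countable_topology}"
  assumes f: "integrable lborel f" and c: "c \<noteq> 0"
  shows "integrable lborel (\<lambda>x. f (t + c *\<^sub>R x))"
  using f f[THEN borel_measurable_integrable] c unfolding integrable_iff_bounded
  by (subst nn_integral_lborel_affine) (auto simp: ennreal_mult_less_top)

lemma integral_lborel_affine:
  fixes f :: "'a::euclidean_space \<Rightarrow> 'b::{banach, second_countable_topology}"
  assumes [measurable]: "f \<in> borel_measurable borel" and c: "c \<noteq> 0"
  shows "(\<integral>x. f (t + c *\<^sub>R x) \<partial>lborel) = (1 / \<bar>c\<bar> ^ DIM('a)) *\<^sub>R (\<integral>x. f x \<partial>lborel)"
proof -
  have "(\<integral>x. f x \<partial>lborel) = (\<bar>c\<bar> ^ DIM('a)) *\<^sub>R (\<integral>x. f (t + c *\<^sub>R x) \<partial>lborel)"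
    by (subst lborel_affine[OF c, of t])
       (simp add: integral_density integral_distr)
  then show ?thesis
    using c by simp
qed

section \<open>The Gaussian and its Fourier transform\<close>

lemma cis_measurable [measurable]: "cis \<in> borel_measurable borel"
  by (intro borel_measurable_continuous_onI continuous_intros)

text \<open>This is the characteristic function of the standard normal distribution at -u, freed
  from the normalisation 1/sqrt(2 pi) of the density.\<close>

lemma integral_cis_gaussian_real:
  "(\<integral>x. cis (- (x * u)) * of_real (exp (- (x\<^sup>2 / 2))) \<partial>lborel)
     = of_real (sqrt (2 * pi) * exp (- (u\<^sup>2 / 2)))"
proof -
  have "of_real (exp (- (u\<^sup>2 / 2))) = char std_normal_distribution (- u)"
    by (simp add: char_std_normal_distribution)
  also have "\<dots> = (\<integral>x. std_normal_density x *\<^sub>R cis (- u * x) \<partial>lborel)"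
    unfolding char_def by (subst integral_density) (auto simp: cis_conv_exp)
  also have "\<dots> = (\<integral>x. complex_of_real (1 / sqrt (2 * pi)) *
       (cis (- (x * u)) * of_real (exp (- (x\<^sup>2 / 2)))) \<partial>lborel)"
    by (intro Bochner_Integration.integral_cong)
       (auto simp: std_normal_density_def scaleR_conv_of_real ac_simps)
  also have "\<dots> = complex_of_real (1 / sqrt (2 * pi)) *
       (\<integral>x. cis (- (x * u)) * of_real (exp (- (x\<^sup>2 / 2))) \<partial>lborel)"
    by (rule integral_mult_right_zero)
  finally show ?thesis by (simp add: field_simps)
qed

lemma integrable_gaussian_real: "integrable lborel (\<lambda>x::real. exp (- (x\<^sup>2 / 2)))"
proof -
  have "integrable lborel (\<lambda>x. sqrt (2 * pi) * std_normal_density x)"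
    by (intro integrable_mult_right integrable_normal_density) auto
  then show ?thesis by (simp add: std_normal_density_def)
qed

definition gaussian :: "'a::euclidean_space \<Rightarrow> real" where
  "gaussian x = exp (- ((norm x)\<^sup>2 / 2))"

text \<open>The integrand factorises over the coordinates, and \<open>lborel\<close> is the image of
  a product of one-dimensional Lebesgue measures under
  \<open>\<lambda>f. \<Sum>b\<in>Basis. f b *\<^sub>R b\<close>. Both claims reduce to dimension
  one.\<close>

lemma
  fixes \<xi> :: "'a::euclidean_space"
  shows integrable_cis_gaussian:
      "integrable lborel (\<lambda>x. cis (- (x \<bullet> \<xi>)) * of_real (gaussian x))"
    and integral_cis_gaussian:
      "(\<integral>x. cis (- (x \<bullet> \<xi>)) * of_real (gaussian x) \<partial>lborel)
        = of_real (sqrt (2 * pi) ^ DIM('a) * gaussian \<xi>)"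
proof -
  interpret product_sigma_finite "\<lambda>_::'a. lborel :: real measure" ..
  let ?g = "\<lambda>b::'a. \<lambda>x::real. cis (- (x * (\<xi> \<bullet> b))) * complex_of_real (exp (- (x\<^sup>2 / 2)))"
  have cis_sum: "cis (\<Sum>b\<in>A. h b) = (\<Prod>b\<in>A. cis (h b))" if "finite A" for h and A :: "'a set"
    using that by induction (auto simp: cis_mult[symmetric])
  have n: "(norm x)\<^sup>2 = (\<Sum>b\<in>Basis. (x \<bullet> b)\<^sup>2)" for x :: 'a
    unfolding power2_norm_eq_inner by (subst euclidean_inner) (simp add: power2_eq_square)
  have split: "cis (- (x \<bullet> \<xi>)) * of_real (gaussian x) = (\<Prod>b\<in>Basis. ?g b (x \<bullet> b))" for x
    unfolding gaussian_def n prod.distrib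
    by (subst euclidean_inner)
       (simp add: cis_sum sum_negf[symmetric] exp_sum sum_divide_distrib)
  have int: "integrable lborel (?g b)" for b
    by (rule Bochner_Integration.integrable_bound[OF integrable_gaussian_real])
       (auto simp: norm_mult)
  have meas: "(\<lambda>f. \<Sum>b\<in>Basis. f b *\<^sub>R b) \<in> measurable (\<Pi>\<^sub>M b\<in>Basis. lborel) (borel :: 'a measure)"
    by measurable
  have inner: "(\<Sum>b\<in>Basis. f b *\<^sub>R b) \<bullet> c = f c" if "c \<in> Basis" for f and c :: 'a
    using that by (simp add: inner_sum_left inner_Basis if_distrib cong: if_cong)
  have m: "(\<lambda>x::'a. \<Prod>b\<in>Basis. ?g b (x \<bullet> b)) \<in> borel_measurable borel"
    by measurable
  show "integrable lborel (\<lambda>x. cis (- (x \<bullet> \<xi>)) * of_real (gaussian x))"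
    unfolding split
    using product_integrable_prod[of Basis ?g, OF finite_Basis int]
    by (subst lborel_eq, subst integrable_distr_eq[OF meas m]) (simp add: inner cong: prod.cong)
  have "(\<integral>x. cis (- (x \<bullet> \<xi>)) * of_real (gaussian x) \<partial>lborel)
      = (\<Prod>b\<in>Basis. \<integral>x. ?g b x \<partial>lborel)"
    unfolding split
    using product_integral_prod[of Basis ?g, OF finite_Basis int]
    by (subst lborel_eq, subst integral_distr[OF meas m]) (simp add: inner cong: prod.cong)
  also have "\<dots> = of_real (sqrt (2 * pi) ^ DIM('a) * gaussian \<xi>)"
    unfolding integral_cis_gaussian_real gaussian_def n
    by (simp add: prod.distrib exp_sum sum_divide_distrib sum_negf[symmetric])
  finally show "(\<integral>x. cis (- (x \<bullet> \<xi>)) * of_real (gaussian x) \<partial>lborel)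
        = of_real (sqrt (2 * pi) ^ DIM('a) * gaussian \<xi>)" .
qed

lemma integrable_gaussian: "integrable lborel (gaussian :: 'a::euclidean_space \<Rightarrow> real)"
proof -
  have "norm (cis (- (x \<bullet> 0)) * complex_of_real (gaussian x)) = gaussian x" for x :: 'a
    by (simp add: norm_mult gaussian_def)
  then show ?thesis using integrable_norm[OF integrable_cis_gaussian[of "0::'a"]] by simp
qed

lemma integral_gaussian:
  "(\<integral>x. gaussian (x::'a::euclidean_space) \<partial>lborel) = sqrt (2 * pi) ^ DIM('a)"
proof -
  have "complex_of_real (\<integral>x. gaussian (x::'a) \<partial>lborel) = of_real (sqrt (2 * pi) ^ DIM('a))"
    using integral_cis_gaussian[of "0::'a"] by (simp add: gaussian_def)
  then show ?thesis by (simp only: of_real_eq_iff)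
qed

lemma continuous_gaussian [continuous_intros]:
  "continuous_on A f \<Longrightarrow> continuous_on A (\<lambda>x. gaussian (f x))"
  unfolding gaussian_def by (intro continuous_intros) auto

lemma gaussian_measurable [measurable]: "gaussian \<in> borel_measurable borel"
  by (intro borel_measurable_continuous_onI continuous_intros)

section \<open>Multiplication formula and symmetries of the Fourier transform\<close>

lemma fourier_multiplication:
  fixes f k :: "real^'n::finite \<Rightarrow> complex"
  assumes f: "integrable lborel f" and k: "integrable lborel k"
  shows "(\<integral>\<eta>. fourier f \<eta> * k \<eta> \<partial>lborel) = (\<integral>x. f x * fourier k x \<partial>lborel)"
proof -
  have [measurable]: "f \<in> borel_measurable borel" "k \<in> borel_measurable borel"
    using f k by auto
  have "integrable (lborel \<Otimes>\<^sub>M lborel) (\<lambda>(x::real^'n, y::real^'n). f x * k y)"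
    by (intro lborel_pair.Fubini_integrable)
       (auto simp: norm_mult f k intro!: integrable_mult_left integrable_mult_right integrable_norm)
  then have i: "integrable (lborel \<Otimes>\<^sub>M lborel)
      (\<lambda>(x::real^'n, y::real^'n). cis (- (x \<bullet> y)) * f x * k y)"
    by (rule Bochner_Integration.integrable_bound) (auto simp: norm_mult)
  have "(\<integral>\<eta>. fourier f \<eta> * k \<eta> \<partial>lborel)
      = (\<integral>\<eta>. (\<integral>x. cis (- (x \<bullet> \<eta>)) * f x * k \<eta> \<partial>lborel) \<partial>lborel)"
    by (simp add: fourier_def)
  also have "\<dots> = (\<integral>x. (\<integral>\<eta>. cis (- (x \<bullet> \<eta>)) * f x * k \<eta> \<partial>lborel) \<partial>lborel)"
    by (rule lborel_pair.Fubini_integral[OF i])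
  also have "\<dots> = (\<integral>x. f x * fourier k x \<partial>lborel)"
    unfolding fourier_def integral_mult_right_zero[symmetric]
    by (simp add: inner_commute ac_simps)
  finally show ?thesis .
qed

lemma fourier_measurable:
  assumes "f \<in> borel_measurable borel"
  shows "fourier f \<in> borel_measurable borel"
proof -
  note assms [measurable]
  show ?thesis unfolding fourier_def by measurable
qed

lemma fourier_affine:
  fixes f :: "real^'n::finite \<Rightarrow> complex"
  assumes [measurable]: "f \<in> borel_measurable borel" and c: "c \<noteq> 0"
  shows "fourier (\<lambda>t. f (a + c *\<^sub>R t)) \<xi>
    = of_real (1 / \<bar>c\<bar> ^ CARD('n)) * cis (a \<bullet> \<xi> / c) * fourier f (\<xi> /\<^sub>R c)"
proof -
  have "fourier (\<lambda>t. f (a + c *\<^sub>R t)) \<xi>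
      = (\<integral>t. cis (a \<bullet> \<xi> / c) *
          (\<lambda>s. cis (- (s \<bullet> (\<xi> /\<^sub>R c))) * f s) (a + c *\<^sub>R t) \<partial>lborel)"
    unfolding fourier_def mult.assoc[symmetric] cis_mult
    using c by (intro Bochner_Integration.integral_cong) (auto simp: inner_simps field_simps)
  also have "\<dots> = cis (a \<bullet> \<xi> / c) * (of_real (1 / \<bar>c\<bar> ^ CARD('n)) * fourier f (\<xi> /\<^sub>R c))"
    by (subst integral_mult_right_zero, subst integral_lborel_affine[OF _ c])
       (simp_all add: fourier_def scaleR_conv_of_real)
  finally show ?thesis by (simp add: ac_simps)
qed

lemma fourier_modulate: "fourier (\<lambda>t. cis (t \<bullet> \<zeta>) * f t) \<xi> = fourier f (\<xi> - \<zeta>)"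
  unfolding fourier_def mult.assoc[symmetric] cis_mult by (simp add: inner_simps)

lemma fourier_cnj: "fourier (\<lambda>t. cnj (f t)) \<xi> = cnj (fourier f (- \<xi>))"
  proof -
  have "cnj (fourier f (- \<xi>)) = (\<integral>x. cnj (cis (- (x \<bullet> - \<xi>)) * f x) \<partial>lborel)"
    unfolding fourier_def by (rule Bochner_Integration.integral_cnj[symmetric])
  then show ?thesis by (simp add: fourier_def cis_cnj)
qed

text \<open>The regularising factor \<open>gaussian (\<epsilon>\<eta>)\<close> turns the inversion integral into the average
  of \<open>h\<close> against a Gaussian of width \<open>\<epsilon>\<close> centred at \<open>x\<close>.\<close>

lemma fourier_inversion_regularised:
  fixes h :: "real^'n::finite \<Rightarrow> complex"
  assumes h: "integrable lborel h" and e: "\<epsilon> > 0"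
  shows "(\<integral>\<eta>. fourier h \<eta> * (cis (\<eta> \<bullet> x) * of_real (gaussian (\<epsilon> *\<^sub>R \<eta>))) \<partial>lborel)
    = of_real (sqrt (2 * pi) ^ CARD('n)) * (\<integral>s. h (x + \<epsilon> *\<^sub>R s) * of_real (gaussian s) \<partial>lborel)"
proof -
  let ?G = "\<lambda>x::real^'n. complex_of_real (gaussian x)"
  \<comment> \<open>The summand 0 gives the argument the shape \<open>a + c *\<^sub>R t\<close> of
    the affine lemmas.\<close>
  let ?k = "\<lambda>\<eta>::real^'n. cis (\<eta> \<bullet> x) * ?G (0 + \<epsilon> *\<^sub>R \<eta>)"
  have [measurable]: "h \<in> borel_measurable borel" using h by auto
  have iG: "integrable lborel (\<lambda>\<eta>. ?G (0 + \<epsilon> *\<^sub>R \<eta>))"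
    by (rule integrable_lborel_affine) (use e integrable_gaussian in auto)
  have ik: "integrable lborel ?k"
    by (rule Bochner_Integration.integrable_bound[OF iG]) (auto simp: norm_mult)
  have fk: "fourier ?k t = of_real (1 / \<epsilon> ^ CARD('n)) *
      of_real (sqrt (2 * pi) ^ CARD('n) * gaussian ((t - x) /\<^sub>R \<epsilon>))" for t
  proof -
    have "fourier ?k t = fourier (\<lambda>\<eta>. ?G (0 + \<epsilon> *\<^sub>R \<eta>)) (t - x)"
      by (rule fourier_modulate)
    also have "\<dots> = of_real (1 / \<epsilon> ^ CARD('n)) * fourier ?G ((t - x) /\<^sub>R \<epsilon>)"
      by (subst fourier_affine) (use e in auto)
    also have "fourier ?G ((t - x) /\<^sub>R \<epsilon>)
        = of_real (sqrt (2 * pi) ^ CARD('n) * gaussian ((t - x) /\<^sub>R \<epsilon>))"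
      unfolding fourier_def by (subst integral_cis_gaussian) simp
    finally show ?thesis .
  qed
  have "(\<integral>\<eta>. fourier h \<eta> * ?k \<eta> \<partial>lborel) = (\<integral>t. h t * fourier ?k t \<partial>lborel)"
    by (rule fourier_multiplication[OF h ik])
  also have "\<dots> = of_real (sqrt (2 * pi) ^ CARD('n)) * (of_real (1 / \<epsilon> ^ CARD('n)) *
      (\<integral>t. h t * ?G ((t - x) /\<^sub>R \<epsilon>) \<partial>lborel))"
    unfolding fk integral_mult_right_zero[symmetric] by (simp add: ac_simps)
  \<comment> \<open>Substitution t = x + \<epsilon>s, whose Jacobian absorbs the prefactor.\<close>
  also have "of_real (1 / \<epsilon> ^ CARD('n)) * (\<integral>t. h t * ?G ((t - x) /\<^sub>R \<epsilon>) \<partial>lborel)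
      = (\<integral>s. h (x + \<epsilon> *\<^sub>R s) * ?G s \<partial>lborel)"
  proof -
    have "(\<lambda>t. h t * ?G ((t - x) /\<^sub>R \<epsilon>)) \<in> borel_measurable borel" by measurable
    from integral_lborel_affine[OF this, of \<epsilon> x] e show ?thesis
      by (simp add: scaleR_conv_of_real[where 'a = complex])
  qed
  finally show ?thesis by simp
qed

text \<open>Let \<epsilon> tend to 0 in the regularised formula. Dominated convergence applies on
  both sides: on the left with |fourier h| as dominating function, on the right with
  \<open>B\<close> times the Gaussian, where continuity of \<open>h\<close> identifies the limit. Of
  the factor (2 pi)^N, one square root comes from the transform of the Gaussian and the other from
  its integral.\<close>

theorem fourier_inversion:
  fixes h :: "real^'n::finite \<Rightarrow> complex"
  assumes h: "integrable lborel h" and c: "continuous_on UNIV h"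
    and B: "\<And>x. norm (h x) \<le> B" and hh: "integrable lborel (fourier h)"
  shows "(\<integral>\<eta>. fourier h \<eta> * cis (\<eta> \<bullet> x) \<partial>lborel) = of_real ((2 * pi) ^ CARD('n)) * h x"
proof -
  have [measurable]: "h \<in> borel_measurable borel" "fourier h \<in> borel_measurable borel"
    using h hh by auto
  let ?e = "\<lambda>n. inverse (real (Suc n))"
  let ?L = "\<lambda>n. \<integral>\<eta>. fourier h \<eta> * (cis (\<eta> \<bullet> x) * of_real (gaussian (?e n *\<^sub>R \<eta>))) \<partial>lborel"
  let ?R = "\<lambda>n. \<integral>s. h (x + ?e n *\<^sub>R s) * of_real (gaussian s) \<partial>lborel"
  have e0: "?e \<longlonglongrightarrow> 0" by (rule LIMSEQ_inverse_real_of_nat)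
  have g1: "norm (complex_of_real (gaussian z)) \<le> 1" for z :: "real^'n"
    by (simp add: gaussian_def)
  have cG: "isCont (gaussian :: real^'n \<Rightarrow> real) z" for z
    using continuous_gaussian[of UNIV "\<lambda>x. x"]
    by (auto simp: continuous_on_eq_continuous_at[OF open_UNIV])
  have ch: "isCont h z" for z
    using c by (simp add: continuous_on_eq_continuous_at)
  have L: "?L \<longlonglongrightarrow> (\<integral>\<eta>. fourier h \<eta> * cis (\<eta> \<bullet> x) \<partial>lborel)"
  proof (rule integral_dominated_convergence[where w = "\<lambda>\<eta>. norm (fourier h \<eta>)"])
    show "AE \<eta> in lborel. (\<lambda>n. fourier h \<eta> * (cis (\<eta> \<bullet> x) * of_real (gaussian (?e n *\<^sub>R \<eta>))))
        \<longlonglongrightarrow> fourier h \<eta> * cis (\<eta> \<bullet> x)"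
    proof (intro AE_I2)
      fix \<eta> :: "real^'n"
      have "(\<lambda>n. gaussian (?e n *\<^sub>R \<eta>)) \<longlonglongrightarrow> gaussian (0 *\<^sub>R \<eta>)"
        by (intro isCont_tendsto_compose[OF cG] tendsto_intros e0)
      then have "(\<lambda>n. fourier h \<eta> * (cis (\<eta> \<bullet> x) * of_real (gaussian (?e n *\<^sub>R \<eta>))))
        \<longlonglongrightarrow> fourier h \<eta> * (cis (\<eta> \<bullet> x) * of_real (gaussian (0 *\<^sub>R \<eta>)))"
        by (intro tendsto_intros)
      then show "(\<lambda>n. fourier h \<eta> * (cis (\<eta> \<bullet> x) * of_real (gaussian (?e n *\<^sub>R \<eta>))))
        \<longlonglongrightarrow> fourier h \<eta> * cis (\<eta> \<bullet> x)" by (simp add: gaussian_def)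
    qed
    show "AE \<eta> in lborel. norm (fourier h \<eta> * (cis (\<eta> \<bullet> x) * of_real (gaussian (?e n *\<^sub>R \<eta>))))
        \<le> norm (fourier h \<eta>)" for n
      using g1[of "?e n *\<^sub>R _"] by (auto simp: norm_mult mult_left_le)
  qed (use hh in auto)
  have "?R \<longlonglongrightarrow> (\<integral>s. h x * of_real (gaussian (s::real^'n)) \<partial>lborel)"
  proof (rule integral_dominated_convergence[where w = "\<lambda>s::real^'n. B * gaussian s"])
    show "AE s in lborel. (\<lambda>n. h (x + ?e n *\<^sub>R s) * of_real (gaussian s))
        \<longlonglongrightarrow> h x * of_real (gaussian s)"
    proof (intro AE_I2)
      fix s :: "real^'n"
      have "(\<lambda>n. h (x + ?e n *\<^sub>R s)) \<longlonglongrightarrow> h (x + 0 *\<^sub>R s)"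
        by (intro isCont_tendsto_compose[OF ch] tendsto_intros e0)
      then show "(\<lambda>n. h (x + ?e n *\<^sub>R s) * of_real (gaussian s)) \<longlonglongrightarrow> h x * of_real (gaussian s)"
        by (intro tendsto_intros) simp
    qed
    show "AE s in lborel. norm (h (x + ?e n *\<^sub>R s) * of_real (gaussian s)) \<le> B * gaussian s" for n
      by (auto simp: norm_mult gaussian_def intro!: mult_right_mono B)
  qed (use integrable_gaussian in auto)
  then have R: "(\<lambda>n. of_real (sqrt (2 * pi) ^ CARD('n)) * ?R n)
      \<longlonglongrightarrow> of_real (sqrt (2 * pi) ^ CARD('n)) * (\<integral>s. h x * of_real (gaussian (s::real^'n)) \<partial>lborel)"
    by (rule tendsto_mult_left)
  have "?L n = of_real (sqrt (2 * pi) ^ CARD('n)) * ?R n" for n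
    by (rule fourier_inversion_regularised[OF h]) simp
  with R have "?L \<longlonglongrightarrow> of_real (sqrt (2 * pi) ^ CARD('n)) *
      (\<integral>s. h x * of_real (gaussian (s::real^'n)) \<partial>lborel)"
    by presburger
  with L have "(\<integral>\<eta>. fourier h \<eta> * cis (\<eta> \<bullet> x) \<partial>lborel)
      = of_real (sqrt (2 * pi) ^ CARD('n)) * (\<integral>s. h x * of_real (gaussian (s::real^'n)) \<partial>lborel)"
    by (rule LIMSEQ_unique)
  also have "\<dots> = of_real (sqrt (2 * pi) ^ CARD('n) * sqrt (2 * pi) ^ CARD('n)) * h x"
    by (subst integral_mult_right_zero) (simp add: integral_gaussian)
  also have "sqrt (2 * pi) ^ CARD('n) * sqrt (2 * pi) ^ CARD('n) = (2 * pi) ^ CARD('n)"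
    by (subst power_mult_distrib[symmetric]) simp
  finally show ?thesis .
qed

text \<open>If \<open>fourier h\<close> is not integrable, the right-hand side is infinite. In this
  form inversion applies to products of f with a translated window, for which integrability of the
  transform is not established.\<close>

corollary fourier_inversion_bound:
  fixes h :: "real^'n::finite \<Rightarrow> complex"
  assumes h: "integrable lborel h" and c: "continuous_on UNIV h" and B: "\<And>x. norm (h x) \<le> B"
  shows "ennreal ((2 * pi) ^ CARD('n)) * ennreal (norm (h x)) \<le> (\<integral>\<^sup>+\<eta>. norm (fourier h \<eta>) \<partial>lborel)"
proof (cases "integrable lborel (fourier h)")
  case True
  have "(2 * pi) ^ CARD('n) * norm (h x) = norm (\<integral>\<eta>. fourier h \<eta> * cis (\<eta> \<bullet> x) \<partial>lborel)"
    unfolding fourier_inversion[OF h c B True] by (simp add: norm_mult norm_power)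
  also have "\<dots> \<le> (\<integral>\<eta>. norm (fourier h \<eta> * cis (\<eta> \<bullet> x)) \<partial>lborel)"
    by (rule integral_norm_bound)
  finally have "(2 * pi) ^ CARD('n) * norm (h x) \<le> (\<integral>\<eta>. norm (fourier h \<eta>) \<partial>lborel)"
    by (simp add: norm_mult)
  then show ?thesis
    using True by (simp add: nn_integral_eq_integral ennreal_mult[symmetric] ennreal_leI)
next
  case False
  have "fourier h \<in> borel_measurable borel"
    using h by (intro fourier_measurable) auto
  with False have "(\<integral>\<^sup>+\<eta>. norm (fourier h \<eta>) \<partial>lborel) = \<infinity>"
    by (simp add: integrable_iff_bounded less_top[symmetric])
  then show ?thesis by simp
qed

text \<open>The multiplication formula is applied to \<open>f\<close> and the conjugate of
  \<open>fourier h\<close>, whose transform is known by inversion. Only \<open>h\<close> is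
  inverted, which explains the asymmetric assumptions.\<close>

theorem parseval:
  fixes f h :: "real^'n::finite \<Rightarrow> complex"
  assumes f: "integrable lborel f"
    and h: "integrable lborel h" and c: "continuous_on UNIV h"
    and B: "\<And>x. norm (h x) \<le> B" and hh: "integrable lborel (fourier h)"
  shows "of_real ((2 * pi) ^ CARD('n)) * (\<integral>x. f x * cnj (h x) \<partial>lborel)
    = (\<integral>\<eta>. fourier f \<eta> * cnj (fourier h \<eta>) \<partial>lborel)"
proof -
  have "fourier (\<lambda>\<eta>. cnj (fourier h \<eta>)) x = of_real ((2 * pi) ^ CARD('n)) * cnj (h x)" for x
    unfolding fourier_cnj
    using fourier_inversion[OF h c B hh, of x] by (simp add: fourier_def ac_simps)
  moreover have "(\<integral>\<eta>. fourier f \<eta> * cnj (fourier h \<eta>) \<partial>lborel)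
      = (\<integral>x. f x * fourier (\<lambda>\<eta>. cnj (fourier h \<eta>)) x \<partial>lborel)"
    using hh by (intro fourier_multiplication f) simp
  ultimately show ?thesis
    unfolding integral_mult_right_zero[symmetric] by (simp add: ac_simps)
qed

section \<open>Inequalities for Lebesgue norms\<close>

lemma conj_exponent_cases:
  assumes "1 \<le> p"
  obtains "p = 1" "conj_exponent p = \<infinity>"
  | "p = \<infinity>" "conj_exponent p = 1"
  | r q where "1 < r" "1 < q" "1 / r + 1 / q = 1" "p = ennreal r" "conj_exponent p = ennreal q"
proof (cases p)
  case top
  then show ?thesis using that(2) by (simp add: conj_exponent_def)
next
  case (real r)
  with assms have r: "1 \<le> r" by (simp flip: ennreal_1)
  show ?thesis
  proof (cases "r = 1")
    case True
    then show ?thesis using that(1) real by (simp add: conj_exponent_def)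
  next
    case False
    with r have r: "1 < r" by simp
    have "1 / p = ennreal (1 / r)"
      using real r by (simp add: divide_ennreal flip: ennreal_1)
    then have "1 - 1 / p = ennreal (1 - 1 / r)"
      using r by (simp add: ennreal_minus flip: ennreal_1)
    moreover have "1 - 1 / r > 0" using r by simp
    ultimately have "conj_exponent p = ennreal (1 / (1 - 1 / r))"
      unfolding conj_exponent_def by (simp add: divide_ennreal flip: ennreal_1)
    then show ?thesis
      using that(3)[of r "1 / (1 - 1 / r)"] real r by (simp add: field_simps)
  qed
qed

lemma Lp_norm_1: "Lp_norm 1 F = (\<integral>\<^sup>+z. ennreal (norm (F z)) \<partial>lborel)"
  by (simp add: Lp_norm_def Let_def less_top)

text \<open>Trades the root in the norm for a power of the bound, so that estimates for finite
  exponents become estimates of plain integrals.\<close>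

lemma Lp_norm_ennreal_le_iff:
  assumes r: "r > 0" and C: "C \<ge> 0"
  shows "Lp_norm (ennreal r) F \<le> ennreal C \<longleftrightarrow>
    (\<integral>\<^sup>+z. ennreal (norm (F z) powr r) \<partial>lborel) \<le> ennreal (C powr r)"
proof (cases "\<integral>\<^sup>+z. ennreal (norm (F z) powr r) \<partial>lborel")
  case top
  then show ?thesis using r by (simp add: Lp_norm_def top_unique)
next
  case (real i)
  have "i powr (1 / r) \<le> C \<longleftrightarrow> i \<le> C powr r"
  proof
    assume "i powr (1 / r) \<le> C"
    then have "(i powr (1 / r)) powr r \<le> C powr r" using r by (intro powr_mono2) auto
    then show "i \<le> C powr r" using r real by (simp add: powr_powr)
  next
    assume "i \<le> C powr r"
    then have "i powr (1 / r) \<le> (C powr r) powr (1 / r)" using r real by (intro powr_mono2) auto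
    then show "i powr (1 / r) \<le> C" using r C by (simp add: powr_powr)
  qed
  then show ?thesis using real r C by (simp add: Lp_norm_def)
qed

lemma Lp_norm_ennreal_eqD:
  assumes r: "r > 0" and C: "C \<ge> 0" and F: "Lp_norm (ennreal r) F = ennreal C"
  shows "(\<integral>\<^sup>+z. ennreal (norm (F z) powr r) \<partial>lborel) = ennreal (C powr r)"
proof (cases "\<integral>\<^sup>+z. ennreal (norm (F z) powr r) \<partial>lborel")
  case top
  then show ?thesis using r F by (simp add: Lp_norm_def)
next
  case (real i)
  then have "i powr (1 / r) = C"
    using F r C by (simp add: Lp_norm_def)
  then show ?thesis using real r by (auto simp: powr_powr)
qed

lemma Lp_norm_mono_AE:
  assumes [measurable]: "F \<in> borel_measurable borel"
    and le: "AE z in lborel. norm (F z) \<le> norm (G z)" and p: "1 \<le> p"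
  shows "Lp_norm p F \<le> Lp_norm p G"
proof (cases p)
  case top
  then show ?thesis
    unfolding Lp_norm_def using le by (auto intro!: esssup_AE_mono)
next
  case (real r)
  with p have r: "r \<ge> 1" by (simp flip: ennreal_1)
  show ?thesis
  proof (cases "Lp_norm p G")
    case (real C)
    have "(\<integral>\<^sup>+z. ennreal (norm (F z) powr r) \<partial>lborel) \<le> (\<integral>\<^sup>+z. ennreal (norm (G z) powr r) \<partial>lborel)"
      using le r by (intro nn_integral_mono_AE) (auto intro!: ennreal_leI powr_mono2)
    also have "\<dots> = ennreal (C powr r)"
      using Lp_norm_ennreal_eqD[of r C G] real \<open>p = ennreal r\<close> r by simp
    finally show ?thesis
      using real \<open>p = ennreal r\<close> r by (simp add: Lp_norm_ennreal_le_iff)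
  qed simp
qed

lemma Lp_norm_eq_0_AE:
  assumes [measurable]: "F \<in> borel_measurable borel" and p: "1 \<le> p" and 0: "Lp_norm p F = 0"
  shows "AE z in lborel. F z = 0"
proof (cases p)
  case top
  have "AE z in lborel. ennreal (norm (F z)) \<le> esssup lborel (\<lambda>z. ennreal (norm (F z)))"
    by (rule esssup_AE)
  then show ?thesis using 0 top by (simp add: Lp_norm_def)
next
  case (real r)
  with p have r: "r \<ge> 1" by (simp flip: ennreal_1)
  have "(\<integral>\<^sup>+z. ennreal (norm (F z) powr r) \<partial>lborel) = 0"
    using Lp_norm_ennreal_eqD[of r 0 F] 0 real r by simp
  then show ?thesis
    by (simp add: nn_integral_0_iff_AE)
qed

section \<open>Hoelder's inequality along two maps\<close>

lemma AE_pullback: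
  fixes A :: "'b::euclidean_space \<Rightarrow> 'a::euclidean_space"
  assumes [measurable]: "A \<in> borel_measurable borel" "Measurable.pred borel P"
    and A: "\<And>\<Phi>. \<Phi> \<in> borel_measurable borel \<Longrightarrow>
      (\<integral>\<^sup>+w. \<Phi> (A w) \<partial>lborel) \<le> ennreal c * (\<integral>\<^sup>+z. \<Phi> z \<partial>lborel)"
    and P: "AE z in lborel. P z"
  shows "AE w in lborel. P (A w)"
proof -
  \<comment> \<open>The hypothesis on \<open>A\<close> bounds the image of Lebesgue measure under
    \<open>A\<close> by \<open>c\<close> times Lebesgue measure. It is tested on the indicator of
    the exceptional set.\<close>
  have "(\<integral>\<^sup>+z. (if P z then 0 else 1) \<partial>lborel) = 0"
    using P by (subst nn_integral_0_iff_AE) auto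
  then have "(\<integral>\<^sup>+w. (if P (A w) then 0 else 1) \<partial>lborel) = 0"
    using A[of "\<lambda>z. if P z then 0 else 1"] by simp
  then show ?thesis
    by (subst (asm) nn_integral_0_iff_AE) (auto elim!: eventually_mono split: if_splits)
qed

text \<open>Young's inequality for products is pointwise, so it separates \<open>F (A w)\<close>
  from \<open>G (B w)\<close> although the arguments differ. The maps are removed afterwards, in one
  integral each. The constant stays \<open>c\<close>, not its square, because the two integrals are
  added with weights 1/r and 1/q. In (i), \<open>A\<close> and \<open>B\<close> are the affine maps
  at which the two copies of Rf are evaluated.\<close>

lemma Holder_pullback:
  fixes F G :: "'a::euclidean_space \<Rightarrow> complex" and A B :: "'b::euclidean_space \<Rightarrow> 'a"
  assumes p: "1 \<le> p" and c: "c > 0"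
    and [measurable]: "F \<in> borel_measurable borel" "G \<in> borel_measurable borel"
      "A \<in> borel_measurable borel" "B \<in> borel_measurable borel"
    and A: "\<And>\<Phi>. \<Phi> \<in> borel_measurable borel \<Longrightarrow>
      (\<integral>\<^sup>+w. \<Phi> (A w) \<partial>lborel) \<le> ennreal c * (\<integral>\<^sup>+z. \<Phi> z \<partial>lborel)"
    and B: "\<And>\<Phi>. \<Phi> \<in> borel_measurable borel \<Longrightarrow>
      (\<integral>\<^sup>+w. \<Phi> (B w) \<partial>lborel) \<le> ennreal c * (\<integral>\<^sup>+z. \<Phi> z \<partial>lborel)"
  shows "(\<integral>\<^sup>+w. ennreal (norm (F (A w))) * ennreal (norm (G (B w))) \<partial>lborel)
    \<le> ennreal c * Lp_norm p F * Lp_norm (conj_exponent p) G"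
proof -
  \<comment> \<open>General in all four functions, so that exchanging their roles settles p =
    \<infinity> as well as p = 1.\<close>
  have one_infinity: "(\<integral>\<^sup>+w. ennreal (norm (F (A w))) * ennreal (norm (G (B w))) \<partial>lborel)
      \<le> ennreal c * Lp_norm 1 F * Lp_norm \<infinity> G"
    if [measurable]: "F \<in> borel_measurable borel" "G \<in> borel_measurable borel"
      "A \<in> borel_measurable borel" "B \<in> borel_measurable borel"
    and A: "\<And>\<Phi>. \<Phi> \<in> borel_measurable borel \<Longrightarrow>
      (\<integral>\<^sup>+w. \<Phi> (A w) \<partial>lborel) \<le> ennreal c * (\<integral>\<^sup>+z. \<Phi> z \<partial>lborel)"
    and B: "\<And>\<Phi>. \<Phi> \<in> borel_measurable borel \<Longrightarrow>
      (\<integral>\<^sup>+w. \<Phi> (B w) \<partial>lborel) \<le> ennreal c * (\<integral>\<^sup>+z. \<Phi> z \<partial>lborel)"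
    for F G :: "'a \<Rightarrow> complex" and A B :: "'b \<Rightarrow> 'a"
  proof -
    have "AE z in lborel. ennreal (norm (G z)) \<le> esssup lborel (\<lambda>z. ennreal (norm (G z)))"
      by (rule esssup_AE)
    then have "AE z in lborel. ennreal (norm (G z)) \<le> Lp_norm \<infinity> G"
      by (simp add: Lp_norm_def)
    then have "AE w in lborel. ennreal (norm (G (B w))) \<le> Lp_norm \<infinity> G"
      by (rule AE_pullback[rotated 3]) (use B in auto)
    then have "(\<integral>\<^sup>+w. ennreal (norm (F (A w))) * ennreal (norm (G (B w))) \<partial>lborel)
        \<le> (\<integral>\<^sup>+w. ennreal (norm (F (A w))) * Lp_norm \<infinity> G \<partial>lborel)"
      by (intro nn_integral_mono_AE) (auto elim!: eventually_mono intro: mult_left_mono)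
    also have "\<dots> = (\<integral>\<^sup>+w. ennreal (norm (F (A w))) \<partial>lborel) * Lp_norm \<infinity> G"
      by (rule nn_integral_multc) simp
    also have "\<dots> \<le> ennreal c * Lp_norm 1 F * Lp_norm \<infinity> G"
      unfolding Lp_norm_1 by (intro mult_right_mono A) auto
    finally show ?thesis .
  qed
  show ?thesis
    using p
  proof (cases rule: conj_exponent_cases)
    case 1
    then show ?thesis using one_infinity[of F G A B] A B by simp
  next
    case 2
    then show ?thesis using one_infinity[of G F B A] A B by (simp add: ac_simps)
  next
    case (3 r q)
    show ?thesis
    \<comment> \<open>A vanishing norm is separated for two reasons: the coefficients
      \<open>s\<close> and \<open>t\<close> below divide by powers of the norms, and 0 * \<infinity>
      = 0 on the right forces the left-hand side to vanish even if the other norm is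
      infinite.\<close>
    proof (cases "Lp_norm p F = 0 \<or> Lp_norm (conj_exponent p) G = 0")
      case True
      have "1 \<le> conj_exponent p" using 3 by (simp flip: ennreal_1)
      with True have "(AE z in lborel. F z = 0) \<or> (AE z in lborel. G z = 0)"
        using p Lp_norm_eq_0_AE[of F p] Lp_norm_eq_0_AE[of G "conj_exponent p"] by auto
      then have "(AE w in lborel. F (A w) = 0) \<or> (AE w in lborel. G (B w) = 0)"
        using AE_pullback[of A "\<lambda>z. F z = 0" c] AE_pullback[of B "\<lambda>z. G z = 0" c] A B by auto
      then have "AE w in lborel. ennreal (norm (F (A w))) * ennreal (norm (G (B w))) = 0"
        by auto
      then have "(\<integral>\<^sup>+w. ennreal (norm (F (A w))) * ennreal (norm (G (B w))) \<partial>lborel) = 0"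
        by (subst nn_integral_0_iff_AE) auto
      then show ?thesis by simp
    next
      case nz: False
      show ?thesis
      proof (cases "Lp_norm p F = \<infinity> \<or> Lp_norm (conj_exponent p) G = \<infinity>")
        case True
        then have "ennreal c * Lp_norm p F * Lp_norm (conj_exponent p) G = \<infinity>"
          using nz c by (auto simp: ennreal_mult_eq_top_iff)
        then show ?thesis by simp
      next
        case False
        then obtain a b where ab: "Lp_norm p F = ennreal a" "Lp_norm (conj_exponent p) G = ennreal b"
            "a \<ge> 0" "b \<ge> 0"
          by (cases "Lp_norm p F"; cases "Lp_norm (conj_exponent p) G") auto
        with nz have pos: "a > 0" "b > 0" by (auto simp: less_le)
        have IF: "(\<integral>\<^sup>+z. ennreal (norm (F z) powr r) \<partial>lborel) = ennreal (a powr r)"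
          using 3 ab by (intro Lp_norm_ennreal_eqD) auto
        have IG: "(\<integral>\<^sup>+z. ennreal (norm (G z) powr q) \<partial>lborel) = ennreal (b powr q)"
          using 3 ab by (intro Lp_norm_ennreal_eqD) auto
        \<comment> \<open>The coefficients of Young's inequality for the normalised values |F|/a and
          |G|/b after multiplication by ab.\<close>
        define s where "s = a * b / (a powr r * r)"
        define t where "t = a * b / (b powr q * q)"
        have st: "s \<ge> 0" "t \<ge> 0" using pos 3 by (auto simp: s_def t_def)
        have young: "norm (F x) * norm (G y) \<le> s * norm (F x) powr r + t * norm (G y) powr q" for x y
        proof -
          have "(norm (F x) / a) * (norm (G y) / b)
              \<le> (norm (F x) / a) powr r / r + (norm (G y) / b) powr q / q"
            using 3 pos by (intro Youngs_inequality) auto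
          then have "a * b * ((norm (F x) / a) * (norm (G y) / b))
              \<le> a * b * ((norm (F x) / a) powr r / r + (norm (G y) / b) powr q / q)"
            using pos by (intro mult_left_mono) auto
          then show ?thesis using pos 3 by (simp add: powr_divide distrib_left s_def t_def)
        qed
        have young': "ennreal (norm (F x)) * ennreal (norm (G y))
            \<le> ennreal s * ennreal (norm (F x) powr r) + ennreal t * ennreal (norm (G y) powr q)" for x y
        proof -
          have "ennreal (norm (F x)) * ennreal (norm (G y)) = ennreal (norm (F x) * norm (G y))"
            by (rule ennreal_mult[symmetric]) auto
          also have "\<dots> \<le> ennreal (s * norm (F x) powr r + t * norm (G y) powr q)"
            by (rule ennreal_leI[OF young])
          also have "\<dots> = ennreal s * ennreal (norm (F x) powr r) + ennreal t * ennreal (norm (G y) powr q)"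
            using st by (simp add: ennreal_mult)
          finally show ?thesis .
        qed
        have "(\<integral>\<^sup>+w. ennreal (norm (F (A w))) * ennreal (norm (G (B w))) \<partial>lborel)
            \<le> (\<integral>\<^sup>+w. ennreal s * ennreal (norm (F (A w)) powr r)
                + ennreal t * ennreal (norm (G (B w)) powr q) \<partial>lborel)"
          by (intro nn_integral_mono young')
        also have "\<dots> = ennreal s * (\<integral>\<^sup>+w. ennreal (norm (F (A w)) powr r) \<partial>lborel)
                + ennreal t * (\<integral>\<^sup>+w. ennreal (norm (G (B w)) powr q) \<partial>lborel)"
          by (subst nn_integral_add) (auto simp: nn_integral_cmult)
        also have "\<dots> \<le> ennreal s * (ennreal c * ennreal (a powr r))
                + ennreal t * (ennreal c * ennreal (b powr q))"
          unfolding IF[symmetric] IG[symmetric] by (intro add_mono mult_left_mono A B) auto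
        also have "\<dots> = ennreal (s * (c * a powr r) + t * (c * b powr q))"
          using st c pos by (simp add: ennreal_mult[symmetric] ennreal_plus[symmetric] del: ennreal_plus)
        also have "s * (c * a powr r) + t * (c * b powr q) = c * a * b * (1 / r + 1 / q)"
          using pos 3 by (simp add: field_simps s_def t_def)
        finally show ?thesis
          using 3 ab c by (simp add: ennreal_mult)
      qed
    qed
  qed
qed

corollary Holder_Lp_norm:
  fixes F G :: "'a::euclidean_space \<Rightarrow> complex"
  assumes "1 \<le> p" "F \<in> borel_measurable borel" "G \<in> borel_measurable borel"
  shows "(\<integral>\<^sup>+z. ennreal (norm (F z)) * ennreal (norm (G z)) \<partial>lborel)
    \<le> Lp_norm p F * Lp_norm (conj_exponent p) G"
  using Holder_pullback[of p 1 F G "\<lambda>z. z" "\<lambda>z. z"] assms by simp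

section \<open>Young's inequality for convolutions\<close>

lemma nn_integral_lborel_reflect:
  fixes f :: "'a::euclidean_space \<Rightarrow> ennreal"
  assumes [measurable]: "f \<in> borel_measurable borel"
  shows "(\<integral>\<^sup>+x. f (z - x) \<partial>lborel) = (\<integral>\<^sup>+x. f x \<partial>lborel)"
  using nn_integral_lborel_affine[of f "-1" z] by simp

text \<open>With q conjugate to r, write |G| as |G|^(1/r) |G|^(1/q) and apply Hoelder's inequality
  to |F| |G|^(1/r) and |G|^(1/q). The second factor contributes g^(1/q), and the r-th power turns
  this into g^(r-1). What is left is linear in |G|, so Tonelli's theorem can integrate it over
  \<open>z\<close>.\<close>

lemma convolution_powr_bound:
  fixes F G :: "'a::euclidean_space \<Rightarrow> complex"
  assumes [measurable]: "F \<in> borel_measurable borel" "G \<in> borel_measurable borel"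
    and r: "1 < r" and g: "Lp_norm 1 G = ennreal g" "g > 0"
    and h: "ennreal h \<le> (\<integral>\<^sup>+w. ennreal (norm (F w)) * ennreal (norm (G (z - w))) \<partial>lborel)" "h \<ge> 0"
  shows "ennreal (h powr r)
    \<le> ennreal (g powr (r - 1)) * (\<integral>\<^sup>+w. ennreal (norm (F w) powr r) * ennreal (norm (G (z - w))) \<partial>lborel)"
proof (cases "\<integral>\<^sup>+w. ennreal (norm (F w) powr r) * ennreal (norm (G (z - w))) \<partial>lborel")
  case top
  then show ?thesis using g by (simp add: ennreal_mult_eq_top_iff)
next
  case (real j)
  define q where "q = r / (r - 1)"
  have q: "q > 1" "1 / r + 1 / q = 1" using r by (auto simp: q_def field_simps)
  have cq: "conj_exponent (ennreal r) = ennreal q"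
  proof -
    have "1 \<le> ennreal r" using r by (simp flip: ennreal_1)
    moreover have "1 / ennreal r + 1 / ennreal q = 1"
      using r q by (simp add: divide_ennreal ennreal_plus[symmetric] del: ennreal_plus flip: ennreal_1)
    ultimately show ?thesis by (simp add: conj_exponent_iff)
  qed
  let ?U = "\<lambda>w. complex_of_real (norm (F w) * norm (G (z - w)) powr (1 / r))"
  let ?V = "\<lambda>w. complex_of_real (norm (G (z - w)) powr (1 / q))"
  have "(norm (F w) * norm (G (z - w)) powr (1 / r)) * norm (G (z - w)) powr (1 / q)
      = norm (F w) * norm (G (z - w))" for w
    using q by (simp add: mult.assoc powr_add[symmetric])
  then have UV: "norm (?U w) * norm (?V w) = norm (F w) * norm (G (z - w))" for w
    by (simp only: norm_of_real abs_mult abs_norm_cancel abs_of_nonneg[OF powr_ge_zero])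
  have "Lp_norm (ennreal r) ?U \<le> ennreal (j powr (1 / r))"
  proof (subst Lp_norm_ennreal_le_iff)
    have "norm (?U w) powr r = norm (F w) powr r * norm (G (z - w))" for w
      using r by (simp only: norm_of_real abs_mult abs_norm_cancel abs_of_nonneg[OF powr_ge_zero])
        (simp add: powr_mult powr_powr)
    then show "(\<integral>\<^sup>+w. ennreal (norm (?U w) powr r) \<partial>lborel) \<le> ennreal ((j powr (1 / r)) powr r)"
      using real r by (simp add: powr_powr ennreal_mult)
  qed (use r in auto)
  moreover have "Lp_norm (ennreal q) ?V \<le> ennreal (g powr (1 / q))"
  proof (subst Lp_norm_ennreal_le_iff)
    have "norm (?V w) powr q = norm (G (z - w))" for w
      using q by (simp add: powr_powr)
    then show "(\<integral>\<^sup>+w. ennreal (norm (?V w) powr q) \<partial>lborel) \<le> ennreal ((g powr (1 / q)) powr q)"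
      using g q nn_integral_lborel_reflect[of "\<lambda>w. ennreal (norm (G w))" z]
      by (simp add: powr_powr Lp_norm_1)
  qed (use q in auto)
  ultimately have "Lp_norm (ennreal r) ?U * Lp_norm (ennreal q) ?V
      \<le> ennreal (j powr (1 / r)) * ennreal (g powr (1 / q))"
    by (rule mult_mono) auto
  moreover have "(\<integral>\<^sup>+w. ennreal (norm (F w)) * ennreal (norm (G (z - w))) \<partial>lborel)
      = (\<integral>\<^sup>+w. ennreal (norm (?U w)) * ennreal (norm (?V w)) \<partial>lborel)"
    by (simp only: ennreal_mult[symmetric, OF norm_ge_zero norm_ge_zero] UV)
  moreover have "\<dots> \<le> Lp_norm (ennreal r) ?U * Lp_norm (ennreal q) ?V"
    using Holder_Lp_norm[of "ennreal r" ?U ?V] r by (simp add: cq flip: ennreal_1)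
  ultimately have "ennreal h \<le> ennreal (j powr (1 / r)) * ennreal (g powr (1 / q))"
    using h by order
  then have "h \<le> j powr (1 / r) * g powr (1 / q)"
    by (simp flip: ennreal_mult)
  then have "h powr r \<le> (j powr (1 / r) * g powr (1 / q)) powr r"
    using h r by (intro powr_mono2) auto
  also have "\<dots> = j * g powr (r - 1)"
    using r real by (simp add: powr_mult powr_powr q_def)
  finally show ?thesis
    using real by (simp add: ennreal_leI mult.commute flip: ennreal_mult)
qed

text \<open>The convolution of |F| and |G| takes values in [0,\<infinity>], whereas
  \<open>Lp_norm\<close> is defined for complex functions. The inequality is therefore stated for a
  function \<open>H\<close> dominated by the convolution.\<close>

theorem Young_convolution:
  fixes F G H :: "'a::euclidean_space \<Rightarrow> complex"
  assumes p: "1 \<le> p"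
    and [measurable]: "F \<in> borel_measurable borel" "G \<in> borel_measurable borel"
      "H \<in> borel_measurable borel"
    and H: "\<And>z. ennreal (norm (H z))
      \<le> (\<integral>\<^sup>+w. ennreal (norm (F w)) * ennreal (norm (G (z - w))) \<partial>lborel)"
  shows "Lp_norm p H \<le> Lp_norm p F * Lp_norm 1 G"
proof (cases "Lp_norm p F = 0 \<or> Lp_norm 1 G = 0")
  case True
  \<comment> \<open>Since 0 * \<infinity> = 0, one vanishing norm has to force H = 0, whatever the
    other norm is.\<close>
  have "ennreal (norm (H z)) = 0" for z
  proof -
    have "(AE w in lborel. F w = 0) \<or> (AE w in lborel. G (z - w) = 0)"
      using True p Lp_norm_eq_0_AE[of F p] Lp_norm_eq_0_AE[of G 1]
        AE_pullback[of "\<lambda>w. z - w" "\<lambda>w. G w = 0" 1] by (auto simp: nn_integral_lborel_reflect)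
    then have "AE w in lborel. ennreal (norm (F w)) * ennreal (norm (G (z - w))) = 0"
      by auto
    then have "(\<integral>\<^sup>+w. ennreal (norm (F w)) * ennreal (norm (G (z - w))) \<partial>lborel) = 0"
      by (subst nn_integral_0_iff_AE) auto
    with H[of z] show ?thesis by simp
  qed
  then have "H = (\<lambda>_. 0)" by auto
  moreover have "Lp_norm p (\<lambda>_::'a. 0) = 0"
    by (auto simp: Lp_norm_def zero_ennreal_def[symmetric] intro!: antisym esssup_I)
  ultimately show ?thesis by simp
next
  case nz: False
  show ?thesis
  proof (cases "Lp_norm p F = \<infinity> \<or> Lp_norm 1 G = \<infinity>")
    case True
    then show ?thesis using nz by (auto simp: ennreal_mult_eq_top_iff)
  next
    case False
    then obtain a g where ag: "Lp_norm p F = ennreal a" "Lp_norm 1 G = ennreal g"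
        "a \<ge> 0" "g \<ge> 0"
      by (cases "Lp_norm p F"; cases "Lp_norm 1 G") auto
    with nz have pos: "a > 0" "g > 0" by (auto simp: less_le)
    have G: "(\<integral>\<^sup>+w. ennreal (norm (G (z - w))) \<partial>lborel) = ennreal g" for z
      using ag nn_integral_lborel_reflect[of "\<lambda>w. ennreal (norm (G w))" z] by (simp add: Lp_norm_1)
    have G': "(\<integral>\<^sup>+z. ennreal (norm (G (z - w))) \<partial>lborel) = ennreal g" for w
      using ag nn_integral_lborel_affine[of "\<lambda>w. ennreal (norm (G w))" 1 "- w"]
      by (simp add: Lp_norm_1 add.commute)
    have tonelli: "(\<integral>\<^sup>+z. (\<integral>\<^sup>+w. \<Phi> w * ennreal (norm (G (z - w))) \<partial>lborel) \<partial>lborel)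
        = (\<integral>\<^sup>+w. \<Phi> w \<partial>lborel) * ennreal g"
      if [measurable]: "\<Phi> \<in> borel_measurable borel" for \<Phi> :: "'a \<Rightarrow> ennreal"
    proof -
      have "(\<integral>\<^sup>+z. (\<integral>\<^sup>+w. \<Phi> w * ennreal (norm (G (z - w))) \<partial>lborel) \<partial>lborel)
          = (\<integral>\<^sup>+w. (\<integral>\<^sup>+z. \<Phi> w * ennreal (norm (G (z - w))) \<partial>lborel) \<partial>lborel)"
        by (rule lborel_pair.Fubini') measurable
      also have "\<dots> = (\<integral>\<^sup>+w. \<Phi> w * ennreal g \<partial>lborel)"
        by (subst nn_integral_cmult) (auto simp: G')
      finally show ?thesis by (simp add: nn_integral_multc)
    qed
    have "p = 1 \<or> p = \<infinity> \<or> (\<exists>r>1. p = ennreal r)"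
      using p by (cases rule: conj_exponent_cases) auto
    then consider "p = 1" | "p = \<infinity>" | r where "r > 1" "p = ennreal r" by blast
    then show ?thesis
    proof cases
      case 1
      have "(\<integral>\<^sup>+z. ennreal (norm (H z)) \<partial>lborel)
          \<le> (\<integral>\<^sup>+z. (\<integral>\<^sup>+w. ennreal (norm (F w)) * ennreal (norm (G (z - w))) \<partial>lborel) \<partial>lborel)"
        by (intro nn_integral_mono H)
      also have "\<dots> = Lp_norm 1 F * Lp_norm 1 G"
        using ag by (subst tonelli) (auto simp: Lp_norm_1)
      finally show ?thesis using 1 by (simp add: Lp_norm_1)
    next
      case 2
      have "ennreal (norm (H z)) \<le> Lp_norm p F * Lp_norm 1 G" for z
      proof -
        have "AE w in lborel. ennreal (norm (F w)) \<le> Lp_norm p F"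
          using esssup_AE[of "\<lambda>w. ennreal (norm (F w))" lborel] 2 by (simp add: Lp_norm_def)
        then have "(\<integral>\<^sup>+w. ennreal (norm (F w)) * ennreal (norm (G (z - w))) \<partial>lborel)
            \<le> (\<integral>\<^sup>+w. Lp_norm p F * ennreal (norm (G (z - w))) \<partial>lborel)"
          by (intro nn_integral_mono_AE) (auto elim!: eventually_mono intro: mult_right_mono)
        also have "\<dots> = Lp_norm p F * Lp_norm 1 G"
          using ag by (subst nn_integral_cmult) (auto simp: G)
        finally show ?thesis using H[of z] by order
      qed
      then show ?thesis using 2 by (auto simp: Lp_norm_def intro!: esssup_I)
    next
      case (3 r)
      have IF: "(\<integral>\<^sup>+z. ennreal (norm (F z) powr r) \<partial>lborel) = ennreal (a powr r)"
        using 3 ag by (intro Lp_norm_ennreal_eqD) auto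
      have "(\<integral>\<^sup>+z. ennreal (norm (H z) powr r) \<partial>lborel)
          \<le> (\<integral>\<^sup>+z. ennreal (g powr (r - 1)) *
              (\<integral>\<^sup>+w. ennreal (norm (F w) powr r) * ennreal (norm (G (z - w))) \<partial>lborel) \<partial>lborel)"
        using 3 ag pos H by (intro nn_integral_mono convolution_powr_bound) auto
      also have "\<dots> = ennreal (g powr (r - 1)) * (ennreal (a powr r) * ennreal g)"
        by (subst nn_integral_cmult) (auto simp: tonelli IF)
      also have "\<dots> = ennreal ((a * g) powr r)"
        using pos by (simp add: powr_mult powr_diff flip: ennreal_mult)
      finally have "Lp_norm p H \<le> ennreal (a * g)"
        using 3 ag by (simp add: Lp_norm_ennreal_le_iff)
      then show ?thesis using ag by (simp add: ennreal_mult)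
    qed
  qed
qed

text \<open>Connects the exponent 2p, at which Hoelder's inequality is applied to V, with the
  exponent p for V^2, the quantity that the convolution controls.\<close>

lemma Lp_norm_double_square_le:
  fixes F :: "'a::euclidean_space \<Rightarrow> complex"
  assumes [measurable]: "F \<in> borel_measurable borel" and p: "1 \<le> p"
  shows "(Lp_norm (2 * p) F)\<^sup>2 \<le> Lp_norm p (\<lambda>z. (F z)\<^sup>2)"
proof (cases "Lp_norm p (\<lambda>z. (F z)\<^sup>2)")
  case (real s)
  have "Lp_norm (2 * p) F \<le> ennreal (sqrt s)"
  proof (cases p)
    case top
    have "AE z in lborel. ennreal (norm ((F z)\<^sup>2)) \<le> Lp_norm p (\<lambda>z. (F z)\<^sup>2)"
      using esssup_AE[of "\<lambda>w. ennreal (norm ((F w)\<^sup>2))" lborel] top by (simp add: Lp_norm_def)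
    then have "AE z in lborel. ennreal (norm (F z)) \<le> ennreal (sqrt s)"
      using real by (auto elim!: eventually_mono simp: norm_power real_le_rsqrt intro!: ennreal_leI)
    moreover have "2 * p = \<infinity>" using top by (simp add: ennreal_mult_eq_top_iff)
    ultimately show ?thesis
      by (auto simp: Lp_norm_def intro!: esssup_I)
  next
    case r: (real r)
    with p have r1: "r \<ge> 1" by (simp flip: ennreal_1)
    have n: "norm ((F z)\<^sup>2) powr r = norm (F z) powr (2 * r)" for z
      by (simp add: norm_power powr_powr flip: powr_numeral)
    have "(\<integral>\<^sup>+z. ennreal (norm ((F z)\<^sup>2) powr r) \<partial>lborel) = ennreal (s powr r)"
      using real r r1 by (intro Lp_norm_ennreal_eqD) auto
    moreover have "2 * p = ennreal (2 * r)" using r by (simp add: ennreal_mult)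
    moreover have "s powr r = sqrt s powr (2 * r)"
      using real by (simp add: powr_half_sqrt[symmetric] powr_powr)
    ultimately show ?thesis
      using r1 real by (simp add: Lp_norm_ennreal_le_iff n)
  qed
  then have "(Lp_norm (2 * p) F)\<^sup>2 \<le> (ennreal (sqrt s))\<^sup>2"
    by (intro power_mono) auto
  then show ?thesis using real by (simp add: ennreal_power)
qed simp

text \<open>Interpolation between L^1 and L^\<infinity>: |F|^r \<le> B^(r-1) |F|.\<close>

lemma Lp_norm_finite:
  fixes F :: "'a::euclidean_space \<Rightarrow> complex"
  assumes [measurable]: "F \<in> borel_measurable borel" and p: "1 \<le> p"
    and B: "\<And>z. norm (F z) \<le> B" and 1: "Lp_norm 1 F < \<infinity>"
  shows "Lp_norm p F < \<infinity>"
proof (cases p)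
  case top
  have "Lp_norm \<infinity> F \<le> ennreal B"
    by (auto simp: Lp_norm_def intro!: esssup_I ennreal_leI B)
  then show ?thesis using top by (auto simp: le_less_trans)
next
  case (real r)
  with p have r: "r \<ge> 1" by (simp flip: ennreal_1)
  have "norm (F z) powr r \<le> B powr (r - 1) * norm (F z)" for z
  proof -
    have "norm (F z) powr r = norm (F z) powr (r - 1) * norm (F z)"
      using powr_add[of "norm (F z)" "r - 1" 1] by simp
    also have "\<dots> \<le> B powr (r - 1) * norm (F z)"
      using r B by (intro mult_right_mono powr_mono2) auto
    finally show ?thesis .
  qed
  then have "(\<integral>\<^sup>+z. ennreal (norm (F z) powr r) \<partial>lborel)
      \<le> (\<integral>\<^sup>+z. ennreal (B powr (r - 1)) * ennreal (norm (F z)) \<partial>lborel)"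
    by (intro nn_integral_mono) (simp add: ennreal_leI flip: ennreal_mult)
  also have "\<dots> = ennreal (B powr (r - 1)) * Lp_norm 1 F"
    unfolding Lp_norm_1 by (rule nn_integral_cmult) measurable
  also have "\<dots> < \<infinity>" using 1 by (simp add: ennreal_mult_less_top)
  finally show ?thesis using real r by (auto simp: Lp_norm_def Let_def)
qed

section \<open>Weights and rapidly decreasing functions\<close>

lemma weight_functionD:
  assumes "weight_function \<omega> K b"
  shows weight_continuous: "continuous_on {0..} \<omega>"
    and weight_mono: "0 \<le> s \<Longrightarrow> s \<le> t \<Longrightarrow> \<omega> s \<le> \<omega> t"
    and weight_nonneg: "0 \<le> t \<Longrightarrow> 0 \<le> \<omega> t"
    and weight_K: "1 \<le> K"
    and weight_double: "0 \<le> t \<Longrightarrow> \<omega> (2 * t) \<le> K * (1 + \<omega> t)"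
    and weight_b: "0 < b"
    and weight_log: "\<exists>a. \<forall>t\<ge>0. a + b * ln (1 + t) \<le> \<omega> t"
  using assms by (auto simp: weight_function_def mono_on_def)

text \<open>Doubling and monotonicity replace subadditivity, since u + v \<le> 2 max(u,v). Assuming
  only t \<le> u + v makes the bound fit norms of sums.\<close>

lemma weight_triangle:
  assumes w: "weight_function \<omega> K b" and t: "0 \<le> t" "t \<le> u + v" and uv: "0 \<le> u" "0 \<le> v"
  shows "\<omega> t \<le> K * (1 + \<omega> u + \<omega> v)"
proof -
  have "\<omega> t \<le> \<omega> (2 * max u v)"
    using t by (intro weight_mono[OF w]) auto
  also have "\<dots> \<le> K * (1 + \<omega> (max u v))"
    using uv by (intro weight_double[OF w]) auto
  also have "\<dots> \<le> K * (1 + \<omega> u + \<omega> v)"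
    using weight_nonneg[OF w, of u] weight_nonneg[OF w, of v] weight_K[OF w] uv
    by (intro mult_left_mono) (auto simp: max_def)
  finally show ?thesis .
qed

lemma exp_weight_triangle:
  assumes w: "weight_function \<omega> K b" and t: "0 \<le> t" "t \<le> u + v" and uv: "0 \<le> u" "0 \<le> v"
    and l: "0 \<le> l"
  shows "exp (l * \<omega> t) \<le> exp (K * l) * (exp (K * l * \<omega> u) * exp (K * l * \<omega> v))"
proof -
  have "l * \<omega> t \<le> l * (K * (1 + \<omega> u + \<omega> v))"
    using l by (intro mult_left_mono weight_triangle[OF w t uv])
  then show ?thesis by (simp add: exp_add[symmetric] algebra_simps)
qed

lemma weight_measurable:
  assumes "weight_function \<omega> K b"
  shows "(\<lambda>z::'a::euclidean_space. \<omega> (norm z)) \<in> borel_measurable borel"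
    and "continuous_on UNIV (\<lambda>z::'a::euclidean_space. \<omega> (norm z))"
proof -
  show "continuous_on UNIV (\<lambda>z::'a. \<omega> (norm z))"
    by (rule continuous_on_compose2[OF weight_continuous[OF assms]]) (auto intro: continuous_intros)
  then show "(\<lambda>z::'a. \<omega> (norm z)) \<in> borel_measurable borel"
    by (rule borel_measurable_continuous_onI)
qed

lemma nn_integral_inverse_1_plus_square_finite:
  "(\<integral>\<^sup>+x. ennreal (inverse (1 + x\<^sup>2)) \<partial>lborel) < \<infinity>"
proof -
  have "integrable lborel (\<lambda>x::real. inverse (1 + x\<^sup>2))"
    using integrable_inverse_1_plus_square by (simp add: set_integrable_def einterval_eq)
  then show ?thesis by (simp add: integrable_iff_bounded)
qed

text \<open>By the logarithmic lower bound (\<gamma>), e^{-l\<omega>} decays at least like the power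
  -lb of 1 + |z|. The choice lb = 2d, with d the dimension, provides one factor (1 + |z|)^(-2) per
  coordinate; each is at most 1/(1 + z_i^2), and the integral of the product splits into
  one-dimensional ones.\<close>

lemma weight_decay_integrable:
  assumes w: "weight_function \<omega> K b"
  obtains l where "l > 0" "(\<integral>\<^sup>+z. ennreal (exp (- l * \<omega> (norm (z::'a::euclidean_space)))) \<partial>lborel) < \<infinity>"
proof -
  obtain a where a: "\<And>t. t \<ge> 0 \<Longrightarrow> a + b * ln (1 + t) \<le> \<omega> t"
    using weight_log[OF w] by blast
  define l where "l = 2 * real DIM('a) / b"
  have l: "l > 0" using weight_b[OF w] by (simp add: l_def)
  have bound: "exp (- l * \<omega> (norm z)) \<le> exp (- l * a) * (\<Prod>b\<in>Basis. inverse (1 + (z \<bullet> b)\<^sup>2))" for z :: 'a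
  proof -
    have "l * (a + b * ln (1 + norm z)) \<le> l * \<omega> (norm z)"
      using l by (intro mult_left_mono a) auto
    also have "l * (a + b * ln (1 + norm z)) = l * a + 2 * real DIM('a) * ln (1 + norm z)"
      using weight_b[OF w] by (simp add: l_def field_simps)
    finally have "exp (- l * \<omega> (norm z)) \<le> exp (- l * a - real (2 * DIM('a)) * ln (1 + norm z))"
      by simp
    also have "\<dots> = exp (- l * a) * inverse (exp (real (2 * DIM('a)) * ln (1 + norm z)))"
      by (simp add: exp_diff divide_inverse)
    also have "exp (real (2 * DIM('a)) * ln (1 + norm z)) = (1 + norm z) ^ (2 * DIM('a))"
      by (subst exp_of_nat_mult) (simp add: add_pos_nonneg)
    also have "inverse \<dots> = (\<Prod>b\<in>(Basis::'a set). inverse ((1 + norm z)\<^sup>2))"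
      by (simp add: power_mult power_inverse)
    also have "\<dots> \<le> (\<Prod>b\<in>Basis. inverse (1 + (z \<bullet> b)\<^sup>2))"
    proof (intro prod_mono conjI)
      fix b :: 'a assume "b \<in> Basis"
      then have "\<bar>z \<bullet> b\<bar> \<le> norm z" by (rule Basis_le_norm)
      then have "(z \<bullet> b)\<^sup>2 \<le> (norm z)\<^sup>2" by (rule abs_le_square_iff[THEN iffD1, OF order_trans]) simp
      then have "1 + (z \<bullet> b)\<^sup>2 \<le> (1 + norm z)\<^sup>2"
        by (simp add: power2_sum add_increasing2)
      then show "inverse ((1 + norm z)\<^sup>2) \<le> inverse (1 + (z \<bullet> b)\<^sup>2)"
        by (intro le_imp_inverse_le) (auto simp: add_pos_nonneg)
    qed auto
    finally show ?thesis by simp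
  qed
  have "(\<integral>\<^sup>+z. ennreal (exp (- l * \<omega> (norm (z::'a)))) \<partial>lborel)
      \<le> (\<integral>\<^sup>+z. ennreal (exp (- l * a)) * (\<Prod>b\<in>Basis. ennreal (inverse (1 + ((z::'a) \<bullet> b)\<^sup>2))) \<partial>lborel)"
    using bound by (intro nn_integral_mono)
      (simp add: prod_ennreal ennreal_mult[symmetric] prod_nonneg ennreal_leI)
  also have "\<dots> = ennreal (exp (- l * a)) *
      (\<integral>\<^sup>+z. (\<Prod>b\<in>Basis. ennreal (inverse (1 + ((z::'a) \<bullet> b)\<^sup>2))) \<partial>lborel)"
    by (rule nn_integral_cmult) measurable
  also have "(\<integral>\<^sup>+z. (\<Prod>b\<in>Basis. ennreal (inverse (1 + ((z::'a) \<bullet> b)\<^sup>2))) \<partial>lborel)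
      = (\<integral>\<^sup>+x. ennreal (inverse (1 + x\<^sup>2)) \<partial>lborel) ^ DIM('a)"
    by (subst nn_integral_lborel_prod) auto
  also have "ennreal (exp (- l * a)) * \<dots> < \<infinity>"
    using nn_integral_inverse_1_plus_square_finite
    by (auto intro!: ennreal_mult_less_top[THEN iffD2] simp: power_less_top_ennreal)
  finally show ?thesis using that l by blast
qed

section \<open>Weighted functions and rapid decay\<close>

lemma norm_weighted: "norm (weighted \<omega> l F z) = exp (l * \<omega> (norm z)) * norm (F z)"
  by (simp add: weighted_def norm_mult)

lemma weighted_measurable:
  assumes w: "weight_function \<omega> K b" and F: "F \<in> borel_measurable borel"
  shows "weighted \<omega> l F \<in> borel_measurable borel"
proof -
  note F [measurable] weight_measurable(1)[OF w, measurable]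
  show ?thesis unfolding weighted_def by measurable
qed

lemma weighted_continuous:
  assumes w: "weight_function \<omega> K b" and F: "continuous_on UNIV F"
  shows "continuous_on UNIV (weighted \<omega> l F)"
  unfolding weighted_def by (intro continuous_intros weight_measurable(2)[OF w] F)

text \<open>The set where a continuous |F| exceeds the essential supremum is open and null, hence
  empty.\<close>

lemma continuous_le_Lp_infinity:
  fixes F :: "'a::euclidean_space \<Rightarrow> complex"
  assumes F: "continuous_on UNIV F"
  shows "ennreal (norm (F x)) \<le> Lp_norm \<infinity> F"
proof (cases "Lp_norm \<infinity> F")
  case (real c)
  show ?thesis
  proof (rule ccontr)
    assume "\<not> ?thesis"
    define S where "S = {y. norm (F y) > c}"
    from \<open>\<not> ?thesis\<close> real have "S \<noteq> {}" by (auto simp: S_def not_le ennreal_less_iff)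
    moreover have "open S"
      unfolding S_def by (intro open_Collect_less continuous_intros F)
    ultimately have "\<not> negligible S" by (rule open_not_negligible[rotated])
    have "AE y in lborel. ennreal (norm (F y)) \<le> Lp_norm \<infinity> F"
      using esssup_AE[of "\<lambda>y. ennreal (norm (F y))" lborel] by (simp add: Lp_norm_def)
    then have "AE y in lborel. y \<notin> S"
      using real by (auto elim!: eventually_mono simp: S_def)
    then have "S \<in> null_sets lborel"
      using \<open>open S\<close> by (subst AE_iff_null_sets) auto
    then have "negligible S"
      by (simp add: negligible_iff_null_sets null_sets_completionI)
    with \<open>\<not> negligible S\<close> show False by contradiction
  qed
qed simp

lemma Lp_infinity_power2_le:
  fixes F :: "'a::euclidean_space \<Rightarrow> complex"
  assumes [measurable]: "F \<in> borel_measurable borel"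
    and C: "\<And>z. (ennreal (norm (F z)))\<^sup>2 \<le> C"
  shows "(Lp_norm \<infinity> F)\<^sup>2 \<le> C"
proof (cases C)
  case (real c)
  have "norm (F z) \<le> sqrt c" for z
    using C[of z] real by (simp add: ennreal_power real_le_rsqrt)
  then have "Lp_norm \<infinity> F \<le> ennreal (sqrt c)"
    by (auto simp: Lp_norm_def intro!: esssup_I ennreal_leI)
  then have "(Lp_norm \<infinity> F)\<^sup>2 \<le> (ennreal (sqrt c))\<^sup>2"
    by (intro power_mono) auto
  then show ?thesis using real by (simp add: ennreal_power)
qed simp

text \<open>The bounds hold at every point, not merely almost everywhere, so they survive
  restriction to slices. The exponent l = 0 is included and yields boundedness.\<close>

definition rapidly_decreasing :: "(real \<Rightarrow> real) \<Rightarrow> ('a::euclidean_space \<Rightarrow> complex) \<Rightarrow> bool" where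
  "rapidly_decreasing \<omega> F \<longleftrightarrow> F \<in> borel_measurable borel \<and>
     (\<forall>l\<ge>0. \<exists>C. \<forall>z. exp (l * \<omega> (norm z)) * norm (F z) \<le> C)"

lemma rapidly_decreasing_bounded:
  assumes "rapidly_decreasing \<omega> F"
  obtains B where "\<And>z. norm (F z) \<le> B"
  using assms unfolding rapidly_decreasing_def by (force dest: spec[of _ 0])

lemma rapidly_decreasing_weighted:
  assumes w: "weight_function \<omega> K b" and F: "rapidly_decreasing \<omega> F" and l: "0 \<le> l"
  shows "rapidly_decreasing \<omega> (weighted \<omega> l F)"
  unfolding rapidly_decreasing_def norm_weighted
proof (intro conjI allI impI)
  show "weighted \<omega> l F \<in> borel_measurable borel"
    using F by (intro weighted_measurable[OF w]) (simp add: rapidly_decreasing_def)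
  fix m :: real assume "m \<ge> 0"
  then obtain C where "\<And>z. exp ((m + l) * \<omega> (norm z)) * norm (F z) \<le> C"
    using F l unfolding rapidly_decreasing_def by (meson add_nonneg_nonneg)
  then show "\<exists>C. \<forall>z. exp (m * \<omega> (norm z)) * (exp (l * \<omega> (norm z)) * norm (F z)) \<le> C"
    by (intro exI[of _ C]) (simp add: distrib_right exp_add mult.assoc)
qed

text \<open>With h(y) = (x, y), this makes every slice of a function of two variables integrable,
  whereas Fubini's theorem would give almost every slice. The norm condition transfers the decay in
  \<open>h y\<close> to decay in \<open>y\<close>.\<close>

lemma rapidly_decreasing_slice_integrable:
  fixes F :: "'a::euclidean_space \<Rightarrow> complex" and h :: "'b::euclidean_space \<Rightarrow> 'a"
  assumes w: "weight_function \<omega> K b" and F: "rapidly_decreasing \<omega> F"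
    and h: "h \<in> borel_measurable borel" and le: "\<And>y. norm y \<le> norm (h y)"
  shows "integrable lborel (\<lambda>y. F (h y))"
proof -
  obtain l where l: "l > 0" "(\<integral>\<^sup>+y. ennreal (exp (- l * \<omega> (norm (y::'b)))) \<partial>lborel) < \<infinity>"
    by (rule weight_decay_integrable[OF w])
  obtain C where C: "\<And>z. exp (l * \<omega> (norm z)) * norm (F z) \<le> C"
    using F l unfolding rapidly_decreasing_def by (meson less_imp_le)
  have [measurable]: "F \<in> borel_measurable borel" "h \<in> borel_measurable borel"
    using F h by (auto simp: rapidly_decreasing_def)
  have "0 \<le> C" using C[of 0] by (rule order_trans[rotated]) simp
  have "norm (F (h y)) \<le> C * exp (- l * \<omega> (norm y))" for y
  proof -
    have "l * \<omega> (norm y) \<le> l * \<omega> (norm (h y))"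
      using l by (intro mult_left_mono weight_mono[OF w] le) auto
    then have "exp (l * \<omega> (norm y)) * norm (F (h y)) \<le> exp (l * \<omega> (norm (h y))) * norm (F (h y))"
      by (intro mult_right_mono) auto
    also have "\<dots> \<le> C" by (rule C)
    finally show ?thesis by (simp add: exp_minus field_simps)
  qed
  then have "(\<integral>\<^sup>+y. ennreal (norm (F (h y))) \<partial>lborel)
      \<le> (\<integral>\<^sup>+y. ennreal C * ennreal (exp (- l * \<omega> (norm (y::'b)))) \<partial>lborel)"
    using \<open>0 \<le> C\<close> by (intro nn_integral_mono) (simp add: ennreal_leI flip: ennreal_mult)
  also have "\<dots> = ennreal C * (\<integral>\<^sup>+y. ennreal (exp (- l * \<omega> (norm (y::'b)))) \<partial>lborel)"
  proof -
    note weight_measurable(1)[OF w, measurable]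
    show ?thesis by (rule nn_integral_cmult) measurable
  qed
  also have "\<dots> < \<infinity>" using l by (simp add: ennreal_mult_less_top)
  finally show ?thesis by (simp add: integrable_iff_bounded)
qed

lemma rapidly_decreasing_integrable:
  assumes w: "weight_function \<omega> K b" and F: "rapidly_decreasing \<omega> F"
  shows "integrable lborel F"
  using rapidly_decreasing_slice_integrable[OF w F, of "\<lambda>y. y"] by simp

lemma rapidly_decreasing_Lp_finite:
  assumes w: "weight_function \<omega> K b" and F: "rapidly_decreasing \<omega> F" and p: "1 \<le> p"
  shows "Lp_norm p F < \<infinity>"
proof -
  obtain B where "\<And>z. norm (F z) \<le> B" using rapidly_decreasing_bounded[OF F] by blast
  moreover have "Lp_norm 1 F < \<infinity>"
    using rapidly_decreasing_integrable[OF w F] by (simp add: Lp_norm_1 integrable_iff_bounded)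
  moreover have "F \<in> borel_measurable borel" using F by (simp add: rapidly_decreasing_def)
  ultimately show ?thesis using p by (intro Lp_norm_finite[of F p B])
qed

text \<open>The pointwise form of the order-zero conditions in \<open>S_space\<close>, symmetric in
  f and its Fourier transform.\<close>

definition tame :: "(real \<Rightarrow> real) \<Rightarrow> (real^'n::finite \<Rightarrow> complex) \<Rightarrow> bool" where
  "tame \<omega> f \<longleftrightarrow> continuous_on UNIV f \<and> continuous_on UNIV (fourier f) \<and>
     rapidly_decreasing \<omega> f \<and> rapidly_decreasing \<omega> (fourier f)"

lemma multi_deriv_0: "multi_deriv (\<lambda>_. 0) f = f"
proof -
  have "fold (\<lambda>i. partial_deriv i ^^ 0) is f = f" for "is" :: "'a list"
    by (induction "is") auto
  then show ?thesis by (simp add: multi_deriv_def)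
qed

lemma S_space_tame:
  assumes w: "weight_function \<omega> K b" and f: "f \<in> S_space \<omega>"
  shows "tame \<omega> f"
proof -
  have decay: "rapidly_decreasing \<omega> g"
    if c: "continuous_on UNIV g" and b: "\<And>l. l > 0 \<Longrightarrow> Lp_norm \<infinity> (weighted \<omega> l g) < \<infinity>"
    for g :: "real^'n \<Rightarrow> complex"
    unfolding rapidly_decreasing_def
  proof (intro conjI allI impI)
    show "g \<in> borel_measurable borel" using c by (rule borel_measurable_continuous_onI)
    fix l :: real assume "l \<ge> 0"
    \<comment> \<open>\<open>S_space\<close> provides bounds for positive exponents; passing to
      \<open>l + 1\<close> covers l = 0 too, because \<omega> \<ge> 0.\<close>
    obtain C where C: "Lp_norm \<infinity> (weighted \<omega> (l + 1) g) = ennreal C" "C \<ge> 0"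
      using b[of "l + 1"] \<open>l \<ge> 0\<close> by (cases "Lp_norm \<infinity> (weighted \<omega> (l + 1) g)") auto
    have "exp (l * \<omega> (norm z)) * norm (g z) \<le> C" for z
    proof -
      have "exp (l * \<omega> (norm z)) * norm (g z) \<le> exp ((l + 1) * \<omega> (norm z)) * norm (g z)"
        using weight_nonneg[OF w, of "norm z"] by (intro mult_right_mono) (auto simp: distrib_right)
      also have "\<dots> \<le> C"
        using continuous_le_Lp_infinity[OF weighted_continuous[OF w c], of "l + 1" z] C
        by (simp add: norm_weighted)
      finally show ?thesis .
    qed
    then show "\<exists>C. \<forall>z. exp (l * \<omega> (norm z)) * norm (g z) \<le> C" by blast
  qed
  have c: "continuous_on UNIV f" "continuous_on UNIV (fourier f)"
    using f by (auto simp: S_space_def C_infinity_def dest: spec[of _ 0])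
  have "Lp_norm \<infinity> (weighted \<omega> l f) < \<infinity>" "Lp_norm \<infinity> (weighted \<omega> l (fourier f)) < \<infinity>" if "l > 0" for l
    using f that multi_deriv_0[of f] multi_deriv_0[of "fourier f"] unfolding S_space_def
    by (metis (no_types, lifting) mem_Collect_eq)+
  then show ?thesis unfolding tame_def using c by (auto intro!: decay)
qed

lemma tameD:
  assumes "tame \<omega> f"
  shows tame_continuous: "continuous_on UNIV f" and tame_fourier_continuous: "continuous_on UNIV (fourier f)"
    and tame_rapid: "rapidly_decreasing \<omega> f" and tame_fourier_rapid: "rapidly_decreasing \<omega> (fourier f)"
    and tame_measurable: "f \<in> borel_measurable borel"
    and tame_fourier_measurable: "fourier f \<in> borel_measurable borel"
  using assms by (auto simp: tame_def rapidly_decreasing_def)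

section \<open>Measurability and decay of the Rihaczek form\<close>

lemma cnj_measurable [measurable]: "cnj \<in> borel_measurable borel"
  by (intro borel_measurable_continuous_onI continuous_intros)

lemma Rihaczek_measurable:
  assumes f: "tame \<omega> f"
  shows "Rihaczek f \<in> borel_measurable borel"
proof -
  note tame_measurable[OF f, measurable] tame_fourier_measurable[OF f, measurable]
  show ?thesis unfolding Rihaczek_def split_beta' borel_prod[symmetric] by measurable
qed

lemma norm_Rihaczek: "norm (Rihaczek f (x, \<xi>)) = norm (f x) * norm (fourier f \<xi>)"
  by (simp add: Rihaczek_def norm_mult)

lemma norm_Pair_le: "norm (x, y) \<le> norm x + norm y"
  using norm_triangle_ineq[of "(x, 0)" "(0, y)"] by simp

lemma rapidly_decreasing_Rihaczek:
  assumes w: "weight_function \<omega> K b" and f: "tame \<omega> f"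
  shows "rapidly_decreasing \<omega> (Rihaczek f)"
  unfolding rapidly_decreasing_def
proof (intro conjI allI impI)
  show "Rihaczek f \<in> borel_measurable borel" by (rule Rihaczek_measurable[OF f])
  fix l :: real assume l: "l \<ge> 0"
  then have Kl: "K * l \<ge> 0" using weight_K[OF w] by simp
  obtain C where C: "\<And>z. exp (K * l * \<omega> (norm z)) * norm (f z) \<le> C"
    using tame_rapid[OF f] Kl unfolding rapidly_decreasing_def by meson
  obtain C' where C': "\<And>z. exp (K * l * \<omega> (norm z)) * norm (fourier f z) \<le> C'"
    using tame_fourier_rapid[OF f] Kl unfolding rapidly_decreasing_def by meson
  have "0 \<le> C" using C[of 0] by (rule order_trans[rotated]) simp
  have "exp (l * \<omega> (norm (x, \<xi>))) * norm (Rihaczek f (x, \<xi>)) \<le> exp (K * l) * (C * C')" for x \<xi>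
  proof -
    have "exp (l * \<omega> (norm (x, \<xi>))) * norm (Rihaczek f (x, \<xi>))
        \<le> exp (K * l) * (exp (K * l * \<omega> (norm x)) * exp (K * l * \<omega> (norm \<xi>))) * norm (Rihaczek f (x, \<xi>))"
      using l by (intro mult_right_mono exp_weight_triangle[OF w]) (auto intro: norm_Pair_le)
    also have "\<dots> = exp (K * l) * ((exp (K * l * \<omega> (norm x)) * norm (f x)) *
        (exp (K * l * \<omega> (norm \<xi>)) * norm (fourier f \<xi>)))"
      by (simp add: norm_Rihaczek)
    also have "\<dots> \<le> exp (K * l) * (C * C')"
      using \<open>0 \<le> C\<close> by (intro mult_left_mono mult_mono C C') auto
    finally show ?thesis .
  qed
  then show "\<exists>C. \<forall>z. exp (l * \<omega> (norm z)) * norm (Rihaczek f z) \<le> C" by (auto simp: split_paired_all)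
qed

section \<open>Integrals over pairs; time and frequency bounds for the Wigner transform\<close>

lemma nn_integral_lborel_pair:
  fixes \<Phi> :: "'a::euclidean_space \<times> 'b::euclidean_space \<Rightarrow> ennreal"
  assumes "\<Phi> \<in> borel_measurable borel"
  shows "(\<integral>\<^sup>+z. \<Phi> z \<partial>lborel) = (\<integral>\<^sup>+x. (\<integral>\<^sup>+y. \<Phi> (x, y) \<partial>lborel) \<partial>lborel)"
  using lborel.nn_integral_fst[of \<Phi> lborel] assms by (simp add: lborel_prod)

lemma nn_integral_lborel_pair_affine:
  fixes \<Phi> :: "(real^'n::finite) \<times> (real^'n) \<Rightarrow> ennreal"
  assumes [measurable]: "\<Phi> \<in> borel_measurable borel" and c: "a \<noteq> 0" "b \<noteq> 0"
  shows "(\<integral>\<^sup>+w. \<Phi> (x + a *\<^sub>R fst w, y + b *\<^sub>R snd w) \<partial>lborel)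
    = ennreal (1 / \<bar>a * b\<bar> ^ CARD('n)) * (\<integral>\<^sup>+w. \<Phi> w \<partial>lborel)"
proof -
  have "(\<lambda>w. \<Phi> (x + a *\<^sub>R fst w, y + b *\<^sub>R snd w)) \<in> borel_measurable (borel \<Otimes>\<^sub>M borel)"
    by measurable
  then have "(\<integral>\<^sup>+w. \<Phi> (x + a *\<^sub>R fst w, y + b *\<^sub>R snd w) \<partial>lborel)
      = (\<integral>\<^sup>+t. (\<integral>\<^sup>+s. \<Phi> (x + a *\<^sub>R t, y + b *\<^sub>R s) \<partial>lborel) \<partial>lborel)"
    unfolding borel_prod by (subst nn_integral_lborel_pair) simp_all
  also have "\<dots> = (\<integral>\<^sup>+t. ennreal (1 / \<bar>b\<bar> ^ CARD('n)) * (\<integral>\<^sup>+s. \<Phi> (x + a *\<^sub>R t, s) \<partial>lborel) \<partial>lborel)"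
    using c by (subst nn_integral_lborel_affine) auto
  also have "\<dots> = ennreal (1 / \<bar>b\<bar> ^ CARD('n)) * (\<integral>\<^sup>+t. (\<integral>\<^sup>+s. \<Phi> (x + a *\<^sub>R t, s) \<partial>lborel) \<partial>lborel)"
    by (rule nn_integral_cmult) measurable
  also have "(\<integral>\<^sup>+t. (\<integral>\<^sup>+s. \<Phi> (x + a *\<^sub>R t, s) \<partial>lborel) \<partial>lborel)
      = ennreal (1 / \<bar>a\<bar> ^ CARD('n)) * (\<integral>\<^sup>+t. (\<integral>\<^sup>+s. \<Phi> (t, s) \<partial>lborel) \<partial>lborel)"
    using c nn_integral_lborel_affine[of "\<lambda>t. \<integral>\<^sup>+s. \<Phi> (t, s) \<partial>lborel" a x] by simp
  also have "(\<integral>\<^sup>+t. (\<integral>\<^sup>+s. \<Phi> (t, s) \<partial>lborel) \<partial>lborel) = (\<integral>\<^sup>+w. \<Phi> w \<partial>lborel)"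
    by (subst nn_integral_lborel_pair) simp_all
  finally show ?thesis
    using ennreal_mult[of "1 / \<bar>b\<bar> ^ CARD('n)" "1 / \<bar>a\<bar> ^ CARD('n)"]
    by (simp add: abs_mult power_mult_distrib mult.assoc mult.commute[of "\<bar>a\<bar> ^ CARD('n)"])
qed

lemma Wig_measurable:
  assumes [measurable]: "f \<in> borel_measurable borel"
  shows "Wig \<tau> f \<in> borel_measurable borel"
  unfolding Wig_def split_beta' borel_prod[symmetric] by measurable

text \<open>Holds without integrability, because the Bochner integral of a non-integrable function
  is 0.\<close>

lemma norm_integral_le_nn_integral:
  fixes f :: "'a \<Rightarrow> 'b::{banach, second_countable_topology}"
  shows "ennreal (norm (\<integral>x. f x \<partial>M)) \<le> (\<integral>\<^sup>+x. ennreal (norm (f x)) \<partial>M)"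
  by (cases "integrable M f") (auto simp: integral_norm_bound_ennreal not_integrable_integral_eq)

lemma norm_Wig_le_time:
  "ennreal (norm (Wig \<tau> f (x, \<xi>)))
    \<le> (\<integral>\<^sup>+t. ennreal (norm (f (x + \<tau> *\<^sub>R t)) * norm (f (x - (1 - \<tau>) *\<^sub>R t))) \<partial>lborel)"
  unfolding Wig_def prod.case
  by (rule order_trans[OF norm_integral_le_nn_integral]) (simp add: norm_mult)

text \<open>Wig_\<tau> f(x,\<xi>) is the inner product of t \<mapsto> e^{-it\<xi>} f(x+\<tau>t) and
  t \<mapsto> f(x-(1-\<tau>)t). The transforms of both are rescaled copies of f^ up to phases, so
  after Parseval's formula only a change of variables remains.\<close>

lemma norm_Wig_le_frequency:
  fixes f :: "real^'n::finite \<Rightarrow> complex"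
  assumes w: "weight_function \<omega> K b" and f: "tame \<omega> f" and \<tau>: "0 < \<tau>" "\<tau> < 1"
  shows "ennreal ((2 * pi) ^ CARD('n)) * ennreal (norm (Wig \<tau> f (x, \<xi>)))
    \<le> (\<integral>\<^sup>+\<eta>. ennreal (norm (fourier f (\<xi> + (1 - \<tau>) *\<^sub>R \<eta>)) * norm (fourier f (\<xi> - \<tau> *\<^sub>R \<eta>))) \<partial>lborel)"
proof -
  note tame_measurable[OF f, measurable] tame_fourier_measurable[OF f, measurable]
  have fi: "integrable lborel f" and fhi: "integrable lborel (fourier f)"
    using rapidly_decreasing_integrable[OF w] tame_rapid[OF f] tame_fourier_rapid[OF f] by auto
  obtain B where B: "\<And>z. norm (f z) \<le> B" using rapidly_decreasing_bounded[OF tame_rapid[OF f]] by blast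
  let ?f = "\<lambda>t. cis (t \<bullet> (- \<xi>)) * f (x + \<tau> *\<^sub>R t)"
  let ?h = "\<lambda>t. f (x + (- (1 - \<tau>)) *\<^sub>R t)"
  have t1: "- (1 - \<tau>) \<noteq> 0" "\<tau> \<noteq> 0" using \<tau> by auto
  have f': "integrable lborel ?f"
    by (rule Bochner_Integration.integrable_bound[OF integrable_lborel_affine[OF fi t1(2)]])
       (auto simp: norm_mult)
  have h: "integrable lborel ?h" by (rule integrable_lborel_affine[OF fi t1(1)])
  have fh: "fourier ?h \<eta> = of_real (1 / (1 - \<tau>) ^ CARD('n)) * cis (x \<bullet> \<eta> / (- (1 - \<tau>))) *
      fourier f (\<eta> /\<^sub>R (- (1 - \<tau>)))" for \<eta>
    using \<tau> by (subst fourier_affine[OF _ t1(1)]) auto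
  have ff: "fourier ?f \<eta> = of_real (1 / \<tau> ^ CARD('n)) * cis (x \<bullet> (\<eta> + \<xi>) / \<tau>) *
      fourier f ((\<eta> + \<xi>) /\<^sub>R \<tau>)" for \<eta>
    using \<tau> by (subst fourier_modulate, subst fourier_affine[OF _ t1(2)]) auto
  have ih: "integrable lborel (fourier ?h)"
  proof (rule Bochner_Integration.integrable_bound)
    show "integrable lborel (\<lambda>\<eta>. of_real (1 / (1 - \<tau>) ^ CARD('n)) * fourier f (0 + (inverse (- (1 - \<tau>))) *\<^sub>R \<eta>))"
      by (intro integrable_mult_right integrable_lborel_affine fhi) (use t1 in auto)
    show "fourier ?h \<in> borel_measurable lborel" using fourier_measurable[of ?h] by simp
    show "AE \<eta> in lborel. norm (fourier ?h \<eta>) \<le> norm (of_real (1 / (1 - \<tau>) ^ CARD('n)) *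
        fourier f (0 + (inverse (- (1 - \<tau>))) *\<^sub>R \<eta>))"
      unfolding fh by (simp add: norm_mult norm_divide)
  qed
  have c: "continuous_on UNIV ?h"
    by (intro continuous_on_compose2[OF tame_continuous[OF f]] continuous_intros) auto
  have "of_real ((2 * pi) ^ CARD('n)) * Wig \<tau> f (x, \<xi>)
      = of_real ((2 * pi) ^ CARD('n)) * (\<integral>t. ?f t * cnj (?h t) \<partial>lborel)"
    by (simp only: Wig_def prod.case scaleR_minus_left inner_minus_right diff_conv_add_uminus)
  also have "\<dots> = (\<integral>\<eta>. fourier ?f \<eta> * cnj (fourier ?h \<eta>) \<partial>lborel)"
    by (rule parseval[OF f' h c B ih])
  finally have eq: "of_real ((2 * pi) ^ CARD('n)) * Wig \<tau> f (x, \<xi>)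
      = (\<integral>\<eta>. fourier ?f \<eta> * cnj (fourier ?h \<eta>) \<partial>lborel)" .
  have "ennreal ((2 * pi) ^ CARD('n)) * ennreal (norm (Wig \<tau> f (x, \<xi>)))
      = ennreal (norm (of_real ((2 * pi) ^ CARD('n)) * Wig \<tau> f (x, \<xi>)))"
    by (simp add: norm_mult norm_power flip: ennreal_mult)
  also have "\<dots> \<le> (\<integral>\<^sup>+\<eta>. ennreal (norm (fourier ?f \<eta> * cnj (fourier ?h \<eta>))) \<partial>lborel)"
    unfolding eq by (rule norm_integral_le_nn_integral)
  also have "\<dots> = (\<integral>\<^sup>+\<eta>. ennreal (1 / (\<tau> * (1 - \<tau>)) ^ CARD('n)) *
      ennreal (norm (fourier f ((\<eta> + \<xi>) /\<^sub>R \<tau>)) * norm (fourier f (\<eta> /\<^sub>R (- (1 - \<tau>))))) \<partial>lborel)"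
    unfolding ff fh using \<tau> norm_of_real[of "1 - \<tau>", where 'a = complex]
    by (intro nn_integral_cong) (simp add: norm_mult norm_divide norm_power power_mult_distrib flip: ennreal_mult)
  also have "\<dots> = ennreal (1 / (\<tau> * (1 - \<tau>)) ^ CARD('n)) * (\<integral>\<^sup>+\<eta>.
      ennreal (norm (fourier f ((\<eta> + \<xi>) /\<^sub>R \<tau>)) * norm (fourier f (\<eta> /\<^sub>R (- (1 - \<tau>))))) \<partial>lborel)"
    by (rule nn_integral_cmult) measurable
  \<comment> \<open>The substitution \<eta> = -(1-\<tau>)\<xi> + \<tau>(1-\<tau>)s clears both
    denominators: (\<eta>+\<xi>)/\<tau> = \<xi> + (1-\<tau>)s and -\<eta>/(1-\<tau>) = \<xi> -
    \<tau>s. Its Jacobian absorbs the prefactor.\<close>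
  also have "\<dots> = (\<integral>\<^sup>+s. (\<lambda>\<eta>. ennreal (norm (fourier f ((\<eta> + \<xi>) /\<^sub>R \<tau>)) * norm (fourier f (\<eta> /\<^sub>R (- (1 - \<tau>))))))
      (- (1 - \<tau>) *\<^sub>R \<xi> + (\<tau> * (1 - \<tau>)) *\<^sub>R s) \<partial>lborel)"
    using \<tau> by (subst nn_integral_lborel_affine) auto
  also have "\<dots> = (\<integral>\<^sup>+\<eta>. ennreal (norm (fourier f (\<xi> + (1 - \<tau>) *\<^sub>R \<eta>)) * norm (fourier f (\<xi> - \<tau> *\<^sub>R \<eta>))) \<partial>lborel)"
  proof (intro nn_integral_cong)
    fix s :: "real^'n"
    have "(- (1 - \<tau>) *\<^sub>R \<xi> + (\<tau> * (1 - \<tau>)) *\<^sub>R s + \<xi>) = \<tau> *\<^sub>R (\<xi> + (1 - \<tau>) *\<^sub>R s)"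
      by (simp add: algebra_simps)
    moreover have "(- (1 - \<tau>) *\<^sub>R \<xi> + (\<tau> * (1 - \<tau>)) *\<^sub>R s) = (- (1 - \<tau>)) *\<^sub>R (\<xi> - \<tau> *\<^sub>R s)"
      by (simp add: algebra_simps)
    ultimately show "(\<lambda>\<eta>. ennreal (norm (fourier f ((\<eta> + \<xi>) /\<^sub>R \<tau>)) * norm (fourier f (\<eta> /\<^sub>R (- (1 - \<tau>))))))
      (- (1 - \<tau>) *\<^sub>R \<xi> + (\<tau> * (1 - \<tau>)) *\<^sub>R s)
      = ennreal (norm (fourier f (\<xi> + (1 - \<tau>) *\<^sub>R s)) * norm (fourier f (\<xi> - \<tau> *\<^sub>R s)))"
      using t1 by (simp only: scaleR_scaleR) simp
  qed
  finally show ?thesis .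
qed

section \<open>The Wigner transform bounded by the Rihaczek form\<close>

lemma norm_weighted_mono:
  assumes w: "weight_function \<omega> K b" and "l \<le> m"
  shows "norm (weighted \<omega> l F z) \<le> norm (weighted \<omega> m F z)"
  unfolding norm_weighted using assms(2) weight_nonneg[OF w, of "norm z"]
  by (intro mult_right_mono) (auto intro: mult_right_mono)

text \<open>x = (1-\<tau>)(x+\<tau>t) + \<tau>(x-(1-\<tau>)t), while \<xi> =
  \<tau>(\<xi>+(1-\<tau>)\<eta>) + (1-\<tau>)(\<xi>-\<tau>\<eta>). The coefficients are exchanged
  between the components, so (x,\<xi>) is not in general a convex combination of the two pairs. It
  is a sum of pairs whose components have been shrunk, and shrinking does not increase the
  norm.\<close>

lemma norm_le_norm_mixed_combination:
  fixes x \<xi> :: "'a::real_normed_vector"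
  assumes \<tau>: "0 < \<tau>" "\<tau> < 1"
  shows "norm (x, \<xi>) \<le> norm (x + \<tau> *\<^sub>R t, \<xi> + (1 - \<tau>) *\<^sub>R \<eta>) + norm (x - (1 - \<tau>) *\<^sub>R t, \<xi> - \<tau> *\<^sub>R \<eta>)"
proof -
  have shrink: "norm (r *\<^sub>R u, s *\<^sub>R v) \<le> norm (u, v)"
    if "0 \<le> r" "r \<le> 1" "0 \<le> s" "s \<le> 1" for r s :: real and u v :: 'a
  proof -
    have "(r * norm u)\<^sup>2 + (s * norm v)\<^sup>2 \<le> (norm u)\<^sup>2 + (norm v)\<^sup>2"
      using that by (intro add_mono power_mono mult_left_le_one_le) auto
    then show ?thesis using that by (simp add: norm_Pair)
  qed
  have "(x, \<xi>) = ((1 - \<tau>) *\<^sub>R (x + \<tau> *\<^sub>R t), \<tau> *\<^sub>R (\<xi> + (1 - \<tau>) *\<^sub>R \<eta>))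
      + (\<tau> *\<^sub>R (x - (1 - \<tau>) *\<^sub>R t), (1 - \<tau>) *\<^sub>R (\<xi> - \<tau> *\<^sub>R \<eta>))"
    by (simp add: algebra_simps)
  then have "norm (x, \<xi>) \<le> norm ((1 - \<tau>) *\<^sub>R (x + \<tau> *\<^sub>R t), \<tau> *\<^sub>R (\<xi> + (1 - \<tau>) *\<^sub>R \<eta>))
      + norm (\<tau> *\<^sub>R (x - (1 - \<tau>) *\<^sub>R t), (1 - \<tau>) *\<^sub>R (\<xi> - \<tau> *\<^sub>R \<eta>))"
    by (metis norm_triangle_ineq)
  also have "\<dots> \<le> norm (x + \<tau> *\<^sub>R t, \<xi> + (1 - \<tau>) *\<^sub>R \<eta>) + norm (x - (1 - \<tau>) *\<^sub>R t, \<xi> - \<tau> *\<^sub>R \<eta>)"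
    using \<tau> by (intro add_mono shrink) auto
  finally show ?thesis .
qed

text \<open>One factor |Wig| is bounded in time and the other in frequency, and the four resulting
  factors are regrouped into two values of |Rf|. The pairing matters: f(x+\<tau>t) goes with
  f^(\<xi>+(1-\<tau>)\<eta>), so each map scales by \<tau> in one variable and by 1-\<tau> in the
  other, up to sign. The opposite pairing would give the different Jacobians \<tau>^(2N) and
  (1-\<tau>)^(2N).\<close>

lemma Wig_square_le:
  fixes f :: "real^'n::finite \<Rightarrow> complex"
  assumes w: "weight_function \<omega> K b" and f: "tame \<omega> f" and \<tau>: "0 < \<tau>" "\<tau> < 1"
  shows "ennreal ((2 * pi) ^ CARD('n)) * (ennreal (norm (Wig \<tau> f (x, \<xi>))))\<^sup>2
    \<le> (\<integral>\<^sup>+w. ennreal (norm (Rihaczek f (x + \<tau> *\<^sub>R fst w, \<xi> + (1 - \<tau>) *\<^sub>R snd w))) *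
        ennreal (norm (Rihaczek f (x + (- (1 - \<tau>)) *\<^sub>R fst w, \<xi> + (- \<tau>) *\<^sub>R snd w))) \<partial>lborel)"
proof -
  note tame_measurable[OF f, measurable] tame_fourier_measurable[OF f, measurable]
  let ?\<phi> = "\<lambda>t. ennreal (norm (f (x + \<tau> *\<^sub>R t)) * norm (f (x - (1 - \<tau>) *\<^sub>R t)))"
  let ?\<psi> = "\<lambda>\<eta>. ennreal (norm (fourier f (\<xi> + (1 - \<tau>) *\<^sub>R \<eta>)) * norm (fourier f (\<xi> - \<tau> *\<^sub>R \<eta>)))"
  have "ennreal ((2 * pi) ^ CARD('n)) * (ennreal (norm (Wig \<tau> f (x, \<xi>))))\<^sup>2
      = ennreal (norm (Wig \<tau> f (x, \<xi>))) * (ennreal ((2 * pi) ^ CARD('n)) * ennreal (norm (Wig \<tau> f (x, \<xi>))))"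
    by (simp add: power2_eq_square ac_simps)
  also have "\<dots> \<le> (\<integral>\<^sup>+t. ?\<phi> t \<partial>lborel) * (\<integral>\<^sup>+\<eta>. ?\<psi> \<eta> \<partial>lborel)"
    by (intro mult_mono norm_Wig_le_time norm_Wig_le_frequency[OF w f \<tau>]) auto
  also have "\<dots> = (\<integral>\<^sup>+t. (\<integral>\<^sup>+\<eta>. ?\<phi> t * ?\<psi> \<eta> \<partial>lborel) \<partial>lborel)"
    by (subst nn_integral_cmult) (auto simp: nn_integral_multc)
  also have "\<dots> = (\<integral>\<^sup>+w. ?\<phi> (fst w) * ?\<psi> (snd w) \<partial>lborel)"
  proof -
    have "(\<lambda>w. ?\<phi> (fst w) * ?\<psi> (snd w)) \<in> borel_measurable (borel \<Otimes>\<^sub>M borel)"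
      by measurable
    then show ?thesis unfolding borel_prod by (subst nn_integral_lborel_pair) simp_all
  qed
  also have "\<dots> = (\<integral>\<^sup>+w. ennreal (norm (Rihaczek f (x + \<tau> *\<^sub>R fst w, \<xi> + (1 - \<tau>) *\<^sub>R snd w))) *
        ennreal (norm (Rihaczek f (x + (- (1 - \<tau>)) *\<^sub>R fst w, \<xi> + (- \<tau>) *\<^sub>R snd w))) \<partial>lborel)"
    unfolding scaleR_minus_left diff_conv_add_uminus[symmetric] norm_Rihaczek
    by (intro nn_integral_cong) (simp add: ac_simps flip: ennreal_mult)
  finally show ?thesis .
qed

text \<open>The squared weight has exponent 2l, and its single split between the two arguments of Rf
  turns this into 2Kl. The bound is kept pointwise because it yields the decay of the Wigner
  transform as well as (i).\<close>

lemma weighted_Wig_square_le: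
  fixes f :: "real^'n::finite \<Rightarrow> complex"
  assumes w: "weight_function \<omega> K b" and f: "tame \<omega> f" and \<tau>: "0 < \<tau>" "\<tau> < 1"
    and l: "0 \<le> l" and p: "1 \<le> p"
  shows "(ennreal (norm (weighted \<omega> l (Wig \<tau> f) z)))\<^sup>2
    \<le> ennreal (exp (2 * K * l) / ((2 * pi) ^ CARD('n) * (\<tau> - \<tau>\<^sup>2) ^ CARD('n))) *
      Lp_norm p (weighted \<omega> (2 * K * l) (Rihaczek f)) *
      Lp_norm (conj_exponent p) (weighted \<omega> (2 * K * l) (Rihaczek f))"
proof -
  obtain x \<xi> where z: "z = (x, \<xi>)" by (cases z)
  let ?R = "weighted \<omega> (2 * K * l) (Rihaczek f)"
  let ?A = "\<lambda>w. (x + \<tau> *\<^sub>R fst w, \<xi> + (1 - \<tau>) *\<^sub>R snd w)"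
  let ?B = "\<lambda>w. (x + (- (1 - \<tau>)) *\<^sub>R fst w, \<xi> + (- \<tau>) *\<^sub>R snd w)"
  let ?c = "1 / (\<tau> - \<tau>\<^sup>2) ^ CARD('n)"
  have tt: "\<tau> - \<tau>\<^sup>2 = \<tau> * (1 - \<tau>)" by (simp add: power2_eq_square algebra_simps)
  have c: "?c > 0" unfolding tt using \<tau> by simp
  have [measurable]: "Rihaczek f \<in> borel_measurable borel" and R [measurable]: "?R \<in> borel_measurable borel"
    using Rihaczek_measurable[OF f] weighted_measurable[OF w] by auto
  have AB: "?A \<in> borel_measurable (borel \<Otimes>\<^sub>M borel)" "?B \<in> borel_measurable (borel \<Otimes>\<^sub>M borel)"
    by measurable
  then have A [measurable]: "?A \<in> borel_measurable borel" and B [measurable]: "?B \<in> borel_measurable borel"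
    by (simp_all only: borel_prod)
  have "ennreal ((2 * pi) ^ CARD('n)) * (ennreal (norm (weighted \<omega> l (Wig \<tau> f) z)))\<^sup>2
      = ennreal (exp (2 * l * \<omega> (norm z))) *
        (ennreal ((2 * pi) ^ CARD('n)) * (ennreal (norm (Wig \<tau> f (x, \<xi>))))\<^sup>2)"
    by (simp add: z norm_weighted ennreal_mult power_mult_distrib ac_simps ennreal_power exp_double[symmetric] flip: exp_of_nat_mult)
  also have "\<dots> \<le> ennreal (exp (2 * l * \<omega> (norm z))) *
      (\<integral>\<^sup>+w. ennreal (norm (Rihaczek f (?A w))) * ennreal (norm (Rihaczek f (?B w))) \<partial>lborel)"
    by (intro mult_left_mono Wig_square_le[OF w f \<tau>]) auto
  also have "\<dots> = (\<integral>\<^sup>+w. ennreal (exp (2 * l * \<omega> (norm z))) *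
      (ennreal (norm (Rihaczek f (?A w))) * ennreal (norm (Rihaczek f (?B w)))) \<partial>lborel)"
    by (rule nn_integral_cmult[symmetric]) measurable
  also have "\<dots> \<le> (\<integral>\<^sup>+w. ennreal (exp (2 * K * l)) *
      (ennreal (norm (?R (?A w))) * ennreal (norm (?R (?B w)))) \<partial>lborel)"
  proof (intro nn_integral_mono)
    fix w :: "(real^'n) \<times> (real^'n)"
    have "norm z \<le> norm (?A w) + norm (?B w)"
      using norm_le_norm_mixed_combination[OF \<tau>, of x \<xi> "fst w" "snd w"] by (simp only: z scaleR_minus_left diff_conv_add_uminus)
    then have "exp (2 * l * \<omega> (norm z)) \<le> exp (K * (2 * l)) *
        (exp (K * (2 * l) * \<omega> (norm (?A w))) * exp (K * (2 * l) * \<omega> (norm (?B w))))"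
      using l by (intro exp_weight_triangle[OF w]) auto
    then have "exp (2 * l * \<omega> (norm z)) * (norm (Rihaczek f (?A w)) * norm (Rihaczek f (?B w)))
        \<le> exp (K * (2 * l)) *
        (exp (K * (2 * l) * \<omega> (norm (?A w))) * exp (K * (2 * l) * \<omega> (norm (?B w)))) *
          (norm (Rihaczek f (?A w)) * norm (Rihaczek f (?B w)))"
      by (rule mult_right_mono) simp
    also have "\<dots> = exp (2 * K * l) * (norm (?R (?A w)) * norm (?R (?B w)))"
      unfolding norm_weighted by (simp only: ac_simps)
    finally show "ennreal (exp (2 * l * \<omega> (norm z))) *
      (ennreal (norm (Rihaczek f (?A w))) * ennreal (norm (Rihaczek f (?B w))))
      \<le> ennreal (exp (2 * K * l)) * (ennreal (norm (?R (?A w))) * ennreal (norm (?R (?B w))))"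
      by (simp only: ennreal_mult[symmetric] norm_ge_zero mult_nonneg_nonneg exp_ge_zero ennreal_leI)
  qed
  also have "\<dots> = ennreal (exp (2 * K * l)) *
      (\<integral>\<^sup>+w. ennreal (norm (?R (?A w))) * ennreal (norm (?R (?B w))) \<partial>lborel)"
    by (rule nn_integral_cmult) measurable
  also have "\<dots> \<le> ennreal (exp (2 * K * l)) *
      (ennreal ?c * Lp_norm p ?R * Lp_norm (conj_exponent p) ?R)"
  proof (rule mult_left_mono, rule Holder_pullback[OF p c R R A B])
    fix \<Phi> :: "(real^'n) \<times> (real^'n) \<Rightarrow> ennreal" assume \<Phi>: "\<Phi> \<in> borel_measurable borel"
    show "(\<integral>\<^sup>+w. \<Phi> (?A w) \<partial>lborel) \<le> ennreal ?c * (\<integral>\<^sup>+z. \<Phi> z \<partial>lborel)"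
      using \<tau> by (subst nn_integral_lborel_pair_affine[OF \<Phi>]) (auto simp: tt)
    show "(\<integral>\<^sup>+w. \<Phi> (?B w) \<partial>lborel) \<le> ennreal ?c * (\<integral>\<^sup>+z. \<Phi> z \<partial>lborel)"
      using \<tau> by (subst nn_integral_lborel_pair_affine[OF \<Phi>]) (auto simp: tt abs_mult mult.commute)
  qed simp
  finally have "ennreal (1 / (2 * pi) ^ CARD('n)) * (ennreal ((2 * pi) ^ CARD('n)) *
      (ennreal (norm (weighted \<omega> l (Wig \<tau> f) z)))\<^sup>2)
      \<le> ennreal (1 / (2 * pi) ^ CARD('n)) * (ennreal (exp (2 * K * l)) *
      (ennreal ?c * Lp_norm p ?R * Lp_norm (conj_exponent p) ?R))"
    by (rule mult_left_mono) simp
  then show ?thesis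
    using c by (simp add: mult.assoc[symmetric] ennreal_mult[symmetric])
qed

text \<open>The preceding bound with p = 1, whose right-hand side is finite by the decay of Rf. It
  supplies the integrable slices and the finite norms on which (ii) relies.\<close>

lemma rapidly_decreasing_Wig:
  fixes f :: "real^'n::finite \<Rightarrow> complex"
  assumes w: "weight_function \<omega> K b" and f: "tame \<omega> f" and \<tau>: "0 < \<tau>" "\<tau> < 1"
  shows "rapidly_decreasing \<omega> (Wig \<tau> f)"
  unfolding rapidly_decreasing_def
proof (intro conjI allI impI)
  show "Wig \<tau> f \<in> borel_measurable borel" by (rule Wig_measurable[OF tame_measurable[OF f]])
  fix l :: real assume l: "0 \<le> l"
  let ?R = "weighted \<omega> (2 * K * l) (Rihaczek f)"
  let ?C = "ennreal (exp (2 * K * l) / ((2 * pi) ^ CARD('n) * (\<tau> - \<tau>\<^sup>2) ^ CARD('n))) *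
      Lp_norm 1 ?R * Lp_norm (conj_exponent 1) ?R"
  have R: "rapidly_decreasing \<omega> ?R"
    using l weight_K[OF w] by (intro rapidly_decreasing_weighted[OF w] rapidly_decreasing_Rihaczek[OF w f]) auto
  have "Lp_norm 1 ?R < \<infinity>" "Lp_norm (conj_exponent 1) ?R < \<infinity>"
    by (rule rapidly_decreasing_Lp_finite[OF w R]; simp add: conj_exponent_def)+
  then have "?C < \<infinity>" by (simp add: ennreal_mult_less_top)
  then obtain C where C: "?C = ennreal C" "C \<ge> 0" by (cases ?C) auto
  have "norm (weighted \<omega> l (Wig \<tau> f) z) \<le> sqrt C" for z
    using weighted_Wig_square_le[OF w f \<tau> l, of 1 z] C by (simp add: ennreal_power real_le_rsqrt)
  then show "\<exists>C. \<forall>z. exp (l * \<omega> (norm z)) * norm (Wig \<tau> f z) \<le> C"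
    unfolding norm_weighted by blast
qed

text \<open>The pointwise bound has the exponents 2Kl, both in the constant and in the weight. Since
  K \<ge> 1, they are at most K(1+2K)l and 4K^2 l.\<close>

theorem Lp_infinity_weighted_Wig_le:
  fixes f :: "real^'n::finite \<Rightarrow> complex"
  assumes w: "weight_function \<omega> K b" and f: "tame \<omega> f" and \<tau>: "0 < \<tau>" "\<tau> < 1"
    and l: "0 \<le> l" and p: "1 \<le> p"
  shows "(Lp_norm \<infinity> (weighted \<omega> l (Wig \<tau> f)))\<^sup>2
    \<le> ennreal (D3 CARD('n) K \<tau> l) * Lp_norm p (weighted \<omega> (4 * K\<^sup>2 * l) (Rihaczek f)) *
      Lp_norm (conj_exponent p) (weighted \<omega> (4 * K\<^sup>2 * l) (Rihaczek f))"
proof (rule Lp_infinity_power2_le)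
  show "weighted \<omega> l (Wig \<tau> f) \<in> borel_measurable borel"
    by (intro weighted_measurable[OF w] Wig_measurable tame_measurable[OF f])
  fix z :: "(real^'n) \<times> (real^'n)"
  have K: "1 \<le> K" by (rule weight_K[OF w])
  have "2 * K * 1 \<le> 2 * K * (2 * K)" using K by (intro mult_left_mono) auto
  then have "2 * K * l \<le> 4 * K\<^sup>2 * l" using l by (intro mult_right_mono) (auto simp: power2_eq_square)
  then have le: "Lp_norm q (weighted \<omega> (2 * K * l) (Rihaczek f)) \<le> Lp_norm q (weighted \<omega> (4 * K\<^sup>2 * l) (Rihaczek f))"
    if "1 \<le> q" for q
    using that by (intro Lp_norm_mono_AE AE_I2 norm_weighted_mono[OF w] weighted_measurable[OF w] Rihaczek_measurable[OF f])
  have "K * 2 * l \<le> K * (1 + 2 * K) * l"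
    using K l by (intro mult_right_mono mult_left_mono) auto
  moreover have "\<tau> - \<tau>\<^sup>2 > 0" using \<tau> by (simp add: power2_eq_square)
  ultimately have D: "exp (2 * K * l) / ((2 * pi) ^ CARD('n) * (\<tau> - \<tau>\<^sup>2) ^ CARD('n)) \<le> D3 CARD('n) K \<tau> l"
    unfolding D3_def by (intro divide_right_mono) (auto simp: ac_simps)
  have "1 \<le> conj_exponent p"
    using p by (cases rule: conj_exponent_cases) (auto simp flip: ennreal_1)
  then show "(ennreal (norm (weighted \<omega> l (Wig \<tau> f) z)))\<^sup>2
    \<le> ennreal (D3 CARD('n) K \<tau> l) * Lp_norm p (weighted \<omega> (4 * K\<^sup>2 * l) (Rihaczek f)) *
      Lp_norm (conj_exponent p) (weighted \<omega> (4 * K\<^sup>2 * l) (Rihaczek f))"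
    by (intro order_trans[OF weighted_Wig_square_le[OF w f \<tau> l p]] mult_mono le p ennreal_leI[OF D]) auto
qed

section \<open>The short-time Fourier transform\<close>

definition stft :: "(real^'n::finite \<Rightarrow> complex) \<Rightarrow> (real^'n \<Rightarrow> complex) \<Rightarrow> (real^'n) \<times> (real^'n) \<Rightarrow> complex" where
  "stft g f = (\<lambda>(y, \<eta>). fourier (\<lambda>t. f t * cnj (g (t - y))) \<eta>)"

lemma stft_measurable:
  assumes [measurable]: "f \<in> borel_measurable borel" "g \<in> borel_measurable borel"
  shows "stft g f \<in> borel_measurable borel"
  unfolding stft_def fourier_def split_beta' borel_prod[symmetric] by measurable

lemma tame_bounded:
  assumes "tame \<omega> f"
  obtains B where "\<And>x. norm (f x) \<le> B"
  using rapidly_decreasing_bounded[OF tame_rapid[OF assms]] by blast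

lemma integrable_mult_bounded:
  fixes f h :: "'a::euclidean_space \<Rightarrow> complex"
  assumes f: "integrable lborel f" and h [measurable]: "h \<in> borel_measurable borel"
    and B: "\<And>x. norm (h x) \<le> B"
  shows "integrable lborel (\<lambda>x. f x * h x)"
proof (rule Bochner_Integration.integrable_bound)
  show "integrable lborel (\<lambda>x. of_real B * f x)" using f by simp
  have "0 \<le> B" using B[of undefined] by (rule order_trans[rotated]) simp
  moreover have "norm (f x) * norm (h x) \<le> norm (f x) * B" for x
    by (intro mult_left_mono B) simp
  ultimately show "AE x in lborel. norm (f x * h x) \<le> norm (of_real B * f x)"
    by (simp add: norm_mult mult.commute)
  show "(\<lambda>x. f x * h x) \<in> borel_measurable lborel"
    using f by measurable
qed

lemma tame_plancherel:
  fixes g :: "real^'n::finite \<Rightarrow> complex"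
  assumes w: "weight_function \<omega> K b" and g: "tame \<omega> g"
  shows "(\<integral>\<^sup>+\<eta>. ennreal ((norm (fourier g \<eta>))\<^sup>2) \<partial>lborel)
    = ennreal ((2 * pi) ^ CARD('n)) * (\<integral>\<^sup>+x. ennreal ((norm (g x))\<^sup>2) \<partial>lborel)"
proof -
  obtain B where B: "\<And>x. norm (g x) \<le> B" using tame_bounded[OF g] by blast
  obtain B' where B': "\<And>x. norm (fourier g x) \<le> B'"
    using rapidly_decreasing_bounded[OF tame_fourier_rapid[OF g]] by blast
  have gi: "integrable lborel g" and ghi: "integrable lborel (fourier g)"
    using rapidly_decreasing_integrable[OF w] tame_rapid[OF g] tame_fourier_rapid[OF g] by auto
  note [measurable] = tame_measurable[OF g] tame_fourier_measurable[OF g]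
  have square: "integrable lborel (\<lambda>x. (norm (h x))\<^sup>2)"
    "(\<integral>x. h x * cnj (h x) \<partial>lborel) = of_real (\<integral>x. (norm (h x))\<^sup>2 \<partial>lborel)"
    if h: "integrable lborel h" "h \<in> borel_measurable borel" and B: "\<And>x. norm (h x) \<le> B"
    for h :: "real^'n \<Rightarrow> complex" and B
  proof -
    have i: "integrable lborel (\<lambda>x. h x * cnj (h x))"
      using h B by (intro integrable_mult_bounded[of h _ B]) auto
    then show "integrable lborel (\<lambda>x. (norm (h x))\<^sup>2)"
      using integrable_norm[OF i] by (simp add: norm_mult power2_eq_square)
    show "(\<integral>x. h x * cnj (h x) \<partial>lborel) = of_real (\<integral>x. (norm (h x))\<^sup>2 \<partial>lborel)"
      unfolding integral_complex_of_real[symmetric] by (simp add: complex_norm_square del: of_real_power integral_complex_of_real)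
  qed
  have "complex_of_real ((2 * pi) ^ CARD('n) * (\<integral>x. (norm (g x))\<^sup>2 \<partial>lborel))
      = of_real (\<integral>x. (norm (fourier g x))\<^sup>2 \<partial>lborel)"
    using parseval[OF gi gi tame_continuous[OF g] B ghi] square(2)[OF gi _ B] square(2)[OF ghi _ B']
    by simp
  then have "(2 * pi) ^ CARD('n) * (\<integral>x. (norm (g x))\<^sup>2 \<partial>lborel) = (\<integral>x. (norm (fourier g x))\<^sup>2 \<partial>lborel)"
    by (simp only: of_real_eq_iff)
  then show ?thesis
    using square(1)[OF gi _ B] square(1)[OF ghi _ B']
    by (simp add: nn_integral_eq_integral flip: ennreal_mult)
qed

text \<open>Inversion at t = x bounds (2 pi)^N |f(x)| |g(x-y)| by the integral of |V(y,\<eta>)| over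
  \<eta>. Multiplying by |g(x-y)| once more and integrating over y avoids a division by values of g
  that may vanish, and produces the squared L^2 norm of the window.\<close>

lemma stft_time_bound:
  fixes f g :: "real^'n::finite \<Rightarrow> complex"
  assumes w: "weight_function \<omega> K b" and f: "tame \<omega> f" and g: "tame \<omega> g"
  shows "ennreal ((2 * pi) ^ CARD('n)) * (ennreal (norm (f x)) * (\<integral>\<^sup>+t. ennreal ((norm (g t))\<^sup>2) \<partial>lborel))
    \<le> (\<integral>\<^sup>+z. ennreal (norm (stft g f z)) * ennreal (norm (g (x - fst z))) \<partial>lborel)"
proof -
  note [measurable] = tame_measurable[OF f] tame_measurable[OF g]
  note [measurable] = stft_measurable[OF tame_measurable[OF f] tame_measurable[OF g]]
    stft_measurable[OF tame_measurable[OF f] tame_measurable[OF g], unfolded borel_prod[symmetric]]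
  have fi: "integrable lborel f" by (rule rapidly_decreasing_integrable[OF w tame_rapid[OF f]])
  obtain B where B: "\<And>x. norm (f x) \<le> B" using tame_bounded[OF f] by blast
  obtain B' where B': "\<And>x. norm (g x) \<le> B'" using tame_bounded[OF g] by blast
  have B0: "0 \<le> B" using B[of undefined] by (rule order_trans[rotated]) simp
  have slice: "ennreal ((2 * pi) ^ CARD('n)) * ennreal (norm (f x * cnj (g (x - y))))
      \<le> (\<integral>\<^sup>+\<eta>. ennreal (norm (stft g f (y, \<eta>))) \<partial>lborel)" for y
    unfolding stft_def prod.case
  proof (rule fourier_inversion_bound)
    show "integrable lborel (\<lambda>t. f t * cnj (g (t - y)))"
      using B' by (intro integrable_mult_bounded[OF fi]) auto
    show "continuous_on UNIV (\<lambda>t. f t * cnj (g (t - y)))"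
      by (intro continuous_intros tame_continuous[OF f] continuous_on_compose2[OF tame_continuous[OF g]]) auto
    show "norm (f t * cnj (g (t - y))) \<le> B * B'" for t
      using B B' B0 by (auto simp: norm_mult intro!: mult_mono)
  qed
  have "(\<integral>\<^sup>+t. ennreal ((norm (g t))\<^sup>2) \<partial>lborel) = (\<integral>\<^sup>+y. ennreal ((norm (g (x - y)))\<^sup>2) \<partial>lborel)"
    by (rule nn_integral_lborel_reflect[symmetric]) measurable
  then have "ennreal ((2 * pi) ^ CARD('n)) * (ennreal (norm (f x)) * (\<integral>\<^sup>+t. ennreal ((norm (g t))\<^sup>2) \<partial>lborel))
      = (\<integral>\<^sup>+y. ennreal ((2 * pi) ^ CARD('n)) * (ennreal (norm (f x)) * ennreal ((norm (g (x - y)))\<^sup>2)) \<partial>lborel)"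
    by (simp add: nn_integral_cmult)
  also have "\<dots> = (\<integral>\<^sup>+y. ennreal ((2 * pi) ^ CARD('n)) * ennreal (norm (f x * cnj (g (x - y)))) *
      ennreal (norm (g (x - y))) \<partial>lborel)"
    by (intro nn_integral_cong) (simp add: norm_mult power2_eq_square ennreal_mult ac_simps)
  also have "\<dots> \<le> (\<integral>\<^sup>+y. (\<integral>\<^sup>+\<eta>. ennreal (norm (stft g f (y, \<eta>))) \<partial>lborel) * ennreal (norm (g (x - y))) \<partial>lborel)"
    by (intro nn_integral_mono mult_right_mono slice) auto
  also have "\<dots> = (\<integral>\<^sup>+y. (\<integral>\<^sup>+\<eta>. ennreal (norm (stft g f (y, \<eta>))) * ennreal (norm (g (x - y))) \<partial>lborel) \<partial>lborel)"
    by (intro nn_integral_cong nn_integral_multc[symmetric]) measurable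
  also have "\<dots> = (\<integral>\<^sup>+z. ennreal (norm (stft g f z)) * ennreal (norm (g (x - fst z))) \<partial>lborel)"
  proof -
    have "(\<lambda>z. ennreal (norm (stft g f z)) * ennreal (norm (g (x - fst z)))) \<in> borel_measurable (borel \<Otimes>\<^sub>M borel)"
      by measurable
    then show ?thesis unfolding borel_prod by (subst nn_integral_lborel_pair) simp_all
  qed
  finally show ?thesis .
qed

text \<open>The fundamental identity of time-frequency analysis up to a phase: the left-hand side is
  the modulus at (\<eta>, y) of the short-time Fourier transform of f^ with window g^. It is
  Parseval's formula for f and the translated and modulated window \<open>?h\<close>.\<close>

lemma norm_fourier_product:
  fixes f g :: "real^'n::finite \<Rightarrow> complex"
  assumes w: "weight_function \<omega> K b" and f: "tame \<omega> f" and g: "tame \<omega> g"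
  shows "norm (fourier (\<lambda>\<xi>. fourier f \<xi> * cnj (fourier g (\<xi> - \<eta>))) y)
    = (2 * pi) ^ CARD('n) * norm (stft g f (- y, \<eta>))"
proof -
  note [measurable] = tame_measurable[OF f] tame_measurable[OF g]
  have fi: "integrable lborel f" and gi: "integrable lborel g" and ghi: "integrable lborel (fourier g)"
    using rapidly_decreasing_integrable[OF w] tame_rapid[OF f] tame_rapid[OF g] tame_fourier_rapid[OF g]
    by auto
  obtain B where B: "\<And>x. norm (g x) \<le> B" using tame_bounded[OF g] by blast
  let ?h = "\<lambda>t. cis (t \<bullet> \<eta>) * g (y + 1 *\<^sub>R t)"
  have fh: "fourier ?h \<xi> = cis (y \<bullet> (\<xi> - \<eta>)) * fourier g (\<xi> - \<eta>)" for \<xi>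
    by (subst fourier_modulate, subst fourier_affine) auto
  have h: "integrable lborel ?h"
    by (rule Bochner_Integration.integrable_bound[OF integrable_lborel_affine[OF gi, of 1 y]])
       (auto simp: norm_mult)
  have "integrable lborel (\<lambda>\<xi>. fourier g (- \<eta> + 1 *\<^sub>R \<xi>))"
    by (rule integrable_lborel_affine[OF ghi]) simp
  then have hh: "integrable lborel (fourier ?h)"
  proof (rule Bochner_Integration.integrable_bound)
    show "fourier ?h \<in> borel_measurable lborel" using fourier_measurable[of ?h] by simp
    show "AE \<xi> in lborel. norm (fourier ?h \<xi>) \<le> norm (fourier g (- \<eta> + 1 *\<^sub>R \<xi>))"
      unfolding fh by (simp add: norm_mult)
  qed
  have c: "continuous_on UNIV ?h"
    by (intro continuous_intros continuous_on_compose2[OF tame_continuous[OF g]]) auto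
  have "of_real ((2 * pi) ^ CARD('n)) * stft g f (- y, \<eta>)
      = of_real ((2 * pi) ^ CARD('n)) * (\<integral>t. f t * cnj (?h t) \<partial>lborel)"
    by (simp add: stft_def fourier_def cis_cnj ac_simps)
  also have "\<dots> = (\<integral>\<xi>. fourier f \<xi> * cnj (fourier ?h \<xi>) \<partial>lborel)"
    by (rule parseval[OF fi h c _ hh, of B]) (simp add: norm_mult B)
  also have "\<dots> = (\<integral>\<xi>. cis (y \<bullet> \<eta>) * (cis (- (\<xi> \<bullet> y)) * (fourier f \<xi> * cnj (fourier g (\<xi> - \<eta>)))) \<partial>lborel)"
    unfolding fh
    by (intro Bochner_Integration.integral_cong)
       (auto simp: cis_cnj inner_diff_right inner_commute cis_mult cis_divide[symmetric] field_simps)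
  also have "\<dots> = cis (y \<bullet> \<eta>) * fourier (\<lambda>\<xi>. fourier f \<xi> * cnj (fourier g (\<xi> - \<eta>))) y"
    unfolding fourier_def[of "\<lambda>\<xi>. fourier f \<xi> * cnj (fourier g (\<xi> - \<eta>))"]
    by (rule integral_mult_right_zero)
  finally have "norm (of_real ((2 * pi) ^ CARD('n)) * stft g f (- y, \<eta>))
      = norm (cis (y \<bullet> \<eta>) * fourier (\<lambda>\<xi>. fourier f \<xi> * cnj (fourier g (\<xi> - \<eta>))) y)"
    by (rule arg_cong)
  then show ?thesis by (simp add: norm_mult norm_power)
qed

text \<open>The time bound applied to f^ and g^. Here the (2 pi)^N of the inversion cancels against
  the one in \<open>norm_fourier_product\<close>; the factor in the statement comes from
  Plancherel's formula for the window.\<close>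

lemma stft_frequency_bound:
  fixes f g :: "real^'n::finite \<Rightarrow> complex"
  assumes w: "weight_function \<omega> K b" and f: "tame \<omega> f" and g: "tame \<omega> g"
  shows "ennreal ((2 * pi) ^ CARD('n)) * (ennreal (norm (fourier f \<xi>)) * (\<integral>\<^sup>+t. ennreal ((norm (g t))\<^sup>2) \<partial>lborel))
    \<le> (\<integral>\<^sup>+z. ennreal (norm (stft g f z)) * ennreal (norm (fourier g (\<xi> - snd z))) \<partial>lborel)"
proof -
  note [measurable] = tame_measurable[OF f] tame_measurable[OF g]
    tame_fourier_measurable[OF f] tame_fourier_measurable[OF g]
  note [measurable] = stft_measurable[OF tame_measurable[OF f] tame_measurable[OF g]]
    stft_measurable[OF tame_measurable[OF f] tame_measurable[OF g], unfolded borel_prod[symmetric]]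
  have fi: "integrable lborel (fourier f)" by (rule rapidly_decreasing_integrable[OF w tame_fourier_rapid[OF f]])
  obtain B where B: "\<And>x. norm (fourier f x) \<le> B"
    using rapidly_decreasing_bounded[OF tame_fourier_rapid[OF f]] by blast
  obtain B' where B': "\<And>x. norm (fourier g x) \<le> B'"
    using rapidly_decreasing_bounded[OF tame_fourier_rapid[OF g]] by blast
  have B0: "0 \<le> B" using B[of undefined] by (rule order_trans[rotated]) simp
  let ?c = "(2 * pi) ^ CARD('n)"
  have slice: "ennreal (norm (fourier f \<xi> * cnj (fourier g (\<xi> - \<eta>))))
      \<le> (\<integral>\<^sup>+y. ennreal (norm (stft g f (y, \<eta>))) \<partial>lborel)" for \<eta>
  proof -
    let ?k = "\<lambda>\<xi>. fourier f \<xi> * cnj (fourier g (\<xi> - \<eta>))"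
    have "ennreal ?c * ennreal (norm (?k \<xi>)) \<le> (\<integral>\<^sup>+y. ennreal (norm (fourier ?k y)) \<partial>lborel)"
    proof (rule fourier_inversion_bound)
      show "integrable lborel ?k"
        using B' by (intro integrable_mult_bounded[OF fi]) auto
      show "continuous_on UNIV ?k"
        by (intro continuous_intros tame_fourier_continuous[OF f]
            continuous_on_compose2[OF tame_fourier_continuous[OF g]]) auto
      show "norm (?k t) \<le> B * B'" for t
        using B B' B0 by (auto simp: norm_mult intro!: mult_mono)
    qed
    also have "\<dots> = (\<integral>\<^sup>+y. ennreal ?c * ennreal (norm (stft g f (0 - y, \<eta>))) \<partial>lborel)"
      by (intro nn_integral_cong) (simp add: norm_fourier_product[OF w f g] ennreal_mult)
    also have "\<dots> = ennreal ?c * (\<integral>\<^sup>+y. ennreal (norm (stft g f (0 - y, \<eta>))) \<partial>lborel)"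
      by (rule nn_integral_cmult) measurable
    also have "(\<integral>\<^sup>+y. ennreal (norm (stft g f (0 - y, \<eta>))) \<partial>lborel)
        = (\<integral>\<^sup>+y. ennreal (norm (stft g f (y, \<eta>))) \<partial>lborel)"
      by (rule nn_integral_lborel_reflect) measurable
    finally show ?thesis
      by (simp add: ennreal_mult_le_mult_iff)
  qed
  have "(\<integral>\<^sup>+\<eta>. ennreal ((norm (fourier g \<eta>))\<^sup>2) \<partial>lborel)
      = (\<integral>\<^sup>+\<eta>. ennreal ((norm (fourier g (\<xi> - \<eta>)))\<^sup>2) \<partial>lborel)"
    by (rule nn_integral_lborel_reflect[symmetric]) measurable
  then have "ennreal ?c * (ennreal (norm (fourier f \<xi>)) * (\<integral>\<^sup>+t. ennreal ((norm (g t))\<^sup>2) \<partial>lborel))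
      = (\<integral>\<^sup>+\<eta>. ennreal (norm (fourier f \<xi>)) * ennreal ((norm (fourier g (\<xi> - \<eta>)))\<^sup>2) \<partial>lborel)"
    using tame_plancherel[OF w g] by (simp add: nn_integral_cmult mult.left_commute)
  also have "\<dots> = (\<integral>\<^sup>+\<eta>. ennreal (norm (fourier f \<xi> * cnj (fourier g (\<xi> - \<eta>)))) *
      ennreal (norm (fourier g (\<xi> - \<eta>))) \<partial>lborel)"
    by (intro nn_integral_cong) (simp add: norm_mult power2_eq_square ennreal_mult ac_simps)
  also have "\<dots> \<le> (\<integral>\<^sup>+\<eta>. (\<integral>\<^sup>+y. ennreal (norm (stft g f (y, \<eta>))) \<partial>lborel) *
      ennreal (norm (fourier g (\<xi> - \<eta>))) \<partial>lborel)"
    by (intro nn_integral_mono mult_right_mono slice) auto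
  also have "\<dots> = (\<integral>\<^sup>+\<eta>. (\<integral>\<^sup>+y. ennreal (norm (stft g f (y, \<eta>))) *
      ennreal (norm (fourier g (\<xi> - \<eta>))) \<partial>lborel) \<partial>lborel)"
    by (intro nn_integral_cong nn_integral_multc[symmetric]) measurable
  also have "\<dots> = (\<integral>\<^sup>+y. (\<integral>\<^sup>+\<eta>. ennreal (norm (stft g f (y, \<eta>))) *
      ennreal (norm (fourier g (\<xi> - \<eta>))) \<partial>lborel) \<partial>lborel)"
    by (rule lborel_pair.Fubini') measurable
  also have "\<dots> = (\<integral>\<^sup>+z. ennreal (norm (stft g f z)) * ennreal (norm (fourier g (\<xi> - snd z))) \<partial>lborel)"
  proof -
    have "(\<lambda>z. ennreal (norm (stft g f z)) * ennreal (norm (fourier g (\<xi> - snd z)))) \<in> borel_measurable (borel \<Otimes>\<^sub>M borel)"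
      by measurable
    then show ?thesis unfolding borel_prod by (subst nn_integral_lborel_pair) simp_all
  qed
  finally show ?thesis .
qed

text \<open>The map \<open>\<pi>\<close> will be \<open>fst\<close> or \<open>snd\<close>, which
  treats the time and frequency bounds together. The weight at \<open>v\<close> is split between
  \<open>\<pi> z\<close> and \<open>v - \<pi> z\<close>; as \<omega> is monotone, the first part is
  absorbed by the weight at \<open>z\<close>.\<close>

lemma weighted_convolution_bound:
  fixes G :: "'a::euclidean_space \<Rightarrow> complex" and V :: "'b::euclidean_space \<Rightarrow> complex"
  assumes w: "weight_function \<omega> K b" and G: "continuous_on UNIV G"
    and V [measurable]: "V \<in> borel_measurable borel"
    and [measurable]: "\<pi> \<in> borel_measurable borel" and \<pi>: "\<And>z. norm (\<pi> z) \<le> norm z" and m: "0 \<le> m"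
  shows "ennreal (exp (m * \<omega> (norm v))) * (\<integral>\<^sup>+z. ennreal (norm (V z)) * ennreal (norm (G (v - \<pi> z))) \<partial>lborel)
    \<le> ennreal (exp (K * m)) * Lp_norm \<infinity> (weighted \<omega> (K * m) G) * Lp_norm 1 (weighted \<omega> (K * m) V)"
proof -
  let ?N = "Lp_norm \<infinity> (weighted \<omega> (K * m) G)"
  have [measurable]: "weighted \<omega> (K * m) V \<in> borel_measurable borel"
    by (rule weighted_measurable[OF w V])
  have [measurable]: "G \<in> borel_measurable borel"
    using G by (rule borel_measurable_continuous_onI)
  have Km: "0 \<le> K * m" using weight_K[OF w] m by simp
  have pt: "ennreal (exp (m * \<omega> (norm v))) * (ennreal (norm (V z)) * ennreal (norm (G (v - \<pi> z))))
      \<le> ennreal (exp (K * m)) * ?N * ennreal (norm (weighted \<omega> (K * m) V z))" for z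
  proof -
    have tri: "norm v \<le> norm (\<pi> z) + norm (v - \<pi> z)"
      using norm_triangle_ineq[of "\<pi> z" "v - \<pi> z"] by simp
    have "exp (m * \<omega> (norm v)) * (norm (V z) * norm (G (v - \<pi> z)))
        \<le> exp (K * m) * (exp (K * m * \<omega> (norm (\<pi> z))) * exp (K * m * \<omega> (norm (v - \<pi> z)))) *
          (norm (V z) * norm (G (v - \<pi> z)))"
      by (intro mult_right_mono exp_weight_triangle[OF w _ tri] m) auto
    also have "\<dots> \<le> exp (K * m) * (exp (K * m * \<omega> (norm z)) * exp (K * m * \<omega> (norm (v - \<pi> z)))) *
          (norm (V z) * norm (G (v - \<pi> z)))"
      using Km by (intro mult_right_mono mult_left_mono) (auto intro!: mult_left_mono weight_mono[OF w] \<pi>)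
    also have "\<dots> = exp (K * m) * (norm (weighted \<omega> (K * m) G (v - \<pi> z)) * norm (weighted \<omega> (K * m) V z))"
      unfolding norm_weighted by (simp only: ac_simps)
    finally have "ennreal (exp (m * \<omega> (norm v))) * (ennreal (norm (V z)) * ennreal (norm (G (v - \<pi> z))))
        \<le> ennreal (exp (K * m)) * (ennreal (norm (weighted \<omega> (K * m) G (v - \<pi> z))) *
          ennreal (norm (weighted \<omega> (K * m) V z)))"
      by (simp only: ennreal_mult[symmetric] norm_ge_zero mult_nonneg_nonneg exp_ge_zero ennreal_leI)
    also have "\<dots> \<le> ennreal (exp (K * m)) * (?N * ennreal (norm (weighted \<omega> (K * m) V z)))"
      by (intro mult_left_mono mult_right_mono continuous_le_Lp_infinity weighted_continuous[OF w G]) auto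
    finally show ?thesis by (simp only: mult.assoc)
  qed
  have "ennreal (exp (m * \<omega> (norm v))) * (\<integral>\<^sup>+z. ennreal (norm (V z)) * ennreal (norm (G (v - \<pi> z))) \<partial>lborel)
      \<le> (\<integral>\<^sup>+z. ennreal (exp (K * m)) * ?N * ennreal (norm (weighted \<omega> (K * m) V z)) \<partial>lborel)"
    by (subst nn_integral_cmult[symmetric], measurable) (intro nn_integral_mono pt)
  also have "\<dots> = ennreal (exp (K * m)) * ?N * Lp_norm 1 (weighted \<omega> (K * m) V)"
    unfolding Lp_norm_1 by (rule nn_integral_cmult) measurable
  finally show ?thesis .
qed

section \<open>The Rihaczek form bounded by the Wigner transform\<close>

text \<open>For fixed t the shift of u by -\<tau>t turns the integrand into P(u) cnj(P(u-t)), whose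
  double integral factors. The value is independent of \<tau>, which is why |V|^2 can be expressed
  through the Wigner transform for any chosen \<tau>.\<close>

lemma integral_autocorrelation:
  fixes P :: "real^'n::finite \<Rightarrow> complex"
  assumes P: "integrable lborel P"
  shows "(\<integral>t. P t \<partial>lborel) * cnj (\<integral>t. P t \<partial>lborel)
    = (\<integral>u. (\<integral>t. P (u + \<tau> *\<^sub>R t) * cnj (P (u - (1 - \<tau>) *\<^sub>R t)) \<partial>lborel) \<partial>lborel)"
proof -
  have [measurable]: "P \<in> borel_measurable borel" using P by auto
  let ?Q = "\<lambda>t u. P (u + \<tau> *\<^sub>R t) * cnj (P (u - (1 - \<tau>) *\<^sub>R t))"
  let ?R = "\<lambda>t u. P u * cnj (P (u - t))"
  have shift: "?Q t (- (\<tau> *\<^sub>R t) + 1 *\<^sub>R u) = ?R t u" for t u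
    by (simp add: algebra_simps)
  have nP: "(\<integral>\<^sup>+t. ennreal (norm (P t)) \<partial>lborel) < \<infinity>"
    using P by (simp add: integrable_iff_bounded)
  have "(\<integral>\<^sup>+t. (\<integral>\<^sup>+u. ennreal (norm (?R t u)) \<partial>lborel) \<partial>lborel)
      = (\<integral>\<^sup>+u. (\<integral>\<^sup>+t. ennreal (norm (?R t u)) \<partial>lborel) \<partial>lborel)"
    by (rule lborel_pair.Fubini') measurable
  also have "\<dots> = (\<integral>\<^sup>+u. ennreal (norm (P u)) * (\<integral>\<^sup>+t. ennreal (norm (P (u - t))) \<partial>lborel) \<partial>lborel)"
    by (intro nn_integral_cong) (simp add: norm_mult ennreal_mult nn_integral_cmult)
  also have "\<dots> = (\<integral>\<^sup>+u. ennreal (norm (P u)) * (\<integral>\<^sup>+t. ennreal (norm (P t)) \<partial>lborel) \<partial>lborel)"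
    by (subst nn_integral_lborel_reflect) auto
  also have "\<dots> = (\<integral>\<^sup>+t. ennreal (norm (P t)) \<partial>lborel) * (\<integral>\<^sup>+t. ennreal (norm (P t)) \<partial>lborel)"
    by (rule nn_integral_multc) measurable
  also have "\<dots> < \<infinity>" using nP by (simp add: ennreal_mult_less_top)
  finally have nR: "(\<integral>\<^sup>+t. (\<integral>\<^sup>+u. ennreal (norm (?R t u)) \<partial>lborel) \<partial>lborel) < \<infinity>" .
  have R: "integrable (lborel \<Otimes>\<^sub>M lborel) (\<lambda>(t, u). ?R t u)"
    unfolding integrable_iff_bounded
    using nR by (auto simp: lborel.nn_integral_fst[symmetric] split_beta')
  \<comment> \<open>The shift depends on t but preserves each inner integral, so absolute
    integrability passes from \<open>?R\<close> to \<open>?Q\<close>.\<close>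
  have "(\<integral>\<^sup>+u. ennreal (norm (?Q t u)) \<partial>lborel) = (\<integral>\<^sup>+u. ennreal (norm (?R t u)) \<partial>lborel)" for t
    using nn_integral_lborel_affine[of "\<lambda>u. ennreal (norm (?Q t u))" 1 "- (\<tau> *\<^sub>R t)"]
    unfolding shift by simp
  then have Q: "integrable (lborel \<Otimes>\<^sub>M lborel) (\<lambda>(t, u). ?Q t u)"
    unfolding integrable_iff_bounded
    using nR by (auto simp: lborel.nn_integral_fst[symmetric] split_beta')
  have "(\<integral>u. (\<integral>t. ?Q t u \<partial>lborel) \<partial>lborel) = (\<integral>t. (\<integral>u. ?Q t u \<partial>lborel) \<partial>lborel)"
    by (rule lborel_pair.Fubini_integral[OF Q])
  also have "\<dots> = (\<integral>t. (\<integral>u. ?R t u \<partial>lborel) \<partial>lborel)"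
  proof (rule Bochner_Integration.integral_cong[OF refl])
    fix t show "(\<integral>u. ?Q t u \<partial>lborel) = (\<integral>u. ?R t u \<partial>lborel)"
      using integral_lborel_affine[of "?Q t" 1 "- (\<tau> *\<^sub>R t)"] unfolding shift by simp
  qed
  also have "\<dots> = (\<integral>u. (\<integral>t. ?R t u \<partial>lborel) \<partial>lborel)"
    by (rule lborel_pair.Fubini_integral[OF R, symmetric])
  also have "\<dots> = (\<integral>u. P u * cnj (\<integral>t. P t \<partial>lborel) \<partial>lborel)"
  proof (rule Bochner_Integration.integral_cong[OF refl])
    fix u
    have "(\<integral>t. P (u - t) \<partial>lborel) = (\<integral>t. P t \<partial>lborel)"
      using integral_lborel_affine[of P "-1" u] by simp
    then show "(\<integral>t. ?R t u \<partial>lborel) = P u * cnj (\<integral>t. P t \<partial>lborel)"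
      by simp
  qed
  also have "\<dots> = (\<integral>t. P t \<partial>lborel) * cnj (\<integral>t. P t \<partial>lborel)"
    by (rule integral_mult_left_zero)
  finally show ?thesis by (rule sym)
qed

text \<open>The integrands agree for every t. This is the origin of 1-\<tau> and of the reflected
  window: it turns the conjugate of Wig_\<tau> g at w - z into a function of z - w, and hence a
  correlation into a convolution.\<close>

lemma Wig_reflect: "Wig (1 - \<tau>) (\<lambda>t. g (- t)) (- z) = cnj (Wig \<tau> g z)"
proof -
  let ?i = "\<lambda>t. cis (- (t \<bullet> snd z)) * g (fst z + \<tau> *\<^sub>R t) * cnj (g (fst z - (1 - \<tau>) *\<^sub>R t))"
  have eq: "cis (- (t \<bullet> snd (- z))) * g (- (fst (- z) + (1 - \<tau>) *\<^sub>R t)) *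
      cnj (g (- (fst (- z) - (1 - (1 - \<tau>)) *\<^sub>R t))) = cnj (?i t)" for t
    by (simp add: cis_cnj ac_simps)
  have "Wig (1 - \<tau>) (\<lambda>t. g (- t)) (- z) = (\<integral>t. cnj (?i t) \<partial>lborel)"
    unfolding Wig_def split_beta' eq ..
  also have "\<dots> = cnj (Wig \<tau> g z)"
    unfolding Wig_def split_beta' by (rule Bochner_Integration.integral_cnj)
  finally show ?thesis .
qed

lemma tame_lag_product:
  fixes f :: "real^'n::finite \<Rightarrow> complex"
  assumes w: "weight_function \<omega> K b" and f: "tame \<omega> f" and \<tau>: "0 < \<tau>" "\<tau> < 1"
  shows "integrable lborel (\<lambda>t. f (x + \<tau> *\<^sub>R t) * cnj (f (x - (1 - \<tau>) *\<^sub>R t)))"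
proof -
  note [measurable] = tame_measurable[OF f]
  obtain B where B: "\<And>x. norm (f x) \<le> B" using tame_bounded[OF f] by blast
  have "integrable lborel (\<lambda>t. f (x + \<tau> *\<^sub>R t))"
    using \<tau> by (intro integrable_lborel_affine rapidly_decreasing_integrable[OF w tame_rapid[OF f]]) auto
  then show ?thesis by (rule integrable_mult_bounded[where B = B]) (auto simp: B)
qed

text \<open>A formula of Moyal type. V(x,\<xi>) is the integral of P(t) = e^{-it\<xi>} f(t)
  cnj(g(t-x)), so |V|^2 is the integral over u of the autocorrelation of P. For fixed u the lag
  product of P is the lag product of f at u times the conjugate of a modulated lag product of g at
  u-x. Parseval's formula in the lag variable turns it into Wig_\<tau> f(u,\<eta>) against the
  conjugate of Wig_\<tau> g(u-x,\<eta>-\<xi>).\<close>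

lemma stft_square_le_convolution:
  fixes f g :: "real^'n::finite \<Rightarrow> complex"
  assumes w: "weight_function \<omega> K b" and f: "tame \<omega> f" and g: "tame \<omega> g"
    and \<tau>: "0 < \<tau>" "\<tau> < 1"
  shows "ennreal ((2 * pi) ^ CARD('n)) * ennreal ((norm (stft g f z))\<^sup>2)
    \<le> (\<integral>\<^sup>+w. ennreal (norm (Wig \<tau> f w)) * ennreal (norm (Wig (1 - \<tau>) (\<lambda>t. g (- t)) (z - w))) \<partial>lborel)"
proof -
  obtain x \<xi> where z: "z = (x, \<xi>)" by (cases z)
  note [measurable] = tame_measurable[OF f] tame_measurable[OF g]
  note [measurable] = Wig_measurable[OF tame_measurable[OF f]] Wig_measurable[OF tame_measurable[OF g]]
  note [measurable] = Wig_measurable[OF tame_measurable[OF f], unfolded borel_prod[symmetric]]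
    Wig_measurable[OF tame_measurable[OF g], unfolded borel_prod[symmetric]]
  obtain B where B: "\<And>x. norm (g x) \<le> B" using tame_bounded[OF g] by blast
  have B0: "0 \<le> B" using B[of undefined] by (rule order_trans[rotated]) simp
  let ?c = "(2 * pi) ^ CARD('n)"
  let ?P = "\<lambda>t. cis (- (t \<bullet> \<xi>)) * (f t * cnj (g (t - x)))"
  let ?I = "\<lambda>u. \<integral>t. ?P (u + \<tau> *\<^sub>R t) * cnj (?P (u - (1 - \<tau>) *\<^sub>R t)) \<partial>lborel"
  have "integrable lborel (\<lambda>t. f t * cnj (g (t - x)))"
    using rapidly_decreasing_integrable[OF w tame_rapid[OF f]]
    by (rule integrable_mult_bounded[where B = B]) (auto simp: B)
  then have P: "integrable lborel ?P"
    by (rule Bochner_Integration.integrable_bound) (auto simp: norm_mult)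
  have "complex_of_real ((norm (stft g f z))\<^sup>2) = (\<integral>t. ?P t \<partial>lborel) * cnj (\<integral>t. ?P t \<partial>lborel)"
    by (simp add: z stft_def fourier_def complex_norm_square del: of_real_power)
  also have "\<dots> = (\<integral>u. ?I u \<partial>lborel)"
    by (rule integral_autocorrelation[OF P])
  finally have "ennreal ((norm (stft g f z))\<^sup>2) = ennreal (norm (\<integral>u. ?I u \<partial>lborel))"
    by (metis norm_of_real abs_of_nonneg zero_le_power2)
  also have "\<dots> \<le> (\<integral>\<^sup>+u. ennreal (norm (?I u)) \<partial>lborel)"
    by (rule norm_integral_le_nn_integral)
  finally have "ennreal ?c * ennreal ((norm (stft g f z))\<^sup>2)
      \<le> ennreal ?c * (\<integral>\<^sup>+u. ennreal (norm (?I u)) \<partial>lborel)"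
    by (rule mult_left_mono) simp
  also have "\<dots> = (\<integral>\<^sup>+u. ennreal ?c * ennreal (norm (?I u)) \<partial>lborel)"
    by (rule nn_integral_cmult[symmetric]) measurable
  also have "\<dots> \<le> (\<integral>\<^sup>+u. (\<integral>\<^sup>+\<eta>. ennreal (norm (Wig \<tau> f (u, \<eta>))) *
      ennreal (norm (Wig \<tau> g (u - x, \<eta> - \<xi>))) \<partial>lborel) \<partial>lborel)"
  proof (intro nn_integral_mono)
    fix u :: "real^'n"
    let ?F = "\<lambda>t. f (u + \<tau> *\<^sub>R t) * cnj (f (u - (1 - \<tau>) *\<^sub>R t))"
    let ?G = "\<lambda>t. g (u - x + \<tau> *\<^sub>R t) * cnj (g (u - x - (1 - \<tau>) *\<^sub>R t))"
    let ?h = "\<lambda>t. cis (t \<bullet> \<xi>) * ?G t"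
    have F: "integrable lborel ?F" and G: "integrable lborel ?G"
      by (rule tame_lag_product[OF w _ \<tau>]; fact)+
    have h: "integrable lborel ?h"
      by (rule Bochner_Integration.integrable_bound[OF G]) (auto simp: norm_mult)
    have fF: "fourier ?F \<eta> = Wig \<tau> f (u, \<eta>)" for \<eta>
      by (simp add: fourier_def Wig_def mult.assoc)
    have fh: "fourier ?h \<eta> = Wig \<tau> g (u - x, \<eta> - \<xi>)" for \<eta>
      by (subst fourier_modulate) (simp add: fourier_def Wig_def mult.assoc)
    \<comment> \<open>Parseval's formula requires an integrable transform for each u, not just for
      almost every u.\<close>
    have "integrable lborel (\<lambda>\<eta>. Wig \<tau> g (u - x, \<eta>))"
      by (rule rapidly_decreasing_slice_integrable[OF w rapidly_decreasing_Wig[OF w g \<tau>]])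
         (auto simp: norm_snd_le)
    from integrable_lborel_affine[OF this, of 1 "- \<xi>"]
    have hh: "integrable lborel (fourier ?h)"
      unfolding fh by (simp add: fh[abs_def])
    have c: "continuous_on UNIV ?h"
      by (intro continuous_intros continuous_on_compose2[OF tame_continuous[OF g]]) auto
    have hB: "norm (?h t) \<le> B * B" for t
      using B B0 by (auto simp: norm_mult intro!: mult_mono)
    \<comment> \<open>In the product of the two phases the part depending on u cancels, and
      e^{-it\<xi>} remains. The rest is a regrouping of complex factors, done on abstract
      numbers.\<close>
    have PP: "?P (u + \<tau> *\<^sub>R t) * cnj (?P (u - (1 - \<tau>) *\<^sub>R t)) = ?F t * cnj (?h t)" for t
    proof -
      have "cis (- ((u + \<tau> *\<^sub>R t) \<bullet> \<xi>)) * cnj (cis (- ((u - (1 - \<tau>) *\<^sub>R t) \<bullet> \<xi>))) = cnj (cis (t \<bullet> \<xi>))"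
        by (simp add: cis_cnj cis_mult inner_simps algebra_simps)
      moreover have "u + \<tau> *\<^sub>R t - x = u - x + \<tau> *\<^sub>R t" "u - (1 - \<tau>) *\<^sub>R t - x = u - x - (1 - \<tau>) *\<^sub>R t"
        by (simp_all add: algebra_simps)
      moreover have "(a * (p * cnj q)) * cnj (b * (r * cnj s)) = (p * cnj r) * cnj (c * (q * cnj s))"
        if "a * cnj b = cnj c" for a b c p q r s :: complex
      proof -
        have "(a * (p * cnj q)) * cnj (b * (r * cnj s)) = (a * cnj b) * ((p * cnj r) * (cnj q * s))"
          by (simp add: ac_simps)
        then show ?thesis unfolding that by (simp add: ac_simps)
      qed
      ultimately show ?thesis by presburger
    qed
    have "of_real ?c * ?I u = (\<integral>\<eta>. fourier ?F \<eta> * cnj (fourier ?h \<eta>) \<partial>lborel)"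
      unfolding PP by (rule parseval[OF F h c hB hh])
    then have eq: "of_real ?c * ?I u = (\<integral>\<eta>. Wig \<tau> f (u, \<eta>) * cnj (Wig \<tau> g (u - x, \<eta> - \<xi>)) \<partial>lborel)"
      unfolding fF fh .
    have "ennreal ?c * ennreal (norm (?I u)) = ennreal (norm (of_real ?c * ?I u))"
      by (simp only: norm_mult norm_of_real) (simp add: ennreal_mult)
    also have "\<dots> \<le> (\<integral>\<^sup>+\<eta>. ennreal (norm (Wig \<tau> f (u, \<eta>) * cnj (Wig \<tau> g (u - x, \<eta> - \<xi>)))) \<partial>lborel)"
      unfolding eq by (rule norm_integral_le_nn_integral)
    finally show "ennreal ?c * ennreal (norm (?I u)) \<le> (\<integral>\<^sup>+\<eta>. ennreal (norm (Wig \<tau> f (u, \<eta>))) *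
      ennreal (norm (Wig \<tau> g (u - x, \<eta> - \<xi>))) \<partial>lborel)"
      by (simp add: norm_mult ennreal_mult)
  qed
  also have "\<dots> = (\<integral>\<^sup>+w. ennreal (norm (Wig \<tau> f w)) * ennreal (norm (Wig \<tau> g (fst w - x, snd w - \<xi>))) \<partial>lborel)"
  proof -
    have "(\<lambda>w. ennreal (norm (Wig \<tau> f w)) * ennreal (norm (Wig \<tau> g (fst w - x, snd w - \<xi>))))
        \<in> borel_measurable (borel \<Otimes>\<^sub>M borel)"
      by measurable
    then show ?thesis unfolding borel_prod by (subst nn_integral_lborel_pair) simp_all
  qed
  also have "\<dots> = (\<integral>\<^sup>+w. ennreal (norm (Wig \<tau> f w)) *
      ennreal (norm (Wig (1 - \<tau>) (\<lambda>t. g (- t)) (z - w))) \<partial>lborel)"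
  proof (intro nn_integral_cong)
    fix w :: "(real^'n) \<times> (real^'n)"
    have "Wig (1 - \<tau>) (\<lambda>t. g (- t)) (z - w) = cnj (Wig \<tau> g (fst w - x, snd w - \<xi>))"
      using Wig_reflect[of \<tau> g "(fst w - x, snd w - \<xi>)"] by (cases w) (simp add: z)
    then show "ennreal (norm (Wig \<tau> f w)) * ennreal (norm (Wig \<tau> g (fst w - x, snd w - \<xi>)))
        = ennreal (norm (Wig \<tau> f w)) * ennreal (norm (Wig (1 - \<tau>) (\<lambda>t. g (- t)) (z - w)))"
      by simp
  qed
  finally show ?thesis .
qed

lemma Lp_weighted_stft_square_le:
  fixes f g :: "real^'n::finite \<Rightarrow> complex"
  assumes w: "weight_function \<omega> K b" and f: "tame \<omega> f" and g: "tame \<omega> g"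
    and \<tau>: "0 < \<tau>" "\<tau> < 1" and m: "0 \<le> m" and p: "1 \<le> p"
  shows "(Lp_norm (2 * p) (weighted \<omega> m (stft g f)))\<^sup>2
    \<le> ennreal (exp (2 * K * m)) * Lp_norm 1 (weighted \<omega> (2 * K * m) (Wig (1 - \<tau>) (\<lambda>t. g (- t)))) *
      Lp_norm p (weighted \<omega> (2 * K * m) (Wig \<tau> f))"
proof -
  let ?V = "weighted \<omega> m (stft g f)"
  let ?F = "weighted \<omega> (2 * K * m) (Wig \<tau> f)"
  let ?W = "Wig (1 - \<tau>) (\<lambda>t. g (- t))"
  let ?G = "weighted \<omega> (2 * K * m) ?W"
  note [measurable] = tame_measurable[OF f] tame_measurable[OF g]
  have gr: "(\<lambda>t. g (- t)) \<in> borel_measurable borel" by measurable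
  have [measurable]: "Wig \<tau> f \<in> borel_measurable borel" "?W \<in> borel_measurable borel"
    using Wig_measurable[OF tame_measurable[OF f]] Wig_measurable[OF gr] by auto
  have V [measurable]: "?V \<in> borel_measurable borel"
    by (intro weighted_measurable[OF w] stft_measurable tame_measurable[OF f] tame_measurable[OF g])
  have F [measurable]: "?F \<in> borel_measurable borel" and G [measurable]: "?G \<in> borel_measurable borel"
    by (intro weighted_measurable[OF w]; measurable)+
  \<comment> \<open>The factor e^{2Km} from splitting the weight is attached to the second function,
    so that the right-hand side is a plain convolution as in Young's inequality.\<close>
  have pt: "ennreal (norm ((?V z)\<^sup>2))
      \<le> (\<integral>\<^sup>+w. ennreal (norm (?F w)) * ennreal (norm (of_real (exp (2 * K * m)) * ?G (z - w))) \<partial>lborel)" for z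
  proof -
    have "ennreal (norm ((?V z)\<^sup>2)) = ennreal (exp (2 * m * \<omega> (norm z))) * ennreal ((norm (stft g f z))\<^sup>2)"
      by (simp add: norm_power norm_weighted power_mult_distrib ennreal_mult exp_double[symmetric] mult.assoc)
    also have "\<dots> \<le> ennreal (exp (2 * m * \<omega> (norm z))) *
        (ennreal ((2 * pi) ^ CARD('n)) * ennreal ((norm (stft g f z))\<^sup>2))"
    \<comment> \<open>The constant to be reached is weaker by (2 pi)^N \<ge> 1, so this factor is
      inserted for free.\<close>
    proof (intro mult_left_mono)
      have "1 \<le> (2 * pi) ^ CARD('n)" using pi_gt3 by (intro one_le_power) linarith
      then have "1 * ennreal ((norm (stft g f z))\<^sup>2)
          \<le> ennreal ((2 * pi) ^ CARD('n)) * ennreal ((norm (stft g f z))\<^sup>2)"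
        by (intro mult_right_mono) (auto simp flip: ennreal_1)
      then show "ennreal ((norm (stft g f z))\<^sup>2)
          \<le> ennreal ((2 * pi) ^ CARD('n)) * ennreal ((norm (stft g f z))\<^sup>2)" by simp
    qed simp
    also have "\<dots> \<le> ennreal (exp (2 * m * \<omega> (norm z))) *
        (\<integral>\<^sup>+w. ennreal (norm (Wig \<tau> f w)) * ennreal (norm (?W (z - w))) \<partial>lborel)"
      by (intro mult_left_mono stft_square_le_convolution[OF w f g \<tau>]) auto
    also have "\<dots> = (\<integral>\<^sup>+w. ennreal (exp (2 * m * \<omega> (norm z))) *
        (ennreal (norm (Wig \<tau> f w)) * ennreal (norm (?W (z - w)))) \<partial>lborel)"
      by (rule nn_integral_cmult[symmetric]) measurable
    also have "\<dots> \<le> (\<integral>\<^sup>+w. ennreal (norm (?F w)) * ennreal (norm (of_real (exp (2 * K * m)) * ?G (z - w))) \<partial>lborel)"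
    proof (intro nn_integral_mono)
      fix u :: "(real^'n) \<times> (real^'n)"
      have "norm z \<le> norm u + norm (z - u)"
        using norm_triangle_ineq[of u "z - u"] by simp
      then have "exp (2 * m * \<omega> (norm z)) \<le> exp (K * (2 * m)) *
          (exp (K * (2 * m) * \<omega> (norm u)) * exp (K * (2 * m) * \<omega> (norm (z - u))))"
        using m by (intro exp_weight_triangle[OF w]) auto
      then have "exp (2 * m * \<omega> (norm z)) * (norm (Wig \<tau> f u) * norm (?W (z - u)))
          \<le> exp (K * (2 * m)) * (exp (K * (2 * m) * \<omega> (norm u)) * exp (K * (2 * m) * \<omega> (norm (z - u)))) *
            (norm (Wig \<tau> f u) * norm (?W (z - u)))"
        by (rule mult_right_mono) simp
      also have "\<dots> = norm (?F u) * norm (of_real (exp (2 * K * m)) * ?G (z - u))"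
        unfolding norm_weighted norm_mult norm_of_real abs_exp_cancel by (simp only: ac_simps)
      finally show "ennreal (exp (2 * m * \<omega> (norm z))) *
          (ennreal (norm (Wig \<tau> f u)) * ennreal (norm (?W (z - u))))
          \<le> ennreal (norm (?F u)) * ennreal (norm (of_real (exp (2 * K * m)) * ?G (z - u)))"
        by (simp only: ennreal_mult[symmetric] norm_ge_zero mult_nonneg_nonneg exp_ge_zero ennreal_leI)
    qed
    finally show ?thesis .
  qed
  have G1: "Lp_norm 1 (\<lambda>w. of_real (exp (2 * K * m)) * ?G w) = ennreal (exp (2 * K * m)) * Lp_norm 1 ?G"
    unfolding Lp_norm_1 norm_mult norm_of_real abs_exp_cancel
    by (subst nn_integral_cmult[symmetric]) (auto simp: ennreal_mult)
  have "(Lp_norm (2 * p) ?V)\<^sup>2 \<le> Lp_norm p (\<lambda>z. (?V z)\<^sup>2)"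
    by (rule Lp_norm_double_square_le[OF V p])
  also have "\<dots> \<le> Lp_norm p ?F * Lp_norm 1 (\<lambda>w. of_real (exp (2 * K * m)) * ?G w)"
    by (rule Young_convolution[OF p F _ _ pt]) measurable
  finally show ?thesis unfolding G1 by (simp add: ac_simps)
qed

text \<open>|Rf(x,\<xi>)| = |f(x)| |f^(\<xi>)|, and both factors are bounded by the same weighted
  L^1 norm \<open>?S\<close> of V. Each bound carries (2 pi)^N times the squared L^2 norm of the
  window on the left; the product of the two is the denominator of \<open>D2\<close>.\<close>

lemma Rihaczek_bound_window:
  fixes f g :: "real^'n::finite \<Rightarrow> complex"
  assumes w: "weight_function \<omega> K b" and f: "tame \<omega> f" and g: "tame \<omega> g" and g0: "g \<noteq> (\<lambda>_. 0)"
    and \<tau>: "0 < \<tau>" "\<tau> < 1" and l: "0 \<le> l" and \<mu>: "0 \<le> \<mu>" and p: "1 \<le> p"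
  shows "ennreal (norm (weighted \<omega> l (Rihaczek f) z))
    \<le> D2 \<omega> K p l \<mu> g * ennreal (exp (2 * K * (K\<^sup>2 * l + \<mu>))) *
      Lp_norm 1 (weighted \<omega> (2 * K * (K\<^sup>2 * l + \<mu>)) (Wig (1 - \<tau>) (\<lambda>t. g (- t)))) *
      Lp_norm p (weighted \<omega> (2 * K * (K\<^sup>2 * l + \<mu>)) (Wig \<tau> f))"
proof -
  obtain x \<xi> where z: "z = (x, \<xi>)" by (cases z)
  let ?V = "stft g f" and ?C = "ennreal ((2 * pi) ^ CARD('n))"
  let ?Ng = "Lp_norm \<infinity> (weighted \<omega> (K\<^sup>2 * l) g)" and ?Nh = "Lp_norm \<infinity> (weighted \<omega> (K\<^sup>2 * l) (fourier g))"
  let ?S = "Lp_norm 1 (weighted \<omega> (K\<^sup>2 * l) ?V)"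
  let ?one = "\<lambda>_ :: (real^'n) \<times> (real^'n). 1 :: complex"
  let ?Q = "Lp_norm (conj_exponent (2 * p)) (weighted \<omega> (- \<mu>) ?one)"
  let ?m = "K\<^sup>2 * l + \<mu>"
  let ?X = "Lp_norm p (weighted \<omega> (2 * K * ?m) (Wig \<tau> f))"
  let ?L = "Lp_norm 1 (weighted \<omega> (2 * K * ?m) (Wig (1 - \<tau>) (\<lambda>t. g (- t))))"
  note [measurable] = tame_measurable[OF f] tame_measurable[OF g]
  have K: "1 \<le> K" by (rule weight_K[OF w])
  have Kl: "0 \<le> K * l" using K l by simp
  have KKl: "K * (K * l) = K\<^sup>2 * l" by (simp add: power2_eq_square)
  have V [measurable]: "?V \<in> borel_measurable borel"
    by (intro stft_measurable tame_measurable[OF f] tame_measurable[OF g])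

  \<comment> \<open>The squared L^2 norm of the window. It is positive because g is continuous and
    not identically 0, so division by it is legitimate.\<close>
  obtain \<gamma> where \<gamma>: "(\<integral>\<^sup>+t. ennreal ((norm (g t))\<^sup>2) \<partial>lborel) = ennreal \<gamma>" "\<gamma> > 0"
  proof -
    obtain B where B: "\<And>x. norm (g x) \<le> B" using tame_bounded[OF g] by blast
    have "integrable lborel (\<lambda>t. g t * cnj (g t))"
      using rapidly_decreasing_integrable[OF w tame_rapid[OF g]]
      by (rule integrable_mult_bounded[where B = B]) (auto simp: B)
    then have "(\<integral>\<^sup>+t. ennreal ((norm (g t))\<^sup>2) \<partial>lborel) < \<infinity>"
      by (simp add: integrable_iff_bounded norm_mult power2_eq_square)
    moreover have "(\<integral>\<^sup>+t. ennreal ((norm (g t))\<^sup>2) \<partial>lborel) \<noteq> 0"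
    proof
      assume "(\<integral>\<^sup>+t. ennreal ((norm (g t))\<^sup>2) \<partial>lborel) = 0"
      then have "AE t in lborel. g t = 0" by (subst (asm) nn_integral_0_iff_AE) auto
      then have "AE t in lborel. ennreal (norm (g t)) \<le> 0" by (rule eventually_mono) simp
      then have "esssup lborel (\<lambda>t. ennreal (norm (g t))) \<le> 0" by (intro esssup_I) auto
      then have "Lp_norm \<infinity> g = 0" by (simp add: Lp_norm_def)
      then have "g t = 0" for t
        using continuous_le_Lp_infinity[OF tame_continuous[OF g], of t] by simp
      with g0 show False by auto
    qed
    ultimately show ?thesis
      using that by (cases "\<integral>\<^sup>+t. ennreal ((norm (g t))\<^sup>2) \<partial>lborel") (auto simp: less_le)
  qed
  have L2: "Lp_norm 2 g ^ 4 = ennreal (\<gamma>\<^sup>2)"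
  proof -
    have "norm (g t) powr enn2real 2 = (norm (g t))\<^sup>2" for t
      by (simp flip: powr_numeral)
    then have "Lp_norm 2 g = ennreal (sqrt \<gamma>)"
      using \<gamma> by (simp add: Lp_norm_def powr_half_sqrt)
    moreover have "sqrt \<gamma> ^ 4 = \<gamma>\<^sup>2"
      using \<gamma> power_mult[of "sqrt \<gamma>" 2 2] by simp
    ultimately show ?thesis using \<gamma> by (simp add: ennreal_power)
  qed

  \<comment> \<open>\<open>K * l\<close> is the exponent that the split of the weight at (x, \<xi>)
    leaves on each component; the convolution bound raises it to
    \<open>K\<^sup>2 * l\<close>.\<close>
  have time: "ennreal (exp (K * l * \<omega> (norm x))) * (?C * (ennreal (norm (f x)) * ennreal \<gamma>))
      \<le> ennreal (exp (K\<^sup>2 * l)) * ?Ng * ?S"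
  proof -
    have "ennreal (exp (K * l * \<omega> (norm x))) * (?C * (ennreal (norm (f x)) * ennreal \<gamma>))
        \<le> ennreal (exp (K * l * \<omega> (norm x))) *
          (\<integral>\<^sup>+z. ennreal (norm (?V z)) * ennreal (norm (g (x - fst z))) \<partial>lborel)"
      using stft_time_bound[OF w f g, of x] by (intro mult_left_mono) (auto simp: \<gamma>)
    also have "\<dots> \<le> ennreal (exp (K * (K * l))) * Lp_norm \<infinity> (weighted \<omega> (K * (K * l)) g) *
        Lp_norm 1 (weighted \<omega> (K * (K * l)) ?V)"
    proof (rule weighted_convolution_bound[OF w tame_continuous[OF g] V _ _ Kl])
      show "fst \<in> borel_measurable (borel :: ((real^'n) \<times> (real^'n)) measure)"
        by (intro borel_measurable_continuous_onI continuous_intros)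
      show "norm (fst z) \<le> norm z" for z :: "(real^'n) \<times> (real^'n)"
        by (metis norm_fst_le prod.collapse)
    qed
    finally show ?thesis unfolding KKl .
  qed
  have frequency: "ennreal (exp (K * l * \<omega> (norm \<xi>))) * (?C * (ennreal (norm (fourier f \<xi>)) * ennreal \<gamma>))
      \<le> ennreal (exp (K\<^sup>2 * l)) * ?Nh * ?S"
  proof -
    have "ennreal (exp (K * l * \<omega> (norm \<xi>))) * (?C * (ennreal (norm (fourier f \<xi>)) * ennreal \<gamma>))
        \<le> ennreal (exp (K * l * \<omega> (norm \<xi>))) *
          (\<integral>\<^sup>+z. ennreal (norm (?V z)) * ennreal (norm (fourier g (\<xi> - snd z))) \<partial>lborel)"
      using stft_frequency_bound[OF w f g, of \<xi>] by (intro mult_left_mono) (auto simp: \<gamma>)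
    also have "\<dots> \<le> ennreal (exp (K * (K * l))) * Lp_norm \<infinity> (weighted \<omega> (K * (K * l)) (fourier g)) *
        Lp_norm 1 (weighted \<omega> (K * (K * l)) ?V)"
    proof (rule weighted_convolution_bound[OF w tame_fourier_continuous[OF g] V _ _ Kl])
      show "snd \<in> borel_measurable (borel :: ((real^'n) \<times> (real^'n)) measure)"
        by (intro borel_measurable_continuous_onI continuous_intros)
      show "norm (snd z) \<le> norm z" for z :: "(real^'n) \<times> (real^'n)"
        by (metis norm_snd_le prod.collapse)
    qed
    finally show ?thesis unfolding KKl .
  qed

  \<comment> \<open>Hoelder's inequality for e^{m\<omega>}V and e^{-\<mu>\<omega>} with m = K^2 l +
    \<mu>, so that the two exponents add up to K^2 l.\<close>
  have S: "?S\<^sup>2 \<le> ?Q\<^sup>2 * (ennreal (exp (2 * K * ?m)) * ?L * ?X)"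
  proof -
    have "1 \<le> 2 * p"
      using mult_mono[of 1 2 1 p] p by simp
    then have "(\<integral>\<^sup>+z. ennreal (norm (weighted \<omega> ?m ?V z)) * ennreal (norm (weighted \<omega> (- \<mu>) ?one z)) \<partial>lborel)
        \<le> Lp_norm (2 * p) (weighted \<omega> ?m ?V) * ?Q"
      by (rule Holder_Lp_norm) (intro weighted_measurable[OF w]; measurable)+
    also have "(\<integral>\<^sup>+z. ennreal (norm (weighted \<omega> ?m ?V z)) * ennreal (norm (weighted \<omega> (- \<mu>) ?one z)) \<partial>lborel) = ?S"
      unfolding Lp_norm_1
    proof (intro nn_integral_cong)
      fix v :: "(real^'n) \<times> (real^'n)"
      have "norm (weighted \<omega> ?m ?V v) * norm (weighted \<omega> (- \<mu>) ?one v)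
          = (exp (?m * \<omega> (norm v)) * exp (- \<mu> * \<omega> (norm v))) * norm (?V v)"
        by (simp add: norm_weighted)
      also have "\<dots> = norm (weighted \<omega> (K\<^sup>2 * l) ?V v)"
        unfolding norm_weighted exp_add[symmetric] by (simp add: algebra_simps)
      finally show "ennreal (norm (weighted \<omega> ?m ?V v)) * ennreal (norm (weighted \<omega> (- \<mu>) ?one v))
          = ennreal (norm (weighted \<omega> (K\<^sup>2 * l) ?V v))"
        by (simp only: ennreal_mult[symmetric] norm_ge_zero)
    qed
    finally have "?S\<^sup>2 \<le> (Lp_norm (2 * p) (weighted \<omega> ?m ?V) * ?Q)\<^sup>2"
      by (rule power_mono) simp
    also have "\<dots> = ?Q\<^sup>2 * (Lp_norm (2 * p) (weighted \<omega> ?m ?V))\<^sup>2"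
      by (simp add: power_mult_distrib mult.commute)
    also have "\<dots> \<le> ?Q\<^sup>2 * (ennreal (exp (2 * K * ?m)) * ?L * ?X)"
      using l \<mu> by (intro mult_left_mono Lp_weighted_stft_square_le[OF w f g \<tau> _ p]) auto
    finally show ?thesis .
  qed

  have E: "exp (K * l) * (exp (K\<^sup>2 * l) * exp (K\<^sup>2 * l)) = exp (K * (1 + 2 * K) * l)"
    by (simp add: exp_add[symmetric] power2_eq_square algebra_simps)
  let ?\<beta> = "(2 * pi) ^ (2 * CARD('n)) * \<gamma>\<^sup>2"
  have \<beta>: "?\<beta> > 0" using \<gamma> by simp
  have inverse_cancel: "ennreal (inverse r) * ennreal r = 1" if "r > 0" for r :: real
    using that by (simp flip: ennreal_mult ennreal_1)
  have "norm (weighted \<omega> l (Rihaczek f) z) \<le> exp (K * l) *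
      (exp (K * l * \<omega> (norm x)) * exp (K * l * \<omega> (norm \<xi>))) * (norm (f x) * norm (fourier f \<xi>))"
    unfolding norm_weighted z norm_Rihaczek
    using l by (intro mult_right_mono exp_weight_triangle[OF w] norm_Pair_le) auto
  then have "ennreal (norm (weighted \<omega> l (Rihaczek f) z)) \<le> ennreal (exp (K * l)) *
      (ennreal (exp (K * l * \<omega> (norm x))) * ennreal (exp (K * l * \<omega> (norm \<xi>)))) *
      (ennreal (norm (f x)) * ennreal (norm (fourier f \<xi>)))"
    by (simp only: ennreal_mult[symmetric] norm_ge_zero mult_nonneg_nonneg exp_ge_zero ennreal_leI)
  \<comment> \<open>The denominators stay on the left until the end, where their product
    \<open>?\<beta>\<close> is a positive real and can be cancelled.\<close>
  then have "(?C * ennreal \<gamma>) * (?C * ennreal \<gamma>) * ennreal (norm (weighted \<omega> l (Rihaczek f) z))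
      \<le> (?C * ennreal \<gamma>) * (?C * ennreal \<gamma>) * (ennreal (exp (K * l)) *
      (ennreal (exp (K * l * \<omega> (norm x))) * ennreal (exp (K * l * \<omega> (norm \<xi>)))) *
      (ennreal (norm (f x)) * ennreal (norm (fourier f \<xi>))))"
    by (rule mult_left_mono) simp
  also have "\<dots> = ennreal (exp (K * l)) *
      ((ennreal (exp (K * l * \<omega> (norm x))) * (?C * (ennreal (norm (f x)) * ennreal \<gamma>))) *
       (ennreal (exp (K * l * \<omega> (norm \<xi>))) * (?C * (ennreal (norm (fourier f \<xi>)) * ennreal \<gamma>))))"
    by (simp only: ac_simps)
  also have "\<dots> \<le> ennreal (exp (K * l)) *
      ((ennreal (exp (K\<^sup>2 * l)) * ?Ng * ?S) * (ennreal (exp (K\<^sup>2 * l)) * ?Nh * ?S))"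
    by (intro mult_left_mono mult_mono time frequency) auto
  also have "\<dots> = (ennreal (exp (K * l)) * (ennreal (exp (K\<^sup>2 * l)) * ennreal (exp (K\<^sup>2 * l)))) * ?Ng * ?Nh * ?S\<^sup>2"
    unfolding power2_eq_square[of "Lp_norm _ _"] by (simp only: ac_simps)
  also have "ennreal (exp (K * l)) * (ennreal (exp (K\<^sup>2 * l)) * ennreal (exp (K\<^sup>2 * l))) = ennreal (exp (K * (1 + 2 * K) * l))"
    by (simp only: ennreal_mult[symmetric] mult_nonneg_nonneg exp_ge_zero E)
  also have "ennreal (exp (K * (1 + 2 * K) * l)) * ?Ng * ?Nh * ?S\<^sup>2
      \<le> ennreal (exp (K * (1 + 2 * K) * l)) * ?Ng * ?Nh * (?Q\<^sup>2 * (ennreal (exp (2 * K * ?m)) * ?L * ?X))"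
    by (intro mult_left_mono S) auto
  also have "\<dots> = (ennreal (exp (K * (1 + 2 * K) * l)) * ?Ng * ?Nh * ?Q\<^sup>2) * ennreal (exp (2 * K * ?m)) * ?L * ?X"
    by (simp only: ac_simps)
  also have "(?C * ennreal \<gamma>) * (?C * ennreal \<gamma>) = ennreal ?\<beta>"
    using \<gamma> by (simp add: power_mult power2_eq_square power_mult_distrib mult_ac flip: ennreal_mult)
  finally have main: "ennreal ?\<beta> * ennreal (norm (weighted \<omega> l (Rihaczek f) z))
      \<le> (ennreal (exp (K * (1 + 2 * K) * l)) * ?Ng * ?Nh * ?Q\<^sup>2) * ennreal (exp (2 * K * ?m)) * ?L * ?X" .
  have "D2 \<omega> K p l \<mu> g = (ennreal (exp (K * (1 + 2 * K) * l)) * ?Ng * ?Nh * ?Q\<^sup>2) * ennreal (inverse ?\<beta>)"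
    using \<beta> \<gamma> unfolding D2_def L2
    by (simp only: ennreal_mult[symmetric] divide_ennreal_def inverse_ennreal zero_le_power2 zero_le_power
        mult_nonneg_nonneg pi_ge_zero zero_le_numeral)
  moreover have "ennreal (norm (weighted \<omega> l (Rihaczek f) z))
      = ennreal (inverse ?\<beta>) * (ennreal ?\<beta> * ennreal (norm (weighted \<omega> l (Rihaczek f) z)))"
    by (simp only: mult.assoc[symmetric] inverse_cancel[OF \<beta>] mult_1_left)
  moreover have "\<dots> \<le> ennreal (inverse ?\<beta>) *
      ((ennreal (exp (K * (1 + 2 * K) * l)) * ?Ng * ?Nh * ?Q\<^sup>2) * ennreal (exp (2 * K * ?m)) * ?L * ?X)"
    by (intro mult_left_mono main) simp
  ultimately show ?thesis by (simp only: ac_simps)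
qed

text \<open>The infimum may be \<open>0\<close> and \<open>0 * \<infinity> = 0\<close> in \<^typ>\<open>ennreal\<close>, hence the finiteness of \<open>X\<close>.\<close>

lemma le_INF_mult_ennreal:
  fixes X :: ennreal
  assumes A: "A \<noteq> {}" and X: "X < \<infinity>" and le: "\<And>g. g \<in> A \<Longrightarrow> y \<le> T g * X"
  shows "y \<le> (INF g\<in>A. T g) * X"
proof (cases "X = 0")
  case True
  then show ?thesis using A le by fastforce
next
  case False
  with X obtain x where x: "X = ennreal x" "x > 0" by (cases X) (auto simp: less_le)
  have inv: "X * ennreal (1 / x) = 1"
    using x by (simp flip: ennreal_mult ennreal_1)
  have "y * ennreal (1 / x) \<le> (INF g\<in>A. T g)"
  proof (rule INF_greatest)
    fix g assume "g \<in> A"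
    then have "y * ennreal (1 / x) \<le> T g * X * ennreal (1 / x)"
      by (intro mult_right_mono le) auto
    then show "y * ennreal (1 / x) \<le> T g" by (simp only: mult.assoc inv mult_1_right)
  qed
  then have "y * ennreal (1 / x) * X \<le> (INF g\<in>A. T g) * X"
    by (rule mult_right_mono) simp
  then show ?thesis by (simp only: mult.assoc mult.commute[of "ennreal (1 / x)" X] inv mult_1_right)
qed

text \<open>Unless f = 0, f itself is an admissible window, so the infimum ranges over a non-empty
  set; for f = 0 the left-hand side vanishes. The norm of the Wigner transform is finite by its
  rapid decay, which allows the infimum to be taken in front of it.\<close>

theorem Lp_infinity_weighted_Rihaczek_le:
  fixes f :: "real^'n::finite \<Rightarrow> complex"
  assumes w: "weight_function \<omega> K b" and f: "f \<in> S_space \<omega>" and \<tau>: "0 < \<tau>" "\<tau> < 1"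
    and l: "0 \<le> l" and \<mu>: "0 \<le> \<mu>" and p: "1 \<le> p"
  shows "Lp_norm \<infinity> (weighted \<omega> l (Rihaczek f))
    \<le> D4 TYPE('n) \<omega> K p \<tau> l \<mu> * Lp_norm p (weighted \<omega> (2 * K * (K\<^sup>2 * l + \<mu>)) (Wig \<tau> f))"
proof -
  have tf: "tame \<omega> f" by (rule S_space_tame[OF w f])
  have m: "weighted \<omega> l (Rihaczek f) \<in> borel_measurable borel"
    by (intro weighted_measurable[OF w] Rihaczek_measurable[OF tf])
  show ?thesis
  proof (cases "f = (\<lambda>_. 0)")
    case True
    have 0: "ennreal (norm (weighted \<omega> l (Rihaczek f) z)) = 0" for z
      using norm_Rihaczek[of f "fst z" "snd z"] True by (simp add: norm_weighted)
    have "esssup lborel (\<lambda>z. ennreal (norm (weighted \<omega> l (Rihaczek f) z))) \<le> 0"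
      unfolding 0 by (rule esssup_I) auto
    then show ?thesis by (simp add: Lp_norm_def)
  next
    case False
    have M: "0 \<le> 2 * K * (K\<^sup>2 * l + \<mu>)" using weight_K[OF w] l \<mu> by simp
    have X: "Lp_norm p (weighted \<omega> (2 * K * (K\<^sup>2 * l + \<mu>)) (Wig \<tau> f)) < \<infinity>"
      by (intro rapidly_decreasing_Lp_finite[OF w] rapidly_decreasing_weighted[OF w]
          rapidly_decreasing_Wig[OF w tf \<tau>] M p)
    have "ennreal (norm (weighted \<omega> l (Rihaczek f) z))
        \<le> D4 TYPE('n) \<omega> K p \<tau> l \<mu> * Lp_norm p (weighted \<omega> (2 * K * (K\<^sup>2 * l + \<mu>)) (Wig \<tau> f))" for z
      unfolding D4_def
    proof (rule le_INF_mult_ennreal[OF _ X])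
      show "{g \<in> S_space \<omega> :: (real^'n \<Rightarrow> complex) set. g \<noteq> (\<lambda>_. 0)} \<noteq> {}"
        using f False by blast
    qed (auto intro!: Rihaczek_bound_window[OF w tf _ _ \<tau> l \<mu> p] S_space_tame[OF w])
    then show ?thesis using m by (auto simp: Lp_norm_def intro!: esssup_I)
  qed
qed

theorem theorem3p4:
  fixes \<omega> :: "real \<Rightarrow> real" and K b \<tau> :: real and p :: ennreal
  assumes "weight_function \<omega> K b"
    and "1 \<le> p"
    and "0 < \<tau>" and "\<tau> < 1"
  shows "(\<forall>l\<ge>0. \<forall>f \<in> (S_space \<omega> :: (real^'n::finite \<Rightarrow> complex) set).
            (Lp_norm \<infinity> (weighted \<omega> l (Wig \<tau> f)))\<^sup>2
              \<le> ennreal (D3 CARD('n) K \<tau> l) *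
                Lp_norm p (weighted \<omega> (4 * K\<^sup>2 * l) (Rihaczek f)) *
                Lp_norm (conj_exponent p) (weighted \<omega> (4 * K\<^sup>2 * l) (Rihaczek f)))
       \<and> (\<forall>l\<ge>0. \<forall>\<mu>. \<mu> > 2 * real CARD('n) / (b * enn2real (conj_exponent (2 * p))) \<longrightarrow>
           (\<forall>f \<in> (S_space \<omega> :: (real^'n \<Rightarrow> complex) set).
            Lp_norm \<infinity> (weighted \<omega> l (Rihaczek f))
              \<le> D4 TYPE('n) \<omega> K p \<tau> l \<mu> *
                Lp_norm p (weighted \<omega> (2 * K * (K\<^sup>2 * l + \<mu>)) (Wig \<tau> f))))"
proof (intro conjI allI impI ballI)
  fix l :: real and f :: "real^'n \<Rightarrow> complex"
  assume "0 \<le> l" "f \<in> S_space \<omega>"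
  then show "(Lp_norm \<infinity> (weighted \<omega> l (Wig \<tau> f)))\<^sup>2
      \<le> ennreal (D3 CARD('n) K \<tau> l) *
        Lp_norm p (weighted \<omega> (4 * K\<^sup>2 * l) (Rihaczek f)) *
        Lp_norm (conj_exponent p) (weighted \<omega> (4 * K\<^sup>2 * l) (Rihaczek f))"
    using assms by (intro Lp_infinity_weighted_Wig_le S_space_tame)
next
  fix l \<mu> :: real and f :: "real^'n \<Rightarrow> complex"
  assume l: "0 \<le> l" and \<mu>: "\<mu> > 2 * real CARD('n) / (b * enn2real (conj_exponent (2 * p)))"
    and f: "f \<in> S_space \<omega>"
  have "0 \<le> 2 * real CARD('n) / (b * enn2real (conj_exponent (2 * p)))"
    using weight_b[OF assms(1)] by (intro divide_nonneg_nonneg mult_nonneg_nonneg) auto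
  with \<mu> have "0 \<le> \<mu>" by linarith
  then show "Lp_norm \<infinity> (weighted \<omega> l (Rihaczek f))
      \<le> D4 TYPE('n) \<omega> K p \<tau> l \<mu> * Lp_norm p (weighted \<omega> (2 * K * (K\<^sup>2 * l + \<mu>)) (Wig \<tau> f))"
    using assms l f by (intro Lp_infinity_weighted_Rihaczek_le)
qed

end
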